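(* Let $1\le t\le n$, let $1\le b_1\le\cdots\le b_n$ be integers, $m=b_1+\cdots+b_n$, $k$ a field, $S=k[x_{11},\dots,x_{1b_1},\dots,x_{n1},\dots,x_{nb_n}]$, $P_j=(x_{j1},\dots,x_{jb_j})$ for $1\le j\le n$, and let $$I_{n,t}=\sum_{1\le j_1<\cdots<j_t\le n}P_{j_1}\cdots P_{j_t}.$$ There exists a labeled regular polytopal cell complex $\Gamma_{n,t}\subset\mathbb{R}^{m-t}$ that supports a $\mathbb{Z}^t$-graded minimal free resolution of $I_{n,t}$. Explicitly, $\Gamma_{n,1}=\Delta(P_1+\cdots+P_n)$ and, for $t\ge 2$, $$\Gamma_{n,t}=\bigcup_{i=t-1}^{n-1}\bigl[\Gamma_{i,t-1}\times\Delta(Q_{i+1})\bigr],$$ where $\Delta(Q_{i+1})$ is the simplex with vertices on the variables generating $Q_{i+1}=\sum_{j=i+1}^{n}P_j$, and where for $q\le p\le n$ the complex $\Gamma_{p,q}$ is the one obtained by the same construction from $P_1,\dots,P_p$ (with $n,t$ replaced by $p,q$). Moreover, $\Gamma_{s,t}$ is connected, and as labeled polytopes, $\Gamma_{s,t}\subset\Gamma_{s+1,t}$ for all $s$, $t\le s\le n-1$.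
   Context: Labeled complexes and cellular resolutions: let $I$ be a monomial ideal in a polynomial ring $R$ in $N$ variables over a field, with minimal monomial generating set $G(I)$. Let $X$ be a regular cell complex with vertices labeled by the elements of $G(I)$ and with an incidence function $\epsilon$. Each nonempty face $F$ is labeled by $\mathbf{m}_F$, the least common multiple of the labels of its vertices, and its degree is the exponent vector of $\mathbf{m}_F$ in $\mathbb{Z}^N$. The cellular complex $\mathbf{F}_X$ is the $\mathbb{Z}^N$-graded module $\bigoplus_{\emptyset\ne F\in X}RF$, where $RF$ is free with one generator in the degree of $F$, with differential $\partial(F)=\sum_{\emptyset\neq F'\in X}\epsilon(F,F')\frac{\mathbf{m}_F}{\mathbf{m}_{F'}}F'$, where $\epsilon(F,F')$ is nonzero only if $F'$ is a codimension-one face of $F$, in which case it is $\pm1$. One says $X$ supports a (minimal) free resolution of $I$ if $\mathbf{F}_X$ is a (minimal) free resolution of $I$. The phrase "$\mathbb{Z}^t$-graded" is the paper's own wording; the paper gives no separate definition of this grading. A polytopal cell complex is one whose cells are convex polytopes, any two meeting in a common (possibly empty) face. Notation: for an ideal $Q$ generated by a set of variables, $\Delta(Q)$ denotes the simplex (with all its faces) whose vertices are labeled by the variables generating $Q$. If $X,Y$ are labeled complexes whose labels involve disjoint sets of variables, $X\times Y$ is the complex with cells $F\times G$ ($F\in X$, $G\in Y$), the vertex $(v,w)$ being labeled by the product of the labels of $v$ and $w$. In the unions, vertices with the same label are identified, and faces with the same set of vertex labels are identified. An inclusion is meant as an inclusion of labeled complexes under this identification. *)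

theory Defs
  imports "HOL-Analysis.Analysis" "HOL-Library.Poly_Mapping"
begin

section \<open>Monomials, polynomials and ideals\<close>

text \<open>
  A monomial is identified with its exponent vector, so products of monomials are sums.
  The polynomial ring over a field in the variables \<open>'v\<close> is the type \<open>('v, 'k) mpoly\<close>.
\<close>

type_synonym 'v monomial = "'v \<Rightarrow>\<^sub>0 nat"
type_synonym ('v, 'k) mpoly = "'v monomial \<Rightarrow>\<^sub>0 'k"

definition var :: "'v \<Rightarrow> 'v monomial" where
  "var v = Poly_Mapping.single v 1"

definition mon :: "'v monomial \<Rightarrow> ('v, 'k::field) mpoly" where
  "mon u = Poly_Mapping.single u 1"

definition monomial_dvd :: "'v monomial \<Rightarrow> 'v monomial \<Rightarrow> bool" where
  "monomial_dvd u u' \<longleftrightarrow> (\<exists>w. u' = u + w)"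

definition lcm_monomial :: "'v::finite monomial set \<Rightarrow> 'v monomial" where
  "lcm_monomial A = Abs_poly_mapping (\<lambda>v. SUP u\<in>A. Poly_Mapping.lookup u v)"

text \<open>An ideal is a submodule of the ring, viewed as a module over itself.\<close>

definition ideal_gen :: "'r::comm_ring_1 set \<Rightarrow> 'r set" where
  "ideal_gen A = module.span (*) A"

definition ideal_prod :: "'i set \<Rightarrow> ('i \<Rightarrow> 'r::comm_ring_1 set) \<Rightarrow> 'r set" where
  "ideal_prod J P = ideal_gen {(\<Prod>j\<in>J. f j) | f. \<forall>j\<in>J. f j \<in> P j}"

definition ideal_sum :: "'r::comm_ring_1 set set \<Rightarrow> 'r set" where
  "ideal_sum \<A> = ideal_gen (\<Union>\<A>)"

definition var_ideal :: "'v set \<Rightarrow> ('v, 'k::field) mpoly set" where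
  "var_ideal V = ideal_gen ((\<lambda>v. mon (var v)) ` V)"

text \<open>For a monomial ideal this is the minimal monomial generating set \<open>G(I)\<close>.\<close>

definition min_gens :: "('v, 'k::field) mpoly set \<Rightarrow> 'v monomial set" where
  "min_gens I = {u. mon u \<in> I \<and> (\<forall>u'. mon u' \<in> I \<and> monomial_dvd u' u \<longrightarrow> u' = u)}"

text \<open>
  The ideal \<open>I\<^bsub>p,q\<^esub>\<close>, where \<open>B j\<close> is the set of variables generating \<open>P\<^sub>j\<close>.
\<close>

definition I_ideal :: "(nat \<Rightarrow> 'v set) \<Rightarrow> nat \<Rightarrow> nat \<Rightarrow> ('v, 'k::field) mpoly set" where
  "I_ideal B p q = ideal_sum {ideal_prod J (\<lambda>j. var_ideal (B j)) | J. J \<subseteq> {1..p} \<and> card J = q}"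

section \<open>Graded free resolutions\<close>

text \<open>The free module on the basis \<open>B\<close>, as a set of coefficient functions.\<close>

definition free_mod :: "'b set \<Rightarrow> ('b \<Rightarrow> 'r::comm_ring_1) set" where
  "free_mod B = {f. finite {b. f b \<noteq> 0} \<and> {b. f b \<noteq> 0} \<subseteq> B}"

definition hom_free :: "'b set \<Rightarrow> 'b set \<Rightarrow> (('b \<Rightarrow> 'r::comm_ring_1) \<Rightarrow> ('b \<Rightarrow> 'r)) \<Rightarrow> bool" where
  "hom_free B C d \<longleftrightarrow>
     (\<forall>f \<in> free_mod B. d f \<in> free_mod C) \<and>
     (\<forall>f \<in> free_mod B. \<forall>g \<in> free_mod B. d (\<lambda>b. f b + g b) = (\<lambda>c. d f c + d g c)) \<and>
     (\<forall>r. \<forall>f \<in> free_mod B. d (\<lambda>b. r * f b) = (\<lambda>c. r * d f c))"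

definition hom_ring :: "'b set \<Rightarrow> (('b \<Rightarrow> 'r::comm_ring_1) \<Rightarrow> 'r) \<Rightarrow> bool" where
  "hom_ring B e \<longleftrightarrow>
     (\<forall>f \<in> free_mod B. \<forall>g \<in> free_mod B. e (\<lambda>b. f b + g b) = e f + e g) \<and>
     (\<forall>r. \<forall>f \<in> free_mod B. e (\<lambda>b. r * f b) = r * e f)"

text \<open>
  Exactness of \<open>\<dots> \<rightarrow> F\<^sub>2 \<rightarrow> F\<^sub>1 \<rightarrow> F\<^sub>0 \<rightarrow> I \<rightarrow> 0\<close>, where \<open>F\<^sub>i\<close> is free on \<open>B i\<close>, the map
  \<open>d i\<close> goes from \<open>F\<^bsub>i+1\<^esub>\<close> to \<open>F\<^sub>i\<close>, and \<open>e\<close> is the augmentation.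
\<close>

definition free_resolution ::
  "(nat \<Rightarrow> 'b set) \<Rightarrow> (nat \<Rightarrow> ('b \<Rightarrow> 'r::comm_ring_1) \<Rightarrow> ('b \<Rightarrow> 'r)) \<Rightarrow> (('b \<Rightarrow> 'r) \<Rightarrow> 'r) \<Rightarrow> 'r set \<Rightarrow> bool"
where
  "free_resolution B d e I \<longleftrightarrow>
     (\<forall>i. hom_free (B (Suc i)) (B i) (d i)) \<and> hom_ring (B 0) e \<and>
     e ` free_mod (B 0) = I \<and>
     {f \<in> free_mod (B 0). e f = 0} = d 0 ` free_mod (B 1) \<and>
     (\<forall>i. {f \<in> free_mod (B (Suc i)). d i f = (\<lambda>_. 0)} = d (Suc i) ` free_mod (B (Suc (Suc i))))"

text \<open>Minimality: the image of each differential lies in \<open>\<mm>F\<^sub>i\<close>, \<open>\<mm>\<close> the ideal of all variables.\<close>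

definition minimal_differentials ::
  "(nat \<Rightarrow> 'b set) \<Rightarrow> (nat \<Rightarrow> ('b \<Rightarrow> ('v, 'k::field) mpoly) \<Rightarrow> ('b \<Rightarrow> ('v, 'k) mpoly)) \<Rightarrow> bool"
where
  "minimal_differentials B d \<longleftrightarrow>
     (\<forall>i. \<forall>f \<in> free_mod (B (Suc i)). \<forall>c. d i f c \<in> var_ideal UNIV)"

text \<open>
  A grading of the polynomial ring by \<open>\<int>\<^sup>J\<close> in which the variables are homogeneous is given by the
  degrees \<open>w v \<in> \<int>\<^sup>J\<close> of the variables. Degrees are functions of which only the
  components in \<open>J\<close> matter.
\<close>

definition mon_degree :: "('v::finite \<Rightarrow> 'j \<Rightarrow> int) \<Rightarrow> 'v monomial \<Rightarrow> 'j \<Rightarrow> int" where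
  "mon_degree w u j = (\<Sum>v\<in>UNIV. int (Poly_Mapping.lookup u v) * w v j)"

definition homogeneous ::
  "'j set \<Rightarrow> ('v::finite \<Rightarrow> 'j \<Rightarrow> int) \<Rightarrow> ('j \<Rightarrow> int) \<Rightarrow> ('v, 'k::field) mpoly \<Rightarrow> bool"
where
  "homogeneous J w a p \<longleftrightarrow> (\<forall>u \<in> Poly_Mapping.keys p. \<forall>j\<in>J. mon_degree w u j = a j)"

text \<open>
  The elements of degree \<open>a\<close> in the graded free module in which the basis element \<open>b\<close> has the
  degree of the monomial \<open>g b\<close>.
\<close>

definition graded_piece ::
  "'j set \<Rightarrow> ('v::finite \<Rightarrow> 'j \<Rightarrow> int) \<Rightarrow> ('b \<Rightarrow> 'v monomial) \<Rightarrow> 'b set \<Rightarrow> ('j \<Rightarrow> int)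
    \<Rightarrow> ('b \<Rightarrow> ('v, 'k::field) mpoly) set"
where
  "graded_piece J w g B a =
     {f \<in> free_mod B. \<forall>b\<in>B. homogeneous J w (\<lambda>j. a j - mon_degree w (g b) j) (f b)}"

definition graded_maps ::
  "'j set \<Rightarrow> ('v::finite \<Rightarrow> 'j \<Rightarrow> int) \<Rightarrow> ('b \<Rightarrow> 'v monomial) \<Rightarrow> (nat \<Rightarrow> 'b set)
    \<Rightarrow> (nat \<Rightarrow> ('b \<Rightarrow> ('v, 'k::field) mpoly) \<Rightarrow> ('b \<Rightarrow> ('v, 'k) mpoly))
    \<Rightarrow> (('b \<Rightarrow> ('v, 'k) mpoly) \<Rightarrow> ('v, 'k) mpoly) \<Rightarrow> bool"
where
  "graded_maps J w g B d e \<longleftrightarrow>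
     (\<forall>i a. d i ` graded_piece J w g (B (Suc i)) a \<subseteq> graded_piece J w g (B i) a) \<and>
     (\<forall>a. \<forall>f \<in> graded_piece J w g (B 0) a. homogeneous J w a (e f))"

section \<open>Labeled polytopal complexes\<close>

text \<open>Polytopal complexes are automatically regular; the empty face is included as a cell.\<close>

definition polytopal_complex :: "'a::euclidean_space set set \<Rightarrow> bool" where
  "polytopal_complex X \<longleftrightarrow>
     finite X \<and> (\<forall>F\<in>X. polytope F) \<and>
     (\<forall>F\<in>X. \<forall>G. G face_of F \<longrightarrow> G \<in> X) \<and>
     (\<forall>F\<in>X. \<forall>G\<in>X. (F \<inter> G) face_of F \<and> (F \<inter> G) face_of G)"

definition verts :: "'a::real_vector set \<Rightarrow> 'a set" where
  "verts F = {v. v extreme_point_of F}"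

text \<open>A labeled complex: its set of cells, and the labels of its vertices.\<close>

type_synonym ('a, 'v) labeled_complex = "'a set set \<times> ('a \<Rightarrow> 'v monomial)"

abbreviation cells :: "('a, 'v) labeled_complex \<Rightarrow> 'a set set" where
  "cells \<equiv> fst"

abbreviation vlabel :: "('a, 'v) labeled_complex \<Rightarrow> 'a \<Rightarrow> 'v monomial" where
  "vlabel \<equiv> snd"

definition labeled_by :: "('a::euclidean_space, 'v) labeled_complex \<Rightarrow> 'v monomial set \<Rightarrow> bool" where
  "labeled_by L A \<longleftrightarrow> bij_betw (vlabel L) (\<Union>F\<in>cells L. verts F) A"

definition face_label :: "('a::euclidean_space, 'v::finite) labeled_complex \<Rightarrow> 'a set \<Rightarrow> 'v monomial"
where
  "face_label L F = lcm_monomial (vlabel L ` verts F)"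

text \<open>
  Being embedded in \<open>\<real>\<^sup>d\<close>, where \<open>d\<close> may vary and may be \<open>0\<close>: the complex lies in a
  \<open>d\<close>-dimensional linear subspace of the ambient space, which is linearly isometric to \<open>\<real>\<^sup>d\<close>.
\<close>

definition lies_in_Rd :: "nat \<Rightarrow> ('a::euclidean_space, 'v) labeled_complex \<Rightarrow> bool" where
  "lies_in_Rd d L \<longleftrightarrow> (\<exists>U. subspace U \<and> dim U = d \<and> \<Union>(cells L) \<subseteq> U)"

text \<open>
  The simplex with all its faces, realized as the standard simplex, whose vertices (the unit
  vectors of the variables in \<open>Q\<close>) are labeled by these variables.
\<close>

definition Delta :: "'v::finite set \<Rightarrow> (real^'v, 'v) labeled_complex" where
  "Delta Q = ({F. F face_of (convex hull ((\<lambda>v. axis v 1) ` Q))}, \<lambda>p. var (THE v. p = axis v 1))"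

definition lprod ::
  "('a, 'v) labeled_complex \<Rightarrow> ('b, 'v) labeled_complex \<Rightarrow> ('a \<times> 'b, 'v) labeled_complex"
where
  "lprod K L = ({F \<times> G | F G. F \<in> cells K \<and> G \<in> cells L}, \<lambda>(v, w). vlabel K v + vlabel L w)"

text \<open>
  Faces with the same set of vertex labels are identified, so that as a labeled complex
  \<open>L\<close> is given by the vertex label sets of its cells. Under this identification, equality,
  inclusion and union of labeled complexes are those of these systems of sets.
\<close>

definition label_cells :: "('a::euclidean_space, 'v) labeled_complex \<Rightarrow> 'v monomial set set" where
  "label_cells L = (\<lambda>F. vlabel L ` verts F) ` cells L"

section \<open>Cellular resolutions\<close>

text \<open>This differs from \<open>facet_of\<close> in that the empty face is a codimension-one face of a vertex.\<close>

definition codim1_face :: "'a::euclidean_space set \<Rightarrow> 'a set \<Rightarrow> bool" where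
  "codim1_face G F \<longleftrightarrow> G face_of F \<and> aff_dim G = aff_dim F - 1"

definition incidence_function :: "'a::euclidean_space set set \<Rightarrow> ('a set \<Rightarrow> 'a set \<Rightarrow> int) \<Rightarrow> bool" where
  "incidence_function X \<epsilon> \<longleftrightarrow>
     (\<forall>F\<in>X. \<forall>G\<in>X. if codim1_face G F then \<epsilon> F G \<in> {1, -1} else \<epsilon> F G = 0) \<and>
     (\<forall>v. {v} \<in> X \<longrightarrow> \<epsilon> {v} {} = 1) \<and>
     (\<forall>F\<in>X. \<forall>G1\<in>X. \<forall>G2\<in>X. \<forall>H\<in>X.
        G1 \<noteq> G2 \<and> codim1_face G1 F \<and> codim1_face G2 F \<and> codim1_face H G1 \<and> codim1_face H G2 \<longrightarrow>
        \<epsilon> F G1 * \<epsilon> G1 H + \<epsilon> F G2 * \<epsilon> G2 H = 0)"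

definition cells_of_dim :: "('a::euclidean_space, 'v) labeled_complex \<Rightarrow> nat \<Rightarrow> 'a set set" where
  "cells_of_dim L i = {F \<in> cells L. aff_dim F = int i}"

text \<open>
  The differential of the cellular complex, extended linearly from
  \<open>\<partial>F = (\<Sum>G. \<epsilon>(F,G) (m\<^sub>F / m\<^sub>G) G)\<close>; the quotient of monomials is the difference of exponents.
\<close>

definition cell_diff ::
  "('a::euclidean_space, 'v::finite) labeled_complex \<Rightarrow> ('a set \<Rightarrow> 'a set \<Rightarrow> int)
    \<Rightarrow> ('a set \<Rightarrow> ('v, 'k::field) mpoly) \<Rightarrow> ('a set \<Rightarrow> ('v, 'k) mpoly)"
where
  "cell_diff L \<epsilon> f =
     (\<lambda>G. if G \<in> cells L - {{}}
          then \<Sum>F\<in>cells L - {{}}. f F * (of_int (\<epsilon> F G) * mon (face_label L F - face_label L G))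
          else 0)"

definition cell_aug ::
  "('a::euclidean_space, 'v::finite) labeled_complex \<Rightarrow> ('a set \<Rightarrow> ('v, 'k::field) mpoly) \<Rightarrow> ('v, 'k) mpoly"
where
  "cell_aug L f = (\<Sum>F\<in>cells_of_dim L 0. f F * mon (face_label L F))"

definition supports_minimal_free_resolution ::
  "('a::euclidean_space, 'v::finite) labeled_complex \<Rightarrow> ('a set \<Rightarrow> 'a set \<Rightarrow> int)
    \<Rightarrow> ('v, 'k::field) mpoly set \<Rightarrow> bool"
where
  "supports_minimal_free_resolution L \<epsilon> I \<longleftrightarrow>
     free_resolution (cells_of_dim L) (\<lambda>_. cell_diff L \<epsilon>) (cell_aug L) I \<and>
     minimal_differentials (cells_of_dim L)
       (\<lambda>_. cell_diff L \<epsilon> :: ('a set \<Rightarrow> ('v, 'k) mpoly) \<Rightarrow> _)"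

text \<open>
  The cellular complex of \<open>L\<close>, over the field \<open>'k\<close>, is graded for the weights \<open>w\<close>; a cell has
  the degree of its label. The type token fixes the field.
\<close>

definition cellular_graded ::
  "'k::field itself \<Rightarrow> 'j set \<Rightarrow> ('v::finite \<Rightarrow> 'j \<Rightarrow> int)
    \<Rightarrow> ('a::euclidean_space, 'v) labeled_complex \<Rightarrow> ('a set \<Rightarrow> 'a set \<Rightarrow> int) \<Rightarrow> bool"
where
  "cellular_graded _ J w L \<epsilon> \<longleftrightarrow>
     graded_maps J w (face_label L) (cells_of_dim L)
       (\<lambda>_. cell_diff L \<epsilon> :: ('a set \<Rightarrow> ('v, 'k) mpoly) \<Rightarrow> _) (cell_aug L)"

text \<open>
  The paper's ``\<open>\<int>\<^sup>t\<close>-graded'' is not defined there. Here it is taken in the strongest sense: the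
  complex is graded for every \<open>\<int>\<^sup>t\<close>-grading of the polynomial ring with homogeneous variables.
\<close>

definition Zt_graded ::
  "'k::field itself \<Rightarrow> nat \<Rightarrow> ('a::euclidean_space, 'v::finite) labeled_complex
    \<Rightarrow> ('a set \<Rightarrow> 'a set \<Rightarrow> int) \<Rightarrow> bool"
where
  "Zt_graded K t L \<epsilon> \<longleftrightarrow> (\<forall>w. cellular_graded K {..<t} w L \<epsilon>)"

text \<open>The grading by the exponent vectors.\<close>

definition fine_graded ::
  "'k::field itself \<Rightarrow> ('a::euclidean_space, 'v::finite) labeled_complex
    \<Rightarrow> ('a set \<Rightarrow> 'a set \<Rightarrow> int) \<Rightarrow> bool"
where
  "fine_graded K L \<epsilon> \<longleftrightarrow> cellular_graded K UNIV (\<lambda>v v'. if v = v' then 1 else 0) L \<epsilon>"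

text \<open>The variables \<open>x\<^bsub>j1\<^esub>, \<dots>, x\<^bsub>j b\<^sub>j\<^esub>\<close> generating \<open>P\<^sub>j\<close>.\<close>

definition block :: "(nat \<Rightarrow> nat \<Rightarrow> 'v) \<Rightarrow> (nat \<Rightarrow> nat) \<Rightarrow> nat \<Rightarrow> 'v set" where
  "block x b j = x j ` {1..b j}"

end

theory Submission
  imports Defs
begin

text \<open>
  Unfolding the recursion, a nonempty cell of \<open>\<Gamma>\<^bsub>p,q\<^esub>\<close> is a product \<open>A\<^sub>0 \<times> \<dots> \<times> A\<^bsub>q-1\<^esub>\<close> of nonempty sets
  of variables of which each lies in strictly later blocks than its predecessor. Number all variables
  consecutively, compatibly with the blocks, and send the vertex with variables numbered
  \<open>a\<^sub>0 < \<dots> < a\<^bsub>q-1\<^esub>\<close> to the vector whose \<open>c\<close>-th coordinate counts the \<open>k\<close> with \<open>a\<^sub>k - k \<ge> c\<close>, for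
  \<open>1 \<le> c \<le> m - q\<close>. Every point of the union of the convex hulls determines the cells containing it, as
  its barycentric weights in the factors can be read off from its coordinates; hence the cells form a
  polytopal complex whose face poset is that of the products.

  In multidegree \<open>\<alpha>\<close> the cellular complex is the chain complex of the subcomplex on the variables in the
  support of \<open>\<alpha>\<close>. It is contracted row by row: toggling the first available variable in \<open>A\<^sub>0\<close> cancels
  all cells except those where \<open>A\<^sub>0\<close> is that single variable, then the same applies to \<open>A\<^sub>1\<close>, and so on
  down to one vertex. Removing a vertex from a factor divides the label by one variable, whence
  minimality.
\<close>

section \<open>Boxes of chains and uniqueness of weights\<close>

text \<open>The obstacle is the dimension. Placed side by side in coordinate spaces, the factors of
  a product cell need a space that grows with the number of factors, and a variable may occur in
  different rows of different cells; one global vertex map into a small space is required. After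
  subtraction of the row number, the entries satisfy 0 <= a_0 - 0 <= a_1 - 1 <= ... <= a_{q-1} -
  (q-1) <= m - q. This is a partition in a box, and the coordinates are the parts of its conjugate:
  hence the dimension m - q. The same monotonicity makes weights readable. In a cell every entry of
  a row precedes every entry of the next row, so the share of the weight of row k on numbers >= c +
  k is 0 up to some row, arbitrary in at most one row, and 1 from then on. Such a sequence is
  determined by its sum, which is coordinate c. Since the map is a sum over the rows, a convex
  combination of vertices matters only through its marginals in the rows, and these marginals decide
  membership in cells and faces.\<close>

text \<open>Row \<open>k\<close> of the relation is the vertex set of the \<open>k\<close>-th
  simplex factor. In this encoding the nonempty faces of a product are the subsets without empty
  rows, facets arise by deleting one pair, and the dimension is the number of pairs minus
  \<open>q\<close>.\<close>

definition row_chains :: "('v \<Rightarrow> nat) \<Rightarrow> 'v set \<Rightarrow> nat \<Rightarrow> (nat \<times> 'v) set set" where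
  "row_chains \<beta> W q = {D. D \<subseteq> {..<q} \<times> W \<and> (\<forall>k<q. D `` {k} \<noteq> {}) \<and>
     (\<forall>k l a c. (k, a) \<in> D \<longrightarrow> (l, c) \<in> D \<longrightarrow> k < l \<longrightarrow> \<beta> a < \<beta> c)}"

text \<open>The vertices of the product cell. Extensionality makes a vertex a unique function, so
  there are finitely many and equality of vertices is equality of functions.\<close>

definition picks :: "nat \<Rightarrow> (nat \<times> 'v) set \<Rightarrow> (nat \<Rightarrow> 'v) set" where
  "picks q D = PiE {..<q} (\<lambda>k. D `` {k})"

text \<open>The contribution of one entry to the coordinate of rank \<open>c = r v\<close> is the
  indicator of \<open>r a - k >= c\<close>, written without truncated subtraction. Rank 0 is left
  out: every entry of a chain would count there, and the coordinate would be constantly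
  \<open>q\<close>.\<close>

definition stair :: "('v::finite \<Rightarrow> nat) \<Rightarrow> nat \<Rightarrow> 'v \<Rightarrow> real^'v" where
  "stair r k a = (\<chi> v. if 0 < r v \<and> r v + k \<le> r a then 1 else 0)"

definition corner :: "('v::finite \<Rightarrow> nat) \<Rightarrow> nat \<Rightarrow> (nat \<Rightarrow> 'v) \<Rightarrow> real^'v" where
  "corner r q s = (\<Sum>k<q. stair r k (s k))"

definition chain_cell :: "('v::finite \<Rightarrow> nat) \<Rightarrow> nat \<Rightarrow> (nat \<times> 'v) set \<Rightarrow> (real^'v) set" where
  "chain_cell r q D = convex hull (corner r q ` picks q D)"

lemma row_chainsD:
  assumes "D \<in> row_chains \<beta> W q"
  shows "D \<subseteq> {..<q} \<times> W" "\<And>k. k < q \<Longrightarrow> \<exists>a. (k, a) \<in> D"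
    "\<And>k l a c. (k, a) \<in> D \<Longrightarrow> (l, c) \<in> D \<Longrightarrow> k < l \<Longrightarrow> \<beta> a < \<beta> c"
proof -
  have *: "D \<subseteq> {..<q} \<times> W" "\<forall>k<q. D `` {k} \<noteq> {}"
    "\<forall>k l a c. (k, a) \<in> D \<longrightarrow> (l, c) \<in> D \<longrightarrow> k < l \<longrightarrow> \<beta> a < \<beta> c"
    using assms unfolding row_chains_def mem_Collect_eq by simp_all
  show "D \<subseteq> {..<q} \<times> W" by (rule *(1))
  show "\<exists>a. (k, a) \<in> D" if "k < q" for k using *(2) that by auto
  show "\<beta> a < \<beta> c" if "(k, a) \<in> D" "(l, c) \<in> D" "k < l" for k l a c using *(3) that by simp
qed

lemma row_chains_subset:
  assumes "D \<in> row_chains \<beta> W q" "E \<subseteq> D" "\<And>k. k < q \<Longrightarrow> \<exists>a. (k, a) \<in> E"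
  shows "E \<in> row_chains \<beta> W q"
proof -
  note D = row_chainsD [OF assms(1)]
  have "E \<subseteq> {..<q} \<times> W" using D(1) assms(2) by (rule order_trans [rotated])
  moreover have "E `` {k} \<noteq> {}" if "k < q" for k using assms(3) [OF that] by auto
  moreover have "\<beta> a < \<beta> c" if "(k, a) \<in> E" "(l, c) \<in> E" "k < l" for k l a c
    using D(3) [of k a l c] assms(2) that by (simp add: subset_iff)
  ultimately show ?thesis by (simp add: row_chains_def)
qed

lemma finite_chains [simp]: "finite (row_chains \<beta> (W :: 'v::finite set) q)"
  by (rule finite_subset [of _ "Pow ({..<q} \<times> UNIV)"]) (auto simp: row_chains_def)

lemma finite_chain: "D \<in> row_chains \<beta> (W :: 'v::finite set) q \<Longrightarrow> finite D"
  by (rule finite_subset [of _ "{..<q} \<times> UNIV"]) (auto simp: row_chains_def)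

lemma finite_picks [simp]: "finite (picks q (D :: (nat \<times> 'v::finite) set))"
  unfolding picks_def by (rule finite_PiE) auto

lemma picks_iff: "s \<in> picks q D \<longleftrightarrow> s \<in> extensional {..<q} \<and> (\<forall>k<q. (k, s k) \<in> D)"
  by (auto simp: picks_def PiE_iff)

lemma picks_through:
  assumes D: "D \<in> row_chains \<beta> W q" and "(k, a) \<in> D"
  shows "\<exists>s \<in> picks q D. s k = a"
proof -
  obtain g where g: "\<And>l. l < q \<Longrightarrow> (l, g l) \<in> D" using row_chainsD(2)[OF D] by metis
  have k: "k < q" using row_chainsD(1)[OF D] assms(2) by auto
  define s where "s = restrict (g(k := a)) {..<q}"
  have "(l, s l) \<in> D" if "l < q" for l using g[OF that] that assms(2) by (simp add: s_def)
  moreover have "s \<in> extensional {..<q}" "s k = a" using k by (simp_all add: s_def)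
  ultimately have "s \<in> picks q D" "s k = a" unfolding picks_iff by blast+
  then show ?thesis by blast
qed

lemma picks_nonempty: "D \<in> row_chains \<beta> W q \<Longrightarrow> picks q D \<noteq> {}"
proof -
  assume D: "D \<in> row_chains \<beta> W q"
  then have "\<forall>k<q. D `` {k} \<noteq> {}" by (auto simp: row_chains_def)
  then show ?thesis unfolding picks_def by (simp add: PiE_eq_empty_iff)
qed

lemma picks_mono: "E \<subseteq> D \<Longrightarrow> picks q E \<subseteq> picks q D"
  unfolding picks_iff subset_iff by blast

lemma picks_subset_imp:
  assumes "D \<in> row_chains \<beta> W q" "picks q D \<subseteq> picks q E"
  shows "D \<subseteq> E"
proof
  fix d assume d: "d \<in> D"
  obtain k a where ka: "d = (k, a)" by force
  obtain s where "s \<in> picks q D" "s k = a" using picks_through[OF assms(1)] d ka by blast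
  moreover have "k < q" using row_chainsD(1)[OF assms(1)] d ka by auto
  ultimately show "d \<in> E" using assms(2) ka unfolding picks_iff subset_iff by blast
qed

text \<open>Weights are attached to the indices and not to the points, so \<open>f\<close> may
  repeat values; \<open>corner\<close> is not yet known to be injective where this is
  applied.\<close>

lemma convex_hull_image_finite:
  assumes "finite S"
  shows "convex hull (f ` S) = {(\<Sum>s\<in>S. u s *\<^sub>R f s) | u. (\<forall>s\<in>S. 0 \<le> u s) \<and> sum u S = 1}"
    (is "_ = ?R")
proof
  show "convex hull (f ` S) \<subseteq> ?R"
  proof (rule hull_minimal)
    show "f ` S \<subseteq> ?R"
    proof
      fix y assume "y \<in> f ` S"
      then obtain s where s: "s \<in> S" "y = f s" by blast
      have "y = (\<Sum>t\<in>S. (if t = s then 1 else 0) *\<^sub>R f t)"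
        using s assms by (simp add: if_distrib [of "\<lambda>c. c *\<^sub>R _"] cong: if_cong)
      moreover have "(\<Sum>t\<in>S. (if t = s then 1 else 0)) = (1::real)" using s assms by simp
      ultimately show "y \<in> ?R" by (intro CollectI exI [of _ "\<lambda>t. if t = s then 1 else 0"]) auto
    qed
    show "convex ?R"
    proof (rule convexI)
      fix x y :: 'b and a b :: real
      assume "x \<in> ?R" "y \<in> ?R" and ab: "0 \<le> a" "0 \<le> b" "a + b = 1"
      then obtain u w where u: "x = (\<Sum>s\<in>S. u s *\<^sub>R f s)" "\<forall>s\<in>S. 0 \<le> u s" "sum u S = 1"
        and w: "y = (\<Sum>s\<in>S. w s *\<^sub>R f s)" "\<forall>s\<in>S. 0 \<le> w s" "sum w S = 1" by blast
      have "a *\<^sub>R x + b *\<^sub>R y = (\<Sum>s\<in>S. (a * u s + b * w s) *\<^sub>R f s)"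
        unfolding u w by (simp add: scaleR_add_left sum.distrib scaleR_sum_right)
      moreover have "(\<Sum>s\<in>S. a * u s + b * w s) = 1"
        using u(3) w(3) ab by (simp add: sum.distrib flip: sum_distrib_left)
      ultimately show "a *\<^sub>R x + b *\<^sub>R y \<in> ?R"
        using u(2) w(2) ab by (intro CollectI exI [of _ "\<lambda>s. a * u s + b * w s"]) auto
    qed
  qed
  show "?R \<subseteq> convex hull (f ` S)"
  proof clarify
    fix u :: "'a \<Rightarrow> real" assume "\<forall>s\<in>S. 0 \<le> u s" "sum u S = 1"
    then show "(\<Sum>s\<in>S. u s *\<^sub>R f s) \<in> convex hull (f ` S)"
      using assms by (intro convex_sum) (auto intro: hull_inc)
  qed
qed

section \<open>Sequences of zeros and ones with one intermediate term\<close>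

text \<open>From \<open>u k < w k <= 1\<close> it follows that \<open>u\<close> vanishes before
  \<open>k\<close>, and from \<open>0 <= u k < w k\<close> that \<open>w\<close> is 1 after
  \<open>k\<close>. So \<open>u\<close> is below \<open>w\<close> throughout, strictly at
  \<open>k\<close>.\<close>

lemma threshold_sequences_less:
  fixes u w :: "nat \<Rightarrow> real"
  assumes u: "\<And>k. k < q \<Longrightarrow> 0 \<le> u k \<and> u k \<le> 1" "\<And>k l. k < l \<Longrightarrow> l < q \<Longrightarrow> 0 < u k \<Longrightarrow> u l = 1"
    and w: "\<And>k. k < q \<Longrightarrow> 0 \<le> w k \<and> w k \<le> 1" "\<And>k l. k < l \<Longrightarrow> l < q \<Longrightarrow> 0 < w k \<Longrightarrow> w l = 1"
    and k: "k < q" "u k < w k"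
  shows "(\<Sum>k<q. u k) < (\<Sum>k<q. w k)"
proof (rule sum_strict_mono_ex1)
  show "\<forall>j\<in>{..<q}. u j \<le> w j"
  proof
    fix j assume "j \<in> {..<q}"
    then have j: "j < q" by simp
    consider "j < k" | "j = k" | "k < j" by linarith
    then show "u j \<le> w j"
    proof cases
      case 1
      then have "u j = 0" using u(2)[OF 1 k(1)] u(1)[OF j] w(1)[OF k(1)] k(2) by force
      then show ?thesis using w(1)[OF j] by simp
    next
      case 3
      then have "w j = 1" using w(2)[OF 3 j] u(1)[OF k(1)] k(2) by simp
      then show ?thesis using u(1)[OF j] by simp
    qed (use k in simp)
  qed
qed (use k in auto)

lemma threshold_sequences_unique:
  fixes u w :: "nat \<Rightarrow> real"
  assumes "\<And>k. k < q \<Longrightarrow> 0 \<le> u k \<and> u k \<le> 1" "\<And>k l. k < l \<Longrightarrow> l < q \<Longrightarrow> 0 < u k \<Longrightarrow> u l = 1"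
    and "\<And>k. k < q \<Longrightarrow> 0 \<le> w k \<and> w k \<le> 1" "\<And>k l. k < l \<Longrightarrow> l < q \<Longrightarrow> 0 < w k \<Longrightarrow> w l = 1"
    and "(\<Sum>k<q. u k) = (\<Sum>k<q. w k)" "k < q"
  shows "u k = w k"
proof (rule linorder_cases [of "u k" "w k"])
  assume "u k < w k"
  then show ?thesis using threshold_sequences_less [of q u w k, OF assms(1-4) \<open>k < q\<close>] assms(5) by simp
next
  assume "w k < u k"
  then show ?thesis using threshold_sequences_less [of q w u k, OF assms(3,4,1,2) \<open>k < q\<close>] assms(5) by simp
qed

section \<open>Barycentric weights in the factors of a cell\<close>

definition weights :: "nat \<Rightarrow> (nat \<times> 'v::finite) set \<Rightarrow> (nat \<Rightarrow> 'v \<Rightarrow> real) \<Rightarrow> bool" where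
  "weights q D y \<longleftrightarrow> (\<forall>k a. 0 \<le> y k a) \<and> (\<forall>k a. y k a \<noteq> 0 \<longrightarrow> (k, a) \<in> D) \<and>
     (\<forall>k<q. (\<Sum>a\<in>UNIV. y k a) = 1)"

text \<open>The affine extension of \<open>corner\<close> from vertices to tuples of points, one in
  each simplex factor.\<close>

definition weight_point :: "('v::finite \<Rightarrow> nat) \<Rightarrow> nat \<Rightarrow> (nat \<Rightarrow> 'v \<Rightarrow> real) \<Rightarrow> real^'v" where
  "weight_point r q y = (\<Sum>k<q. \<Sum>a\<in>UNIV. y k a *\<^sub>R stair r k a)"

lemma weight_point_component:
  assumes "0 < r v"
  shows "weight_point r q y $ v = (\<Sum>k<q. \<Sum>a | r v + k \<le> r a. y k a)"
proof -
  have "(\<Sum>a\<in>UNIV. (y k a *\<^sub>R stair r k a) $ v) = (\<Sum>a | r v + k \<le> r a. y k a)" for k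
    using assms by (intro sum.mono_neutral_cong_right) (auto simp: stair_def)
  then show ?thesis by (simp add: weight_point_def)
qed

text \<open>\<open>\<beta>\<close> is the block of a variable and \<open>r\<close> its number in a
  consecutive numbering. Rows of chains are compared by \<open>\<beta>\<close>, coordinates are
  indexed by \<open>r\<close>.\<close>

locale ranking =
  fixes r \<beta> :: "'v::finite \<Rightarrow> nat"
  assumes r_bij: "bij_betw r UNIV {..<CARD('v)}"
    and r_mono: "\<beta> u < \<beta> v \<Longrightarrow> r u < r v"
begin

abbreviation "\<C> \<equiv> row_chains \<beta>"
abbreviation "cell \<equiv> chain_cell r"

lemma r_eq_iff [simp]: "r a = r c \<longleftrightarrow> a = c"
  using r_bij by (auto simp: bij_betw_def inj_on_def)

lemma \<beta>_mono: "r a \<le> r c \<Longrightarrow> \<beta> a \<le> \<beta> c"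
  using r_mono leD not_le_imp_less by blast

text \<open>The rows in between are nonempty, and each passage to the next row raises the block and
  hence the rank by at least 1.\<close>

lemma chain_rank_step:
  assumes D: "D \<in> \<C> W q" and "(k, a) \<in> D" "(k + Suc n, c) \<in> D"
  shows "r a + Suc n \<le> r c"
  using assms(3)
proof (induction n arbitrary: c)
  case 0
  have "\<beta> a < \<beta> c" using row_chainsD(3)[OF D assms(2) 0] by simp
  then show ?case using r_mono by fastforce
next
  case (Suc n)
  then have "k + Suc n < q" using row_chainsD(1)[OF D] by auto
  then obtain e where e: "(k + Suc n, e) \<in> D" using row_chainsD(2)[OF D] by blast
  have "\<beta> e < \<beta> c" using row_chainsD(3)[OF D e Suc.prems] by simp
  then show ?case using Suc.IH[OF e] r_mono by fastforce
qed

text \<open>Stands for \<open>r a - k <= r c - l\<close> without subtraction. It holds for all pairs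
  of entries of the two rows, not only along one vertex, and therefore survives convex
  combinations.\<close>

lemma chain_rank:
  assumes D: "D \<in> \<C> W q" and "(k, a) \<in> D" "(l, c) \<in> D" "k < l"
  shows "r a + l \<le> r c + k"
  using chain_rank_step[OF D assms(2), of "l - Suc k" c] assms by simp

text \<open>Comparison with an entry of row 0 makes the shifted rank \<open>r a - k\<close> a
  natural number.\<close>

lemma chain_rank_ge:
  assumes D: "D \<in> \<C> W q" and ka: "(k, a) \<in> D"
  shows "k \<le> r a"
proof (cases "k = 0")
  case False
  then have "0 < q" using row_chainsD(1)[OF D] ka by auto
  then obtain e where "(0, e) \<in> D" using row_chainsD(2)[OF D] by blast
  then show ?thesis using chain_rank[OF D _ ka] False by fastforce
qed simp

text \<open>A positive tail in row \<open>k\<close> exhibits an entry with shifted rank at least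
  \<open>c\<close>. By \<open>chain_rank\<close> all entries of the later row \<open>l\<close> have
  this too, so no weight of row \<open>l\<close> lies outside the tail.\<close>

lemma weights_tail_threshold:
  assumes D: "D \<in> \<C> W q" and y: "weights q D y"
    and kl: "k < l" "l < q" and pos: "0 < (\<Sum>a | c + k \<le> r a. y k a)"
  shows "(\<Sum>a | c + l \<le> r a. y l a) = 1"
proof -
  obtain a where a: "c + k \<le> r a" "y k a \<noteq> 0"
    using pos sum.neutral[of "{a. c + k \<le> r a}" "y k"] by (metis less_irrefl mem_Collect_eq)
  then have aD: "(k, a) \<in> D" using y by (auto simp: weights_def)
  have "y l e = 0" if "\<not> c + l \<le> r e" for e
    using that a chain_rank[OF D aD _ kl(1), of e] y by (force simp: weights_def)
  then have "(\<Sum>a | c + l \<le> r a. y l a) = (\<Sum>a\<in>UNIV. y l a)"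
    by (intro sum.mono_neutral_left) auto
  then show ?thesis using y kl by (simp add: weights_def)
qed

lemma weights_tail_bounds:
  assumes y: "weights q D y" and "k < q"
  shows "0 \<le> (\<Sum>a | c + k \<le> r a. y k a) \<and> (\<Sum>a | c + k \<le> r a. y k a) \<le> 1"
proof -
  have "(\<Sum>a | c + k \<le> r a. y k a) \<le> (\<Sum>a\<in>UNIV. y k a)"
    using y by (intro sum_mono2) (auto simp: weights_def)
  then show ?thesis using y assms(2) by (auto simp: weights_def intro: sum_nonneg)
qed

text \<open>
  The tail sums of the rows of a weight on a chain form a 0-1 sequence up to one intermediate
  term, so they are determined by their total, which is a coordinate of the point.
\<close>

lemma weights_unique:
  assumes D: "D \<in> \<C> W q" and y: "weights q D y"
    and D': "D' \<in> \<C> W' q" and y': "weights q D' y'"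
    and eq: "weight_point r q y = weight_point r q y'" and k: "k < q"
  shows "y k a = y' k a"
proof -
  define U where "U y k c = (\<Sum>a | c + k \<le> r a. y k a)" for y :: "nat \<Rightarrow> 'v \<Rightarrow> real" and k c
  \<comment> \<open>No coordinate shows the tail sums at \<open>c = 0\<close>, but they are 1, as no
    entry of row \<open>k\<close> has rank below \<open>k\<close>.\<close>
  have U0: "U z k 0 = 1" if E: "E \<in> \<C> V q" and z: "weights q E z" for E V z
  proof -
    have "z k e = 0" if "\<not> k \<le> r e" for e
      using that chain_rank_ge[OF E, of k e] z unfolding weights_def by blast
    then have "U z k 0 = (\<Sum>a\<in>UNIV. z k a)"
      unfolding U_def by (intro sum.mono_neutral_left) auto
    then show ?thesis using z k by (simp add: weights_def)
  qed
  have U: "U y k c = U y' k c" for c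
  proof -
    consider "c = 0" | "CARD('v) \<le> c" | "0 < c" "c < CARD('v)" by linarith
    then show ?thesis
    proof cases
      case 1
      then show ?thesis using U0[OF D y] U0[OF D' y'] by simp
    next
      case 2
      have "r a < CARD('v)" for a using r_bij by (auto simp: bij_betw_def)
      then have "{a. c + k \<le> r a} = {}" using 2 by (metis (no_types, lifting) add_leD1 empty_Collect_eq le_trans not_le)
      then show ?thesis by (simp add: U_def)
    next
      case 3
      then obtain v where v: "r v = c" using r_bij unfolding bij_betw_def by (metis imageE lessThan_iff)
      have "(\<Sum>k<q. U y k c) = (\<Sum>k<q. U y' k c)"
        using weight_point_component[of r v q y] weight_point_component[of r v q y'] 3 v eq by (simp add: U_def)
      then show ?thesis
        by (intro threshold_sequences_unique [of q "\<lambda>k. U y k c" "\<lambda>k. U y' k c", OF _ _ _ _ _ k])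
          (auto simp: U_def weights_tail_bounds[OF y] weights_tail_bounds[OF y']
            weights_tail_threshold[OF D y] weights_tail_threshold[OF D' y'])
    qed
  qed
  show ?thesis
  proof (cases "k \<le> r a")
    case False
    then show ?thesis using y y' chain_rank_ge[OF D, of k a] chain_rank_ge[OF D', of k a]
      unfolding weights_def by metis
  next
    case True
    \<comment> \<open>A single weight is the difference of the tail sums at \<open>c\<close> and
      \<open>Suc c\<close>, where \<open>c\<close> is the shifted rank of \<open>a\<close>.\<close>
    define c where "c = r a - k"
    have "{e. c + k \<le> r e} = insert a {e. Suc c + k \<le> r e}"
      proof (intro set_eqI iffI)
      fix e assume "e \<in> {e. c + k \<le> r e}"
      then have "r a = r e \<or> r a < r e" using True by (auto simp: c_def)
      then show "e \<in> insert a {e. Suc c + k \<le> r e}" using True by (auto simp: c_def)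
    qed (use True in \<open>auto simp: c_def\<close>)
    moreover have "a \<notin> {e. Suc c + k \<le> r e}" using True by (auto simp: c_def)
    ultimately have "U z k c = z k a + U z k (Suc c)" for z
      unfolding U_def by simp
    from this[of y] this[of y'] show ?thesis using U by simp
  qed
qed

end

section \<open>Faces of the cells\<close>

text \<open>Coefficients on all picks that vanish off \<open>picks q D\<close>, rather than
  functions on \<open>picks q D\<close>: representations of one point in different cells can then be
  compared and restricted.\<close>

definition mixtures :: "nat \<Rightarrow> (nat \<times> 'v::finite) set \<Rightarrow> ((nat \<Rightarrow> 'v) \<Rightarrow> real) set" where
  "mixtures q D = {\<kappa>. (\<forall>s. 0 \<le> \<kappa> s) \<and> (\<forall>s. \<kappa> s \<noteq> 0 \<longrightarrow> s \<in> picks q D) \<and> sum \<kappa> (picks q UNIV) = 1}"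

definition mix_point :: "('v::finite \<Rightarrow> nat) \<Rightarrow> nat \<Rightarrow> ((nat \<Rightarrow> 'v) \<Rightarrow> real) \<Rightarrow> real^'v" where
  "mix_point r q \<kappa> = (\<Sum>s\<in>picks q UNIV. \<kappa> s *\<^sub>R corner r q s)"

text \<open>The marginal distribution in row \<open>k\<close>. The value 0 from row \<open>q\<close>
  on lets the support condition in \<open>weights\<close> hold for all \<open>k\<close>.\<close>

definition margin :: "nat \<Rightarrow> ((nat \<Rightarrow> 'v::finite) \<Rightarrow> real) \<Rightarrow> nat \<Rightarrow> 'v \<Rightarrow> real" where
  "margin q \<kappa> k a = (if k < q then \<Sum>s | s \<in> picks q UNIV \<and> s k = a. \<kappa> s else 0)"

lemma picks_UNIV: "picks q D \<subseteq> picks q UNIV"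
  by (rule picks_mono) simp

lemma mixturesD:
  assumes "\<kappa> \<in> mixtures q D"
  shows "0 \<le> \<kappa> s" "\<kappa> s \<noteq> 0 \<Longrightarrow> s \<in> picks q D" "sum \<kappa> (picks q UNIV) = 1"
  using assms by (simp_all add: mixtures_def)

lemma chain_cell_eq: "chain_cell r q D = mix_point r q ` mixtures q D"
proof -
  have "(\<Sum>s\<in>picks q D. u s *\<^sub>R corner r q s) \<in> mix_point r q ` mixtures q D"
    if u: "\<forall>s\<in>picks q D. 0 \<le> u s" "sum u (picks q D) = 1" for u
  proof
    let ?l = "\<lambda>s. if s \<in> picks q D then u s else 0"
    have "sum ?l (picks q UNIV) = sum u (picks q D)"
      by (intro sum.mono_neutral_cong_right) (use picks_UNIV[of q D] in auto)
    then show "?l \<in> mixtures q D" using u by (auto simp: mixtures_def)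
    show "(\<Sum>s\<in>picks q D. u s *\<^sub>R corner r q s) = mix_point r q ?l"
      unfolding mix_point_def
      by (intro sum.mono_neutral_cong_left) (use picks_UNIV[of q D] in auto)
  qed
  moreover have "mix_point r q \<kappa> \<in> chain_cell r q D" if l: "\<kappa> \<in> mixtures q D" for \<kappa>
  proof -
    have "mix_point r q \<kappa> = (\<Sum>s\<in>picks q D. \<kappa> s *\<^sub>R corner r q s)"
      unfolding mix_point_def
      by (intro sum.mono_neutral_right) (use picks_UNIV[of q D] mixturesD(2)[OF l] in auto)
    moreover have "sum \<kappa> (picks q D) = sum \<kappa> (picks q UNIV)"
      by (intro sum.mono_neutral_left) (use picks_UNIV[of q D] mixturesD(2)[OF l] in auto)
    ultimately show ?thesis
      unfolding chain_cell_def convex_hull_image_finite[OF finite_picks]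
      using mixturesD[OF l] by auto
  qed
  ultimately show ?thesis
    unfolding chain_cell_def convex_hull_image_finite[OF finite_picks] by auto
qed

text \<open>\<open>corner\<close> is a sum over the rows, so a convex combination of corners depends
  only on its marginals in the rows. This passes from the vertices of a product to the weights in
  its factors.\<close>

lemma mix_point_eq_weight_point: "mix_point r q \<kappa> = weight_point r q (margin q \<kappa>)"
proof -
  have "(\<Sum>a\<in>UNIV. margin q \<kappa> k a *\<^sub>R stair r k a) = (\<Sum>s\<in>picks q UNIV. \<kappa> s *\<^sub>R stair r k (s k))"
    if "k < q" for k
  proof -
    have "(\<Sum>a\<in>UNIV. margin q \<kappa> k a *\<^sub>R stair r k a)
      = (\<Sum>a\<in>UNIV. \<Sum>s | s \<in> picks q UNIV \<and> s k = a. \<kappa> s *\<^sub>R stair r k (s k))"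
      using that by (simp add: margin_def scaleR_sum_left)
    also have "\<dots> = (\<Sum>s\<in>picks q UNIV. \<kappa> s *\<^sub>R stair r k (s k))"
      by (rule sum.group) auto
    finally show ?thesis .
  qed
  then show ?thesis
    unfolding mix_point_def weight_point_def corner_def
    by (simp add: scaleR_sum_right sum.swap [of _ "picks q UNIV"])
qed

lemma weights_margin:
  assumes l: "\<kappa> \<in> mixtures q D"
  shows "weights q D (margin q \<kappa>)"
  unfolding weights_def
proof (intro conjI allI impI)
  show "0 \<le> margin q \<kappa> k a" for k a
    using mixturesD(1)[OF l] by (simp add: margin_def sum_nonneg)
  show "(k, a) \<in> D" if "margin q \<kappa> k a \<noteq> 0" for k a
  proof -
    have "k < q" using that by (auto simp: margin_def split: if_splits)
    moreover from this have "\<not> (\<forall>s\<in>{s \<in> picks q UNIV. s k = a}. \<kappa> s = 0)"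
      using that sum.neutral[of "{s \<in> picks q UNIV. s k = a}" \<kappa>] unfolding margin_def by presburger
    then obtain s where "s k = a" "\<kappa> s \<noteq> 0" by blast
    ultimately show ?thesis using mixturesD(2)[OF l, of s] by (auto simp: picks_iff)
  qed
  show "(\<Sum>a\<in>UNIV. margin q \<kappa> k a) = 1" if "k < q" for k
  proof -
    have "(\<Sum>a\<in>UNIV. margin q \<kappa> k a) = (\<Sum>a\<in>UNIV. \<Sum>s | s \<in> picks q UNIV \<and> s k = a. \<kappa> s)"
      using that by (simp add: margin_def)
    also have "\<dots> = sum \<kappa> (picks q UNIV)" by (rule sum.group) auto
    finally show ?thesis using mixturesD(3)[OF l] by simp
  qed
qed

text \<open>Coefficients are nonnegative, so a marginal bounds each coefficient contributing to it
  and nothing cancels: the support can be controlled row by row.\<close>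

lemma mixtures_restrict:
  assumes l: "\<kappa> \<in> mixtures q D" and E: "\<And>k a. margin q \<kappa> k a \<noteq> 0 \<Longrightarrow> (k, a) \<in> E"
  shows "\<kappa> \<in> mixtures q E"
proof -
  have "s \<in> picks q E" if s: "\<kappa> s \<noteq> 0" for s
  proof -
    have sD: "s \<in> picks q D" by (rule mixturesD(2)[OF l s])
    then have sU: "s \<in> picks q UNIV" using picks_UNIV by blast
    have "(k, s k) \<in> E" if k: "k < q" for k
    proof -
      have "\<kappa> s \<le> sum \<kappa> {t \<in> picks q UNIV. t k = s k}"
        using mixturesD(1)[OF l] sU by (intro member_le_sum) auto
      then have "margin q \<kappa> k (s k) \<noteq> 0" using s k mixturesD(1)[OF l, of s] by (simp add: margin_def)
      then show ?thesis by (rule E)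
    qed
    then show ?thesis using sD by (simp add: picks_iff)
  qed
  then show ?thesis using l by (simp add: mixtures_def)
qed

lemma margin_combination:
  "margin q (\<lambda>s. u * \<kappa> s + v * \<mu> s) k a = u * margin q \<kappa> k a + v * margin q \<mu> k a"
  by (simp add: margin_def sum.distrib sum_distrib_left)

lemma mix_point_combination:
  "mix_point r q (\<lambda>s. u * \<kappa> s + v * \<mu> s) = u *\<^sub>R mix_point r q \<kappa> + v *\<^sub>R mix_point r q \<mu>"
  by (simp add: mix_point_def sum.distrib scaleR_sum_right scaleR_add_left)

lemma corner_in_chain_cell: "s \<in> picks q D \<Longrightarrow> corner r q s \<in> chain_cell r q D"
  unfolding chain_cell_def by (simp add: hull_inc)

lemma polytope_chain_cell: "polytope (chain_cell r q D)"
  unfolding chain_cell_def by (intro polytope_convex_hull finite_imageI finite_picks)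

lemma convex_chain_cell: "convex (chain_cell r q D)"
  by (simp add: chain_cell_def convex_convex_hull)

lemma chain_cell_mono: "E \<subseteq> D \<Longrightarrow> chain_cell r q E \<subseteq> chain_cell r q D"
  unfolding chain_cell_def by (intro hull_mono image_mono picks_mono)

lemma corner_upd:
  assumes "n < q"
  shows "corner r q (s(n := a)) = corner r q s - stair r n (s n) + stair r n a"
proof -
  have *: "corner r q t = stair r n (t n) + (\<Sum>k\<in>{..<q} - {n}. stair r k (t k))" for t
    using sum.remove[of "{..<q}" n "\<lambda>k. stair r k (t k)"] assms by (simp add: corner_def)
  have "(\<Sum>k\<in>{..<q} - {n}. stair r k ((s(n := a)) k)) = (\<Sum>k\<in>{..<q} - {n}. stair r k (s k))"
    by (intro sum.cong) auto
  then show ?thesis using *[of s] *[of "s(n := a)"] by simp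
qed

lemma picks_upd: "s \<in> picks q D \<Longrightarrow> n < q \<Longrightarrow> (n, a) \<in> D \<Longrightarrow> s(n := a) \<in> picks q D"
  using PiE_fun_upd[of a "\<lambda>k. D `` {k}" n s "{..<q}"] by (simp add: picks_def insert_absorb)

text \<open>
  If two corners lie in a face, so do the two corners obtained by exchanging one entry, as both
  pairs have the same midpoint. Hence the corners in a face form a product set.
\<close>

lemma face_of_chain_cell:
  assumes D: "D \<in> row_chains \<beta> W q" and G: "G face_of chain_cell r q D" "G \<noteq> {}"
  shows "\<exists>E\<in>row_chains \<beta> W q. E \<subseteq> D \<and> G = chain_cell r q E"
proof -
  define T where "T = {s \<in> picks q D. corner r q s \<in> G}"
  obtain S where S: "S \<subseteq> corner r q ` picks q D" "G = convex hull S"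
    using face_of_convex_hull_subset[OF finite_imp_compact[OF finite_imageI[OF finite_picks]]] G(1)
    unfolding chain_cell_def by metis
  have "S \<subseteq> corner r q ` T" using S hull_subset[of S convex] unfolding T_def by auto
  then have "G \<subseteq> convex hull (corner r q ` T)" unfolding S(2) by (rule hull_mono)
  moreover have convG: "convex G" using S(2) by (simp add: convex_convex_hull)
  then have "convex hull (corner r q ` T) \<subseteq> G"
    by (intro hull_minimal) (auto simp: T_def)
  ultimately have GT: "G = convex hull (corner r q ` T)" by blast
  then obtain s0 where s0: "s0 \<in> T" using G(2) by fastforce
  define E where "E = {(k, s k) | k s. k < q \<and> s \<in> T}"
  have "E \<subseteq> D" by (auto simp: E_def T_def picks_iff)
  have EC: "E \<in> row_chains \<beta> W q"
  proof (rule row_chains_subset[OF D \<open>E \<subseteq> D\<close>])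
    fix k assume "k < q"
    then have "(k, s0 k) \<in> E" using s0 unfolding E_def by blast
    then show "\<exists>a. (k, a) \<in> E" by blast
  qed
  have "picks q E = T"
  proof
    show "T \<subseteq> picks q E" by (auto simp: E_def T_def picks_iff)
    show "picks q E \<subseteq> T"
    proof
      fix s assume s: "s \<in> picks q E"
      \<comment> \<open>The given pick \<open>s\<close> is approached entry by entry, by vertices in
        \<open>G\<close> that agree with \<open>s\<close> in the first \<open>n\<close>
        rows.\<close>
      have "\<exists>t\<in>T. \<forall>k<n. t k = s k" if "n \<le> q" for n
        using that
      proof (induction n)
        case 0
        then show ?case using s0 by blast
      next
        case (Suc n)
        then obtain t where t: "t \<in> T" "\<forall>k<n. t k = s k" by auto
        have n: "n < q" using Suc.prems by simp
        then have "(n, s n) \<in> E" using s by (simp add: picks_iff)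
        then obtain t' where t': "t' \<in> T" "t' n = s n" by (auto simp: E_def)
        \<comment> \<open>The exchange in row \<open>n\<close>: \<open>w\<close> receives the wanted
          entry \<open>s n = t' n\<close>, and \<open>w'\<close> the entry \<open>t n\<close> that
          is given up.\<close>
        define w w' where "w = t(n := t' n)" and "w' = t'(n := t n)"
        have w: "w \<in> picks q D" "w' \<in> picks q D"
        proof -
          have D: "t \<in> picks q D" "t' \<in> picks q D" using t t' by (simp_all add: T_def)
          then have "(n, t n) \<in> D" "(n, t' n) \<in> D" using n by (simp_all add: picks_iff)
          then show "w \<in> picks q D" "w' \<in> picks q D"
            unfolding w_def w'_def using picks_upd[OF D(1) n] picks_upd[OF D(2) n] by blast+
        qed
        have "corner r q w + corner r q w' = corner r q t + corner r q t'"
          unfolding w_def w'_def corner_upd[OF n] by simp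
        then have mid: "midpoint (corner r q w) (corner r q w') = midpoint (corner r q t) (corner r q t')"
          by (simp add: midpoint_def)
        have "midpoint (corner r q t) (corner r q t') \<in> G"
          using closed_segment_subset[OF _ _ convG] t t' midpoint_in_closed_segment unfolding T_def by blast
        then have m: "midpoint (corner r q w) (corner r q w') \<in> G" using mid by simp
        have "corner r q w \<in> G"
        \<comment> \<open>Injectivity of \<open>corner\<close> is established only later. If the two
          corners coincide, they equal their midpoint, which is in \<open>G\<close> already.\<close>
        proof (cases "corner r q w = corner r q w'")
          case True
          then show ?thesis using m by simp
        next
          case False
          then have "midpoint (corner r q w) (corner r q w') \<in> open_segment (corner r q w) (corner r q w')"
            by simp
          then show ?thesis using face_ofD[OF G(1) _ _ _ m] w corner_in_chain_cell by blast
        qed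
        then have "w \<in> T" using w by (simp add: T_def)
        moreover have "\<forall>k<Suc n. w k = s k" using t t' by (auto simp: w_def less_Suc_eq)
        ultimately show ?case by blast
      qed
      from this[of q] obtain t where t: "t \<in> T" "\<forall>k<q. t k = s k" by blast
      have "t = s"
        by (rule extensionalityI[of _ "{..<q}"]) (use t s in \<open>auto simp: T_def picks_iff\<close>)
      then show "s \<in> T" using t by simp
    qed
  qed
  then show ?thesis using EC \<open>E \<subseteq> D\<close> GT unfolding chain_cell_def by blast
qed

section \<open>Intersections, faces and vertices of cells\<close>

context ranking
begin

lemma margin_unique:
  assumes "D \<in> \<C> W q" "\<kappa> \<in> mixtures q D" "D' \<in> \<C> W' q" "\<mu> \<in> mixtures q D'"
    and "mix_point r q \<kappa> = mix_point r q \<mu>"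
  shows "margin q \<kappa> k a = margin q \<mu> k a"
proof (cases "k < q")
  case True
  then show ?thesis
    using weights_unique[OF assms(1) weights_margin[OF assms(2)] assms(3) weights_margin[OF assms(4)]]
      assms(5) unfolding mix_point_eq_weight_point by blast
qed (simp add: margin_def)

text \<open>Equal points have equal marginals, so those of \<open>\<kappa>\<close> are supported in
  \<open>D\<close> and in \<open>D'\<close>.\<close>

lemma mixtures_transfer:
  assumes "D \<in> \<C> W q" "\<kappa> \<in> mixtures q D" "D' \<in> \<C> W' q" "\<mu> \<in> mixtures q D'"
    and "mix_point r q \<kappa> = mix_point r q \<mu>"
  shows "\<kappa> \<in> mixtures q (D \<inter> D')"
proof (rule mixtures_restrict[OF assms(2)])
  fix k a assume "margin q \<kappa> k a \<noteq> 0"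
  then show "(k, a) \<in> D \<inter> D'"
    using margin_unique[OF assms, of k a] weights_margin[OF assms(2)] weights_margin[OF assms(4)]
    by (simp add: weights_def)
qed

text \<open>\<open>D \<inter> D'\<close> may have an empty row; then it has no picks and its cell is
  empty, so the formula covers disjoint cells as well.\<close>

lemma chain_cell_Int:
  assumes D: "D \<in> \<C> W q" and D': "D' \<in> \<C> W' q"
  shows "cell q D \<inter> cell q D' = cell q (D \<inter> D')"
proof
  show "cell q D \<inter> cell q D' \<subseteq> cell q (D \<inter> D')"
  proof
    fix z assume "z \<in> cell q D \<inter> cell q D'"
    then obtain l m where l: "l \<in> mixtures q D" "z = mix_point r q l"
      and m: "m \<in> mixtures q D'" "z = mix_point r q m"
      unfolding chain_cell_eq by (elim IntE imageE)
    then show "z \<in> cell q (D \<inter> D')"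
      using mixtures_transfer[OF D l(1) D' m(1)] unfolding chain_cell_eq by simp
  qed
qed (simp add: chain_cell_mono)

text \<open>By uniqueness, marginals outside \<open>E\<close> vanish at a point of the smaller cell.
  Inside a segment they are positive combinations of the nonnegative marginals at the two ends,
  which must vanish too.\<close>

lemma chain_cell_face_of:
  assumes D: "D \<in> \<C> W q" and E: "E \<in> \<C> W' q" and "E \<subseteq> D"
  shows "cell q E face_of cell q D"
  unfolding face_of_def
proof (intro conjI ballI impI)
  show "cell q E \<subseteq> cell q D" by (rule chain_cell_mono) fact
  show "convex (cell q E)" by (rule convex_chain_cell)
  fix x y z assume x: "x \<in> cell q D" and y: "y \<in> cell q D" and z: "z \<in> cell q E"
    and seg: "z \<in> open_segment x y"
  obtain l where l: "l \<in> mixtures q D" "x = mix_point r q l" using x unfolding chain_cell_eq by blast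
  obtain m where m: "m \<in> mixtures q D" "y = mix_point r q m" using y unfolding chain_cell_eq by blast
  obtain n where n: "n \<in> mixtures q E" "z = mix_point r q n" using z unfolding chain_cell_eq by blast
  obtain u where u: "0 < u" "u < 1" "z = (1 - u) *\<^sub>R x + u *\<^sub>R y"
    using seg by (auto simp: in_segment)
  define k where "k = (\<lambda>s. (1 - u) * l s + u * m s)"
  have "sum k (picks q UNIV) = (1 - u) * sum l (picks q UNIV) + u * sum m (picks q UNIV)"
    unfolding k_def by (simp add: sum.distrib sum_distrib_left)
  also have "\<dots> = 1" using l(1) m(1) by (simp add: mixturesD(3))
  finally have ks: "sum k (picks q UNIV) = 1" .
  have kD: "k \<in> mixtures q D"
    unfolding mixtures_def
  proof (intro CollectI conjI allI impI)
    show "0 \<le> k s" for s using l(1) m(1) u by (simp add: k_def mixturesD(1))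
    show "s \<in> picks q D" if "k s \<noteq> 0" for s
    proof -
      have "l s \<noteq> 0 \<or> m s \<noteq> 0" using that by (auto simp: k_def)
      then show ?thesis using mixturesD(2)[OF l(1)] mixturesD(2)[OF m(1)] by blast
    qed
  qed (rule ks)
  have kz: "mix_point r q k = mix_point r q n"
    unfolding k_def mix_point_combination using u(3) l(2) m(2) n(2) by simp
  have zero: "margin q l i a = 0 \<and> margin q m i a = 0" if "(i, a) \<notin> E" for i a
  proof -
    have "margin q n i a = 0" using weights_margin[OF n(1)] that by (auto simp: weights_def)
    then have "margin q k i a = 0" using margin_unique[OF D kD E n(1) kz] by simp
    then have s0: "(1 - u) * margin q l i a + u * margin q m i a = 0"
      unfolding k_def margin_combination .
    have "0 \<le> margin q l i a" "0 \<le> margin q m i a"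
      using weights_margin[OF l(1)] weights_margin[OF m(1)] by (auto simp: weights_def)
    then have "0 \<le> (1 - u) * margin q l i a" "0 \<le> u * margin q m i a"
      using u by auto
    then have "(1 - u) * margin q l i a = 0" "u * margin q m i a = 0" using s0 by linarith+
    then show ?thesis using u by auto
  qed
  have "l \<in> mixtures q E" "m \<in> mixtures q E"
    using mixtures_restrict[OF l(1), of E] mixtures_restrict[OF m(1), of E] zero by blast+
  then show "x \<in> cell q E" "y \<in> cell q E" unfolding chain_cell_eq l(2) m(2) by blast+
qed

text \<open>The point mass at \<open>s\<close> represents the corner in \<open>D\<close>. A
  representation in \<open>D'\<close> has the same marginals, which confines the point mass to
  \<open>picks q D'\<close>.\<close>

lemma corner_in_chain_cell_iff:
  assumes D: "D \<in> \<C> W q" and D': "D' \<in> \<C> W' q" and s: "s \<in> picks q D"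
  shows "corner r q s \<in> cell q D' \<longleftrightarrow> s \<in> picks q D'"
proof
  assume "corner r q s \<in> cell q D'"
  then obtain m where m: "m \<in> mixtures q D'" "corner r q s = mix_point r q m" unfolding chain_cell_eq by blast
  define l where "l = (\<lambda>t. if t = s then 1 else (0::real))"
  have sU: "s \<in> picks q UNIV" using s picks_UNIV by blast
  then have l: "l \<in> mixtures q D" using s by (simp add: mixtures_def l_def)
  have "mix_point r q l = (\<Sum>t\<in>picks q UNIV. if t = s then corner r q s else 0)"
    unfolding mix_point_def l_def by (intro sum.cong) auto
  then have "mix_point r q l = corner r q s" using sU by simp
  then have "l \<in> mixtures q (D \<inter> D')" using mixtures_transfer[OF D l D' m(1)] m(2) by simp
  then have "s \<in> picks q (D \<inter> D')" by (rule mixturesD(2)) (simp add: l_def)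
  then show "s \<in> picks q D'" using picks_mono[of "D \<inter> D'" D' q] by blast
qed (rule corner_in_chain_cell)

lemma chain_cell_subset_iff:
  assumes D: "D \<in> \<C> W q" and D': "D' \<in> \<C> W' q"
  shows "cell q D \<subseteq> cell q D' \<longleftrightarrow> D \<subseteq> D'"
proof
  assume "cell q D \<subseteq> cell q D'"
  then have "picks q D \<subseteq> picks q D'"
    using corner_in_chain_cell_iff[OF D D'] corner_in_chain_cell by blast
  then show "D \<subseteq> D'" by (rule picks_subset_imp[OF D])
qed (rule chain_cell_mono)

lemma chain_cell_eq_iff:
  assumes "D \<in> \<C> W q" "D' \<in> \<C> W' q"
  shows "cell q D = cell q D' \<longleftrightarrow> D = D'"
  using chain_cell_subset_iff[OF assms] chain_cell_subset_iff[OF assms(2,1)] by auto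

lemma graph_chain:
  assumes D: "D \<in> \<C> W q" and s: "s \<in> picks q D"
  shows "(\<lambda>k. (k, s k)) ` {..<q} \<in> \<C> W q"
  by (rule row_chains_subset[OF D]) (use s in \<open>auto simp: picks_iff\<close>)

lemma picks_graph: "s \<in> extensional {..<q} \<Longrightarrow> picks q ((\<lambda>k. (k, s k)) ` {..<q}) = {s}"
  by (auto simp: picks_iff intro!: extensionalityI[of _ "{..<q}"])

lemma chain_cell_graph: "s \<in> extensional {..<q} \<Longrightarrow> cell q ((\<lambda>k. (k, s k)) ` {..<q}) = {corner r q s}"
  by (simp add: chain_cell_def picks_graph)

text \<open>A vertex is itself the cell of a chain with one entry per row, so this is the membership
  criterion applied to that chain.\<close>

lemma corner_inj:
  assumes D: "D \<in> \<C> W q" and D': "D' \<in> \<C> W' q" and s: "s \<in> picks q D" "s' \<in> picks q D'"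
    and eq: "corner r q s = corner r q s'"
  shows "s = s'"
proof -
  have "s \<in> picks q ((\<lambda>k. (k, s' k)) ` {..<q})"
    using corner_in_chain_cell_iff[OF D graph_chain[OF D' s(2)] s(1)] chain_cell_graph[of s' q] s eq
    by (simp add: picks_iff)
  then show ?thesis using picks_graph[of s' q] s by (simp add: picks_iff[of s'])
qed

lemma verts_chain_cell:
  assumes D: "D \<in> \<C> W q"
  shows "verts (cell q D) = corner r q ` picks q D"
proof
  show "verts (cell q D) \<subseteq> corner r q ` picks q D"
    unfolding verts_def chain_cell_def by (auto dest: extreme_point_of_convex_hull)
  show "corner r q ` picks q D \<subseteq> verts (cell q D)"
  proof
    fix x assume "x \<in> corner r q ` picks q D"
    then obtain s where s: "s \<in> picks q D" "x = corner r q s" by blast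
    have "cell q ((\<lambda>k. (k, s k)) ` {..<q}) face_of cell q D"
      by (rule chain_cell_face_of[OF D graph_chain[OF D s(1)]]) (use s in \<open>auto simp: picks_iff\<close>)
    moreover have "s \<in> extensional {..<q}" using s by (simp add: picks_iff)
    ultimately show "x \<in> verts (cell q D)"
      using s by (simp add: verts_def chain_cell_graph face_of_singleton)
  qed
qed

lemma chain_cell_nonempty: "D \<in> \<C> W q \<Longrightarrow> cell q D \<noteq> {}"
  using picks_nonempty[of D \<beta> W q] by (simp add: chain_cell_def)

section \<open>Dimension of the cells\<close>

lemma chain_card_ge:
  assumes D: "D \<in> \<C> W q"
  shows "q \<le> card D"
proof -
  have "{..<q} \<subseteq> fst ` D" using row_chainsD(2)[OF D] by force
  then have "card {..<q} \<le> card (fst ` D)" using finite_chain[OF D] by (intro card_mono) auto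
  also have "\<dots> \<le> card D" using finite_chain[OF D] by (rule card_image_le)
  finally show ?thesis by simp
qed

lemma chain_card_eq:
  assumes D: "D \<in> \<C> W q" and "card D = q" and s: "s \<in> picks q D"
  shows "D = (\<lambda>k. (k, s k)) ` {..<q}"
proof (rule sym, rule card_subset_eq[OF finite_chain[OF D]])
  show "(\<lambda>k. (k, s k)) ` {..<q} \<subseteq> D" using s by (auto simp: picks_iff)
  have "inj_on (\<lambda>k. (k, s k)) {..<q}" by (auto simp: inj_on_def)
  then show "card ((\<lambda>k. (k, s k)) ` {..<q}) = card D" using assms(2) by (simp add: card_image)
qed

lemma chain_remove:
  assumes D: "D \<in> \<C> W q" and ka: "(k, a) \<in> D" "(k, c) \<in> D" "a \<noteq> c"
  shows "D - {(k, a)} \<in> \<C> W q"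
proof (rule row_chains_subset[OF D])
  fix l assume "l < q"
  then obtain e where "(l, e) \<in> D" using row_chainsD(2)[OF D] by blast
  then have "(l, e) \<in> D - {(k, a)} \<or> (l, c) \<in> D - {(k, a)}" using ka by auto
  then show "\<exists>e. (l, e) \<in> D - {(k, a)}" by blast
qed auto

text \<open>The smaller cell is a proper face, so at least 1 is gained. It is at most 1: by the
  exchange identity, each corner with entry \<open>a\<close> in row \<open>k\<close> is an affine
  combination of one fixed such corner and two corners of the smaller cell.\<close>

lemma aff_dim_chain_cell_remove:
  assumes D: "D \<in> \<C> W q" and ka: "(k, a) \<in> D" "(k, c) \<in> D" "a \<noteq> c"
  shows "aff_dim (cell q D) = aff_dim (cell q (D - {(k, a)})) + 1"
proof (rule antisym)
  let ?D = "D - {(k, a)}"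
  have D': "?D \<in> \<C> W q" by (rule chain_remove[OF assms])
  have "?D \<noteq> D" using ka by blast
  then have "cell q ?D \<noteq> cell q D" using chain_cell_eq_iff[OF D' D] by simp
  then have "aff_dim (cell q ?D) < aff_dim (cell q D)"
    by (intro face_of_aff_dim_lt convex_chain_cell chain_cell_face_of[OF D D']) auto
  then show "aff_dim (cell q ?D) + 1 \<le> aff_dim (cell q D)" by simp
  have k: "k < q" using row_chainsD(1)[OF D] ka by auto
  obtain s where s: "s \<in> picks q D" "s k = a" using picks_through[OF D ka(1)] by blast
  have pick: "t(k := c) \<in> picks q ?D" if t: "t \<in> picks q D" "t k = a" for t
  proof -
    have "t(k := c) \<in> picks q D" using picks_upd[OF t(1) k ka(2)] .
    then show ?thesis using ka(3) by (simp add: picks_iff)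
  qed
  have "corner r q t \<in> affine hull (insert (corner r q s) (cell q ?D))" if t: "t \<in> picks q D" for t
  proof (cases "t k = a")
    case False
    then have "t \<in> picks q ?D" using t k by (auto simp: picks_iff)
    then show ?thesis by (intro hull_inc) (simp add: corner_in_chain_cell)
  next
    case True
    have "corner r q t = corner r q (t(k := c)) - corner r q (s(k := c)) + corner r q s"
      unfolding corner_upd[OF k] using s True by simp
    also have "\<dots> = 1 *\<^sub>R corner r q (t(k := c)) + (-1) *\<^sub>R corner r q (s(k := c)) + 1 *\<^sub>R corner r q s"
      by simp
    also have "\<dots> \<in> affine hull (insert (corner r q s) (cell q ?D))"
      using pick[OF t True] pick[OF s]
      by (intro mem_affine_3[OF affine_affine_hull] hull_inc) (auto simp: corner_in_chain_cell)
    finally show ?thesis .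
  qed
  then have "cell q D \<subseteq> affine hull (insert (corner r q s) (cell q ?D))"
    unfolding chain_cell_def[of r q D]
    by (intro hull_minimal) (auto intro: affine_imp_convex affine_affine_hull)
  then have "aff_dim (cell q D) \<le> aff_dim (insert (corner r q s) (cell q ?D))"
    by (metis aff_dim_subset aff_dim_affine_hull)
  also have "\<dots> \<le> aff_dim (cell q ?D) + 1" by (simp add: aff_dim_insert)
  finally show "aff_dim (cell q D) \<le> aff_dim (cell q ?D) + 1" .
qed

lemma aff_dim_chain_cell:
  assumes "D \<in> \<C> W q"
  shows "aff_dim (cell q D) = int (card D) - int q"
  using assms
proof (induction "card D - q" arbitrary: D)
  case 0
  then have c: "card D = q" using chain_card_ge[OF 0(2)] by simp
  obtain s where s: "s \<in> picks q D" using picks_nonempty[OF 0(2)] by blast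
  have "s \<in> extensional {..<q}" using s by (simp add: picks_iff)
  then show ?case using chain_card_eq[OF 0(2) c s] chain_cell_graph[of s q] c by simp
next
  case (Suc n)
  note D = Suc.prems
  \<comment> \<open>A pair outside the graph of one pick \<open>s\<close> can be removed, since
    \<open>s\<close> still provides an entry in its row.\<close>
  obtain s where s: "s \<in> picks q D" using picks_nonempty[OF D] by blast
  have "card ((\<lambda>k. (k, s k)) ` {..<q}) \<le> q" by (metis card_image_le card_lessThan finite_lessThan)
  then have "D \<noteq> (\<lambda>k. (k, s k)) ` {..<q}" using Suc(2) by auto
  moreover have sub: "(\<lambda>k. (k, s k)) ` {..<q} \<subseteq> D" using s by (auto simp: picks_iff)
  ultimately obtain k a where ka: "(k, a) \<in> D" "(k, a) \<notin> (\<lambda>k. (k, s k)) ` {..<q}" by auto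
  have "k < q" using ka row_chainsD(1)[OF D] by auto
  then have c: "(k, s k) \<in> D" "a \<noteq> s k" using sub ka by auto
  have card: "card (D - {(k, a)}) = card D - 1" using ka by simp
  have "aff_dim (cell q (D - {(k, a)})) = int (card (D - {(k, a)})) - int q"
    by (rule Suc.hyps(1)) (use Suc(2) card chain_remove[OF D ka(1) c] in auto)
  then show ?case using aff_dim_chain_cell_remove[OF D ka(1) c] card Suc(2) by simp
qed

end

section \<open>The labeled complex and its incidence function\<close>

definition vpicks :: "('v \<Rightarrow> nat) \<Rightarrow> 'v set \<Rightarrow> nat \<Rightarrow> (nat \<Rightarrow> 'v) set" where
  "vpicks \<beta> W q = {s \<in> extensional {..<q}. (\<forall>k<q. s k \<in> W) \<and>
     (\<forall>k l. k < l \<longrightarrow> l < q \<longrightarrow> \<beta> (s k) < \<beta> (s l))}"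

definition plabel :: "nat \<Rightarrow> (nat \<Rightarrow> 'v) \<Rightarrow> 'v monomial" where
  "plabel q s = (\<Sum>k<q. var (s k))"

definition clabel :: "(nat \<times> 'v) set \<Rightarrow> 'v monomial" where
  "clabel D = (\<Sum>d\<in>D. var (snd d))"

text \<open>A label has to be a function on points, so the vertex is decoded from its position. The
  choice ranges over all variables and not over \<open>W\<close>: a point then has the same label in
  all complexes with the same \<open>q\<close>.\<close>

definition corner_label :: "('v::finite \<Rightarrow> nat) \<Rightarrow> ('v \<Rightarrow> nat) \<Rightarrow> nat \<Rightarrow> real^'v \<Rightarrow> 'v monomial" where
  "corner_label r \<beta> q z = plabel q (SOME s. s \<in> vpicks \<beta> UNIV q \<and> corner r q s = z)"

definition chain_complex ::
  "('v::finite \<Rightarrow> nat) \<Rightarrow> ('v \<Rightarrow> nat) \<Rightarrow> 'v set \<Rightarrow> nat \<Rightarrow> (real^'v, 'v) labeled_complex" where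
  "chain_complex r \<beta> W q = (insert {} (chain_cell r q ` row_chains \<beta> W q), corner_label r \<beta> q)"

definition before :: "('v \<Rightarrow> nat) \<Rightarrow> nat \<times> 'v \<Rightarrow> nat \<times> 'v \<Rightarrow> bool" where
  "before r d e \<longleftrightarrow> fst d < fst e \<or> fst d = fst e \<and> r (snd d) < r (snd e)"

text \<open>
  Rows count as oriented simplices and a chain as their product; the summand \<open>fst d\<close> accounts
  for the excess of cardinality over dimension in the earlier rows.
\<close>

definition chain_sign :: "('v \<Rightarrow> nat) \<Rightarrow> (nat \<times> 'v) set \<Rightarrow> nat \<times> 'v \<Rightarrow> int" where
  "chain_sign r D d = (-1) ^ (card {e \<in> D. before r e d} + fst d)"

definition cell_chain :: "('v::finite \<Rightarrow> nat) \<Rightarrow> ('v \<Rightarrow> nat) \<Rightarrow> nat \<Rightarrow> (real^'v) set \<Rightarrow> (nat \<times> 'v) set" where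
  "cell_chain r \<beta> q F = (SOME D. D \<in> row_chains \<beta> UNIV q \<and> F = chain_cell r q D)"

text \<open>The pair that is deleted from the chain of \<open>F\<close> determines the sign. The
  value 1 on the empty face is the convention for vertices.\<close>

definition chain_incidence ::
  "('v::finite \<Rightarrow> nat) \<Rightarrow> ('v \<Rightarrow> nat) \<Rightarrow> nat \<Rightarrow> (real^'v) set \<Rightarrow> (real^'v) set \<Rightarrow> int" where
  "chain_incidence r \<beta> q F G =
     (if codim1_face G F
      then if G = {} then 1
           else chain_sign r (cell_chain r \<beta> q F) (the_elem (cell_chain r \<beta> q F - cell_chain r \<beta> q G))
      else 0)"

lemma row_chains_mono: "D \<in> row_chains \<beta> W q \<Longrightarrow> W \<subseteq> W' \<Longrightarrow> D \<in> row_chains \<beta> W' q"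
  unfolding row_chains_def by blast

lemma picks_vpicks: "D \<in> row_chains \<beta> W q \<Longrightarrow> s \<in> picks q D \<Longrightarrow> s \<in> vpicks \<beta> W q"
proof -
  assume D: "D \<in> row_chains \<beta> W q" and s: "s \<in> picks q D"
  have "s k \<in> W" if "k < q" for k using s row_chainsD(1)[OF D] that by (auto simp: picks_iff)
  moreover have "\<beta> (s k) < \<beta> (s l)" if "k < l" "l < q" for k l
    using s row_chainsD(3)[OF D, of k "s k" l "s l"] that by (simp add: picks_iff)
  ultimately show ?thesis using s by (simp add: vpicks_def picks_iff)
qed

lemma vpicks_graph:
  assumes s: "s \<in> vpicks \<beta> W q"
  shows "(\<lambda>k. (k, s k)) ` {..<q} \<in> row_chains \<beta> W q" "s \<in> picks q ((\<lambda>k. (k, s k)) ` {..<q})"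
  using s by (auto simp: vpicks_def row_chains_def picks_iff)

lemma Union_picks: "(\<Union>D\<in>row_chains \<beta> W q. picks q D) = vpicks \<beta> W q"
  using picks_vpicks vpicks_graph by fast

lemma vpicks_mono: "s \<in> vpicks \<beta> W q \<Longrightarrow> W \<subseteq> W' \<Longrightarrow> s \<in> vpicks \<beta> W' q"
  unfolding vpicks_def by blast

lemma vpicks_inj_on: "s \<in> vpicks \<beta> W q \<Longrightarrow> inj_on s {..<q}"
  unfolding vpicks_def inj_on_def by (metis (no_types, lifting) lessThan_iff less_irrefl linorder_neqE_nat mem_Collect_eq)

text \<open>Lets the order of a pick be recovered from its set of variables: entries in lower blocks
  are exactly the earlier ones.\<close>

lemma vpicks_index:
  assumes s: "s \<in> vpicks \<beta> W q" and k: "k < q"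
  shows "card {v \<in> s ` {..<q}. \<beta> v < \<beta> (s k)} = k"
proof -
  have lt: "\<beta> (s i) < \<beta> (s j)" if "i < j" "j < q" for i j using s that by (simp add: vpicks_def)
  have "i < k" if "i < q" "\<beta> (s i) < \<beta> (s k)" for i
    using lt[of k i] that by (cases i k rule: linorder_cases) auto
  then have "{v \<in> s ` {..<q}. \<beta> v < \<beta> (s k)} = s ` {..<k}"
    using lt[of _ k] k by auto
  moreover have "inj_on s {..<k}" using k by (intro inj_on_subset[OF vpicks_inj_on[OF s]]) auto
  ultimately show ?thesis by (simp add: card_image)
qed

lemma vpicks_eqI:
  assumes s: "s \<in> vpicks \<beta> W q" and s': "s' \<in> vpicks \<beta> W' q" and eq: "s ` {..<q} = s' ` {..<q}"
  shows "s = s'"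
proof (rule extensionalityI[of _ "{..<q}"])
  show "s k = s' k" if "k \<in> {..<q}" for k
  proof -
    have k: "k < q" using that by simp
    then obtain l where l: "l < q" "s k = s' l" using eq by auto
    have "l = k" using vpicks_index[OF s k] vpicks_index[OF s' l(1)] eq l(2) by simp
    then show ?thesis using l by simp
  qed
qed (use s s' in \<open>auto simp: vpicks_def\<close>)

abbreviation "lookup \<equiv> Poly_Mapping.lookup"
abbreviation "keys \<equiv> Poly_Mapping.keys"

lemma lookup_var: "lookup (var a) v = (if v = a then 1 else 0)"
  by (simp add: var_def lookup_single when_def)

lemma lookup_plabel:
  assumes "s \<in> vpicks \<beta> W q"
  shows "lookup (plabel q s) v = (if v \<in> s ` {..<q} then 1 else 0)"
proof -
  have "lookup (plabel q s) v = (\<Sum>k<q. if v = s k then 1 else 0)"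
    by (simp add: plabel_def lookup_sum lookup_var)
  also have "\<dots> = (\<Sum>a\<in>s ` {..<q}. if v = a then 1 else 0)"
    using vpicks_inj_on[OF assms] by (subst sum.reindex) simp_all
  finally show ?thesis by simp
qed

text \<open>Labels are squarefree, so they determine the set of entries and thereby the
  pick.\<close>

lemma plabel_inj:
  assumes "s \<in> vpicks \<beta> W q" "s' \<in> vpicks \<beta> W' q" "plabel q s = plabel q s'"
  shows "s = s'"
proof (rule vpicks_eqI[OF assms(1,2)])
  have "(if v \<in> s ` {..<q} then 1 else 0) = (if v \<in> s' ` {..<q} then 1 else (0::nat))" for v
    by (rule trans[OF lookup_plabel[OF assms(1), symmetric]]) (simp only: assms(3) lookup_plabel[OF assms(2)])
  then have "(v \<in> s ` {..<q}) = (v \<in> s' ` {..<q})" for v by (metis zero_neq_one)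
  then show "s ` {..<q} = s' ` {..<q}" by blast
qed

text \<open>Later rows lie in strictly later blocks, so a variable occurs in one row only; this
  makes the labels of cells squarefree.\<close>

lemma chain_snd_inj:
  assumes D: "D \<in> row_chains \<beta> W q"
  shows "inj_on snd D"
proof (rule inj_onI)
  fix d e assume de: "d \<in> D" "e \<in> D" "snd d = snd e"
  obtain i a where d: "d = (i, a)" by force
  obtain j c where e: "e = (j, c)" by force
  have "\<not> i < j" "\<not> j < i" using row_chainsD(3)[OF D, of i a j c] row_chainsD(3)[OF D, of j c i a] de d e by auto
  then show "d = e" using de d e by simp
qed

lemma lookup_clabel:
  assumes D: "D \<in> row_chains \<beta> (W :: 'v::finite set) q"
  shows "lookup (clabel D) v = (if v \<in> snd ` D then 1 else 0)"
proof -
  have "lookup (clabel D) v = (\<Sum>d\<in>D. if v = snd d then 1 else 0)"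
    by (simp add: clabel_def lookup_sum lookup_var)
  also have "\<dots> = (\<Sum>a\<in>snd ` D. if v = a then 1 else 0)"
    using chain_snd_inj[OF D] by (subst sum.reindex) simp_all
  finally show ?thesis using finite_chain[OF D] by simp
qed

text \<open>Every variable of \<open>D\<close> lies on some pick, and all exponents are 0 or 1. The
  maximum is therefore the indicator of the variables of \<open>D\<close>, and deleting a pair
  divides the label by exactly one variable.\<close>

lemma lcm_plabel:
  assumes D: "D \<in> row_chains \<beta> (W :: 'v::finite set) q"
  shows "lcm_monomial (plabel q ` picks q D) = clabel D"
proof (rule poly_mapping_eqI)
  fix v
  have "lookup (lcm_monomial (plabel q ` picks q D)) v = (SUP s\<in>picks q D. lookup (plabel q s) v)"
    unfolding lcm_monomial_def by (simp add: Abs_poly_mapping_inverse image_image)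
  also have "\<dots> = (SUP s\<in>picks q D. if v \<in> s ` {..<q} then 1 else 0)"
    using lookup_plabel[OF picks_vpicks[OF D]] by (intro SUP_cong) auto
  also have "\<dots> = (if v \<in> snd ` D then 1 else 0)"
  proof (cases "v \<in> snd ` D")
    case True
    then obtain k where k: "(k, v) \<in> D" by force
    then obtain s where s: "s \<in> picks q D" "s k = v" using picks_through[OF D] by blast
    have "k < q" using row_chainsD(1)[OF D] k by auto
    then have *: "v \<in> s ` {..<q}" using s by auto
    have "Max ((\<lambda>s. if v \<in> s ` {..<q} then 1 else 0) ` picks q D) = (1::nat)"
      by (rule Max_eqI) (use s * in \<open>auto intro!: image_eqI[of _ _ s]\<close>)
    then show ?thesis using True s by (subst cSup_eq_Max) auto
  next
    case False
    have "(if v \<in> s ` {..<q} then 1 else 0) = (0::nat)" if "s \<in> picks q D" for s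
      using False that by (force simp: picks_iff)
    then have "(SUP s\<in>picks q D. if v \<in> s ` {..<q} then 1 else 0) = (SUP s\<in>picks q D. 0::nat)"
      by (intro SUP_cong) auto
    then show ?thesis using False picks_nonempty[OF D] by simp
  qed
  finally show "lookup (lcm_monomial (plabel q ` picks q D)) v = lookup (clabel D) v"
    using lookup_clabel[OF D] by simp
qed

lemma verts_empty [simp]: "verts {} = {}"
  by (simp add: verts_def extreme_point_of_def)

lemma chain_sign_remove:
  assumes "finite D" "e \<in> D" "e \<noteq> d"
  shows "chain_sign r D d = (if before r e d then -1 else 1) * chain_sign r (D - {e}) d"
proof (cases "before r e d")
  case True
  then have "{x \<in> D. before r x d} = insert e {x \<in> D - {e}. before r x d}" using assms by auto
  then have "card {x \<in> D. before r x d} = Suc (card {x \<in> D - {e}. before r x d})"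
    using assms(1) by simp
  then show ?thesis using True by (simp add: chain_sign_def)
next
  case False
  then have "{x \<in> D. before r x d} = {x \<in> D - {e}. before r x d}" by auto
  then show ?thesis using False by (simp add: chain_sign_def)
qed

lemma chain_sign_cases: "chain_sign r D d = 1 \<or> chain_sign r D d = -1"
  unfolding chain_sign_def using neg_one_even_power neg_one_odd_power by blast

section \<open>Signs, incidence numbers and the polytopal complex\<close>

context ranking
begin

abbreviation "\<sigma> \<equiv> chain_sign r"

abbreviation "\<K> \<equiv> chain_complex r \<beta>"
abbreviation "\<I> \<equiv> chain_incidence r \<beta>"

lemma before_total: "d \<noteq> e \<Longrightarrow> before r d e \<longleftrightarrow> \<not> before r e d"
  using r_eq_iff[of "snd d" "snd e"] by (auto simp: before_def prod_eq_iff not_less le_less)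

text \<open>Exactly one of \<open>d\<close> and \<open>e\<close> comes before the other, so just one
  of the two deletions shifts the position of the other pair.\<close>

lemma chain_sign_swap:
  assumes "finite D" "d \<in> D" "e \<in> D" "d \<noteq> e"
  shows "\<sigma> D d * \<sigma> (D - {d}) e + \<sigma> D e * \<sigma> (D - {e}) d = 0"
  using chain_sign_remove[of D e d r] chain_sign_remove[of D d e r] before_total[OF assms(4)] assms
  by simp

text \<open>With \<open>q + 1\<close> pairs exactly one row has two entries, and only these can be
  deleted. They share the row summand and all other predecessors, so their positions differ by one
  and their signs are opposite.\<close>

lemma edge_ends:
  assumes D: "D \<in> \<C> W q" and card: "card D = Suc q"
  shows "\<exists>d e. d \<noteq> e \<and> {x \<in> D. D - {x} \<in> \<C> W q} = {d, e} \<and>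
    \<sigma> D d + \<sigma> D e = 0"
proof -
  have fin: "finite D" by (rule finite_chain[OF D])
  obtain s where s: "s \<in> picks q D" using picks_nonempty[OF D] by blast
  let ?G = "(\<lambda>k. (k, s k)) ` {..<q}"
  have G: "?G \<subseteq> D" using s by (auto simp: picks_iff)
  have "inj_on (\<lambda>k. (k, s k)) {..<q}" by (auto simp: inj_on_def)
  then have "card (D - ?G) = 1" using card G by (simp add: card_Diff_subset card_image)
  then obtain k a where ka: "D - ?G = {(k, a)}" by (auto simp: card_1_singleton_iff)
  then have kD: "(k, a) \<in> D" and ne: "(k, a) \<notin> ?G" by blast+
  have k: "k < q" using row_chainsD(1)[OF D] kD by auto
  then have as: "a \<noteq> s k" using ne by auto
  have skD: "(k, s k) \<in> D" using s k by (simp add: picks_iff)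
  have DG: "D = insert (k, a) ?G" using ka G by blast
  have "{x \<in> D. D - {x} \<in> \<C> W q} = {(k, a), (k, s k)}"
  proof
    show "{(k, a), (k, s k)} \<subseteq> {x \<in> D. D - {x} \<in> \<C> W q}"
      using chain_remove[OF D kD skD as] chain_remove[OF D skD kD as[symmetric]] kD skD by simp
    show "{x \<in> D. D - {x} \<in> \<C> W q} \<subseteq> {(k, a), (k, s k)}"
    proof
      fix x assume x: "x \<in> {x \<in> D. D - {x} \<in> \<C> W q}"
      then have "x = (k, a) \<or> x \<in> ?G" using DG by blast
      then show "x \<in> {(k, a), (k, s k)}"
      proof
        assume "x \<in> ?G"
        then obtain l where l: "l < q" "x = (l, s l)" by auto
        have "D - {x} \<in> \<C> W q" using x by simp
        then obtain e where "(l, e) \<in> D - {x}" using row_chainsD(2) l(1) by blast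
        then have "l = k" using DG l by auto
        then show ?thesis using l by simp
      qed simp
    qed
  qed
  moreover have "\<sigma> D (k, a) + \<sigma> D (k, s k) = 0"
  proof -
    have row: "fst x \<noteq> k" if "x \<in> D" "x \<noteq> (k, a)" "x \<noteq> (k, s k)" for x
      using that DG by auto
    have "before r x (k, a) \<longleftrightarrow> before r x (k, s k)" if "x \<in> D" "x \<noteq> (k, a)" "x \<noteq> (k, s k)" for x
      using row[OF that] by (simp add: before_def)
    moreover have "\<not> before r x x" for x by (simp add: before_def)
    ultimately have "{x \<in> D - {(k, s k)}. before r x (k, a)} = {x \<in> D - {(k, a)}. before r x (k, s k)}"
      by blast
    then have "\<sigma> (D - {(k, s k)}) (k, a) = \<sigma> (D - {(k, a)}) (k, s k)"
      by (simp add: chain_sign_def)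
    moreover have ne': "(k, a) \<noteq> (k, s k)" using as by simp
    ultimately show ?thesis
      using chain_sign_remove[OF fin skD ne'[symmetric], of r] chain_sign_remove[OF fin kD ne', of r] before_total[OF ne']
      by simp
  qed
  ultimately show ?thesis using as by blast
qed

lemma corner_label_corner:
  assumes s: "s \<in> vpicks \<beta> W q"
  shows "corner_label r \<beta> q (corner r q s) = plabel q s"
proof -
  have *: "s \<in> vpicks \<beta> UNIV q" by (rule vpicks_mono[OF s]) simp
  define s' where "s' = (SOME t. t \<in> vpicks \<beta> UNIV q \<and> corner r q t = corner r q s)"
  have s': "s' \<in> vpicks \<beta> UNIV q \<and> corner r q s' = corner r q s"
    unfolding s'_def by (rule someI[of _ s]) (use * in auto)
  then have "s' = s"
    using corner_inj[OF vpicks_graph(1) vpicks_graph(1) vpicks_graph(2) vpicks_graph(2)] * by blast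
  then show ?thesis unfolding corner_label_def s'_def by simp
qed

lemma vlabel_verts_chain_cell:
  assumes D: "D \<in> \<C> W q"
  shows "corner_label r \<beta> q ` verts (cell q D) = plabel q ` picks q D"
  unfolding verts_chain_cell[OF D] image_image
  using corner_label_corner[OF picks_vpicks[OF D]] by simp

lemma face_label_chain_cell:
  assumes D: "D \<in> \<C> W q"
  shows "face_label (\<K> W' q) (cell q D) = clabel D"
  unfolding face_label_def chain_complex_def using vlabel_verts_chain_cell[OF D] lcm_plabel[OF D] by simp

lemma label_cells_chain_complex:
  "label_cells (\<K> W q) = insert {} ((\<lambda>D. plabel q ` picks q D) ` \<C> W q)"
  unfolding label_cells_def chain_complex_def using vlabel_verts_chain_cell by (simp add: image_image)

lemma cell_chain_chain_cell:
  assumes D: "D \<in> \<C> W q"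
  shows "cell_chain r \<beta> q (cell q D) = D"
proof -
  have "D \<in> \<C> UNIV q" by (rule row_chains_mono[OF D]) simp
  then have "(\<lambda>E. E \<in> \<C> UNIV q \<and> cell q D = cell q E) (cell_chain r \<beta> q (cell q D))"
    unfolding cell_chain_def by (intro someI[where P = "\<lambda>E. E \<in> \<C> UNIV q \<and> cell q D = cell q E"]) simp
  then show ?thesis using chain_cell_eq_iff[OF D] by blast
qed

lemma polytopal_chain_complex: "polytopal_complex (cells (\<K> W q))"
proof -
  have face: "G \<in> insert {} (cell q ` \<C> W q)"
    if "G face_of cell q D" "D \<in> \<C> W q" for G D
    using face_of_chain_cell[OF that(2,1)] by blast
  \<comment> \<open>The intersection of two chains is again a chain unless some row becomes empty,
    and then the cells are disjoint.\<close>
  have int: "(cell q D \<inter> cell q E) face_of cell q D"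
    if D: "D \<in> \<C> W q" and E: "E \<in> \<C> W q" for D E
  proof (cases "\<forall>k<q. \<exists>a. (k, a) \<in> D \<inter> E")
    case True
    then have "D \<inter> E \<in> \<C> W q" by (intro row_chains_subset[OF D]) auto
    then show ?thesis unfolding chain_cell_Int[OF D E] by (intro chain_cell_face_of[OF D]) auto
  next
    case False
    then have "picks q (D \<inter> E) = {}" unfolding set_eq_iff picks_iff by blast
    then show ?thesis unfolding chain_cell_Int[OF D E] by (simp add: chain_cell_def)
  qed
  show ?thesis
    unfolding polytopal_complex_def chain_complex_def fst_conv
  proof (intro conjI ballI allI impI)
    fix F G assume F: "F \<in> insert {} (cell q ` \<C> W q)"
      and G: "G \<in> insert {} (cell q ` \<C> W q)"
    show "(F \<inter> G) face_of F"
      using F G int by (elim insertE imageE) simp_all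
    show "(F \<inter> G) face_of G"
      using F G int by (elim insertE imageE) (simp_all add: Int_commute)
  next
    fix F G assume "F \<in> insert {} (cell q ` \<C> W q)" "G face_of F"
    then show "G \<in> insert {} (cell q ` \<C> W q)"
      using face face_of_empty by blast
  qed (auto simp: polytope_chain_cell polytope_empty)
qed

text \<open>The number of pairs exceeds the dimension by the constant \<open>q\<close>, so
  codimension one means one pair less.\<close>

lemma codim1_face_chain_cell:
  assumes D: "D \<in> \<C> W q" and E: "E \<in> \<C> W q"
  shows "codim1_face (cell q E) (cell q D) \<longleftrightarrow> (\<exists>d\<in>D. E = D - {d})"
proof
  assume c: "codim1_face (cell q E) (cell q D)"
  then have "cell q E \<subseteq> cell q D" using face_of_imp_subset by (auto simp: codim1_face_def)
  then have sub: "E \<subseteq> D" using chain_cell_subset_iff[OF E D] by simp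
  have "int (card E) = int (card D) - 1"
    using c aff_dim_chain_cell[OF D] aff_dim_chain_cell[OF E] by (simp add: codim1_face_def)
  then have "card (D - E) = 1" using sub finite_chain[OF E] by (simp add: card_Diff_subset)
  then obtain d where "D - E = {d}" by (auto simp: card_1_singleton_iff)
  then show "\<exists>d\<in>D. E = D - {d}" using sub by (intro bexI[of _ d]) auto
next
  assume "\<exists>d\<in>D. E = D - {d}"
  then obtain d where d: "d \<in> D" "E = D - {d}" by blast
  then have "card D = Suc (card E)" using card.remove[OF finite_chain[OF D] d(1)] by simp
  then show "codim1_face (cell q E) (cell q D)"
    using chain_cell_face_of[OF D E] d aff_dim_chain_cell[OF D] aff_dim_chain_cell[OF E] by (auto simp: codim1_face_def)
qed

lemma chain_incidence_chain_cell:
  assumes D: "D \<in> \<C> W q" and d: "d \<in> D" and E: "D - {d} \<in> \<C> W q"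
  shows "\<I> q (cell q D) (cell q (D - {d})) = \<sigma> D d"
proof -
  have "D - (D - {d}) = {d}" using d by auto
  moreover have "codim1_face (cell q (D - {d})) (cell q D)"
    using codim1_face_chain_cell[OF D E] d by blast
  ultimately show ?thesis
    using chain_cell_nonempty[OF E] by (simp add: chain_incidence_def cell_chain_chain_cell[OF D] cell_chain_chain_cell[OF E])
qed

lemma codim1_face_empty: "codim1_face {} F \<longleftrightarrow> aff_dim F = 0"
  by (auto simp: codim1_face_def)

lemma not_codim1_face_of_empty: "\<not> codim1_face G {}"
  by (auto simp: codim1_face_def)

text \<open>Over a nonempty face \<open>H\<close> the relation is the sign exchange for two
  deletions. Over the empty face, \<open>F\<close> is an edge and the relation says that its two
  ends carry opposite signs.\<close>

lemma incidence_function_chain_complex: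
  "incidence_function (cells (\<K> W q)) (\<I> q)"
  unfolding incidence_function_def chain_complex_def fst_conv
proof (intro conjI ballI allI impI)
  let ?X = "insert {} (cell q ` \<C> W q)"
  fix F G assume "F \<in> ?X" "G \<in> ?X"
  show "if codim1_face G F then \<I> q F G \<in> {1, - 1} else \<I> q F G = 0"
    using chain_sign_cases[of r "cell_chain r \<beta> q F" "the_elem (cell_chain r \<beta> q F - cell_chain r \<beta> q G)"]
    by (auto simp: chain_incidence_def)
next
  fix v :: "real^'v"
  show "\<I> q {v} {} = 1" by (simp add: chain_incidence_def codim1_face_empty)
next
  let ?X = "insert {} (cell q ` \<C> W q)"
  fix F G1 G2 H
  assume F: "F \<in> ?X" and G: "G1 \<in> ?X" "G2 \<in> ?X" and H: "H \<in> ?X"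
    and c: "G1 \<noteq> G2 \<and> codim1_face G1 F \<and> codim1_face G2 F \<and> codim1_face H G1 \<and> codim1_face H G2"
  have "F \<noteq> {}" "G1 \<noteq> {}" "G2 \<noteq> {}" using c not_codim1_face_of_empty by auto
  then obtain D E1 E2 where D: "D \<in> \<C> W q" "F = cell q D"
    and E1: "E1 \<in> \<C> W q" "G1 = cell q E1" and E2: "E2 \<in> \<C> W q" "G2 = cell q E2"
    using F G by (elim insertE imageE) auto
  obtain d1 where d1: "d1 \<in> D" "E1 = D - {d1}" using c codim1_face_chain_cell[OF D(1) E1(1)] D E1 by blast
  obtain d2 where d2: "d2 \<in> D" "E2 = D - {d2}" using c codim1_face_chain_cell[OF D(1) E2(1)] D E2 by blast
  have ne: "d1 \<noteq> d2" using c E1 E2 d1 d2 by auto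
  have i1: "\<I> q F G1 = \<sigma> D d1"
    using chain_incidence_chain_cell[OF D(1) d1(1)] E1 D d1 by simp
  have i2: "\<I> q F G2 = \<sigma> D d2"
    using chain_incidence_chain_cell[OF D(1) d2(1)] E2 D d2 by simp
  have fin: "finite D" by (rule finite_chain[OF D(1)])
  show "\<I> q F G1 * \<I> q G1 H + \<I> q F G2 * \<I> q G2 H = 0"
  proof (cases "H = {}")
    case True
    then have "aff_dim (cell q E1) = 0" using c E1 by (simp add: codim1_face_empty)
    then have "card E1 = q" using aff_dim_chain_cell[OF E1(1)] by simp
    then have cD: "card D = Suc q" using card.remove[OF fin d1(1)] unfolding d1(2) by (simp only:)
    obtain e e' where e: "{x \<in> D. D - {x} \<in> \<C> W q} = {e, e'}"
      and sgn: "\<sigma> D e + \<sigma> D e' = 0"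
      using edge_ends[OF D(1) cD] by (elim exE conjE)
    have "d1 \<in> {e, e'}" "d2 \<in> {e, e'}" unfolding e[symmetric] using d1 d2 E1 E2 by simp_all
    then have "\<sigma> D d1 + \<sigma> D d2 = 0" using sgn ne by auto
    moreover have "\<I> q G1 H = 1" "\<I> q G2 H = 1"
      using c True by (simp_all add: chain_incidence_def)
    ultimately show ?thesis unfolding i1 i2 by simp
  next
    case False
    then obtain E where E: "E \<in> \<C> W q" "H = cell q E" using H by blast
    obtain h1 where h1: "h1 \<in> E1" "E = E1 - {h1}" using c codim1_face_chain_cell[OF E1(1) E(1)] E E1 by blast
    obtain h2 where h2: "h2 \<in> E2" "E = E2 - {h2}" using c codim1_face_chain_cell[OF E2(1) E(1)] E E2 by blast
    have "h1 = d2" "h2 = d1" using h1 h2 d1 d2 ne by auto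
    then have "\<I> q G1 H = \<sigma> (D - {d1}) d2"
      "\<I> q G2 H = \<sigma> (D - {d2}) d1"
      using chain_incidence_chain_cell[OF E1(1) h1(1)] chain_incidence_chain_cell[OF E2(1) h2(1)] E E1 E2 h1 h2 d1 d2 by simp_all
    then show ?thesis unfolding i1 i2 using chain_sign_swap[OF fin d1(1) d2(1) ne] by simp
  qed
qed

section \<open>Embedding dimension, connectedness and vertex labels\<close>

text \<open>Shifted ranks increase along a pick, and that of the last entry is at most
  \<open>card W - 1 - (q - 1)\<close> when \<open>W\<close> occupies the first ranks. So only the
  coordinates of rank 1 to \<open>card W - q\<close> can be nonzero.\<close>

lemma lies_in_Rd_chain_complex:
  assumes q: "1 \<le> q" and W: "r ` W = {..<card W}"
  shows "lies_in_Rd (card W - q) (\<K> W q)"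
  unfolding lies_in_Rd_def
proof (intro exI conjI)
  define A where "A = {v. 0 < r v \<and> r v \<le> card W - q}"
  let ?U = "{z :: real^'v. \<forall>v. v \<notin> A \<longrightarrow> z $ v = 0}"
  show "subspace ?U" by (auto simp: subspace_def)
  have "card W \<le> CARD('v)" by (rule card_mono) auto
  have "r ` A = {1..card W - q}"
  proof
    show "{1..card W - q} \<subseteq> r ` A"
    proof
      fix c assume c: "c \<in> {1..card W - q}"
      then have "c \<in> {..<CARD('v)}" using q \<open>card W \<le> CARD('v)\<close> by auto
      then obtain v where "r v = c" using r_bij unfolding bij_betw_def by (metis imageE)
      then show "c \<in> r ` A" using c by (auto simp: A_def)
    qed
  qed (auto simp: A_def)
  moreover have "inj_on r A" by (auto simp: inj_on_def)
  ultimately have "card A = card W - q" by (metis card_image card_atLeastAtMost diff_Suc_1)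
  have "dim ?U = card A" using dim_substandard_cart[of A, where 'a = real] by (simp add: dim_vec_eq)
  then show "dim ?U = card W - q" using \<open>card A = card W - q\<close> by simp
  have corner: "corner r q s \<in> ?U" if s: "s \<in> vpicks \<beta> W q" for s
  proof (intro CollectI allI impI)
    fix v assume v: "v \<notin> A"
    have "stair r k (s k) $ v = 0" if k: "k < q" for k
    proof (rule ccontr)
      assume "stair r k (s k) $ v \<noteq> 0"
      then have rv: "0 < r v" "r v + k \<le> r (s k)" by (auto simp: stair_def split: if_splits)
      note G = vpicks_graph[OF s]
      have "r (s k) + (q - 1) \<le> r (s (q - 1)) + k"
      proof (cases "k = q - 1")
        case False
        then have "k < q - 1" "q - 1 < q" using k by auto
        then show ?thesis using chain_rank[OF G(1), of k "s k" "q - 1" "s (q - 1)"] k by simp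
      qed simp
      moreover have "s (q - 1) \<in> W" using s q by (simp add: vpicks_def)
      then have "r (s (q - 1)) < card W" using W by blast
      ultimately have "r v + q \<le> card W" using rv by linarith
      then show False using v rv by (simp add: A_def)
    qed
    then show "corner r q s $ v = 0" by (simp add: corner_def)
  qed
  have "convex ?U" using \<open>subspace ?U\<close> by (rule subspace_imp_convex)
  then have "cell q D \<subseteq> ?U" if "D \<in> \<C> W q" for D
    unfolding chain_cell_def using corner picks_vpicks[OF that] by (intro hull_minimal) auto
  then show "\<Union> (cells (\<K> W q)) \<subseteq> ?U" by (auto simp: chain_complex_def)
qed

text \<open>\<open>f\<close> is the lowest vertex, with entries in the blocks 1 to \<open>q\<close>.
  Any vertex is moved to \<open>f\<close> by replacing its entries one at a time from row 0 upwards,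
  and each move stays within one cell.\<close>

lemma connected_chain_complex:
  assumes \<beta>1: "\<And>v. v \<in> W \<Longrightarrow> 1 \<le> \<beta> v" and f: "\<And>k. k < q \<Longrightarrow> f k \<in> W \<and> \<beta> (f k) = Suc k"
  shows "connected (\<Union> (cells (\<K> W q)))"
proof -
  let ?U = "\<Union> (cells (\<K> W q))"
  have cell: "connected_component ?U x y" if "D \<in> \<C> W q" "x \<in> cell q D" "y \<in> cell q D" for D x y
    unfolding connected_component_def
    using that convex_connected[OF convex_chain_cell[of r q D]] by (intro exI[of _ "cell q D"]) (auto simp: chain_complex_def)
  define g where "g s j = restrict (\<lambda>k. if k < j then f k else s k) {..<q}" for s j
  \<comment> \<open>Blocks increase strictly from at least 1, so row \<open>k\<close> of a pick lies
    in block \<open>k + 1\<close> or later. Hence the later entries remain above those already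
    replaced by entries of \<open>f\<close>.\<close>
  have base: "Suc k \<le> \<beta> (s k)" if s: "s \<in> vpicks \<beta> W q" and "k < q" for s k
    using that(2)
  proof (induction k)
    case 0
    then show ?case using \<beta>1[of "s 0"] s by (simp add: vpicks_def)
  next
    case (Suc k)
    then have "\<beta> (s k) < \<beta> (s (Suc k))" using s by (simp add: vpicks_def)
    then show ?case using Suc by simp
  qed
  have step: "connected_component ?U (corner r q (g s j)) (corner r q (g s (Suc j)))"
    if s: "s \<in> vpicks \<beta> W q" and j: "j < q" for s j
  proof (rule cell)
    \<comment> \<open>The edge with both \<open>s j\<close> and \<open>f j\<close> in row
      \<open>j\<close>, or a single vertex if they agree.\<close>
    let ?D = "(\<lambda>k. (k, g s j k)) ` {..<q} \<union> {(j, f j)}"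
    have mem: "(k, a) \<in> ?D \<longleftrightarrow> k < q \<and> (a = (if k < j then f k else s k) \<or> k = j \<and> a = f j)" for k a
      using j by (auto simp: g_def)
    have sW: "s k \<in> W" if "k < q" for k using s that by (simp add: vpicks_def)
    have slt: "\<beta> (s k) < \<beta> (s l)" if "k < l" "l < q" for k l using s that by (simp add: vpicks_def)
    show "?D \<in> \<C> W q"
      unfolding row_chains_def
    proof (intro CollectI conjI allI impI)
      show "?D \<subseteq> {..<q} \<times> W"
        using f sW j by (auto simp: g_def)
      show "?D `` {k} \<noteq> {}" if "k < q" for k using that by auto
      fix k l a c assume ka: "(k, a) \<in> ?D" and lc: "(l, c) \<in> ?D" and kl: "k < l"
      have "l < q" using lc mem by blast
      then have fkl: "\<beta> (f k) = Suc k" "\<beta> (f l) = Suc l" "Suc l \<le> \<beta> (s l)" "\<beta> (s k) < \<beta> (s l)"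
        using f[of k] f[of l] base[OF s, of l] slt[OF kl] kl by auto
      have a: "a = (if k < j then f k else s k) \<or> k = j \<and> a = f j" using ka mem by blast
      have c: "c = (if l < j then f l else s l) \<or> l = j \<and> c = f j" using lc mem by blast
      consider "a = f k" | "a = s k" "j \<le> k" using a by (auto split: if_splits)
      then show "\<beta> a < \<beta> c"
      proof cases
        case 1
        have "c = f l \<or> c = s l" using c by (auto split: if_splits)
        then show ?thesis using 1 fkl kl by auto
      next
        case 2
        then have "c = s l" using c kl by (auto split: if_splits)
        then show ?thesis using 2 fkl by simp
      qed
    qed
    have ext: "g s i \<in> extensional {..<q}" for i by (simp add: g_def)
    have "g s j \<in> picks q ?D" using ext by (simp add: picks_iff)
    moreover have "g s (Suc j) \<in> picks q ?D"
      unfolding picks_iff using ext mem by (auto simp: g_def less_Suc_eq)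
    ultimately show "corner r q (g s j) \<in> cell q ?D" "corner r q (g s (Suc j)) \<in> cell q ?D"
      by (simp_all add: corner_in_chain_cell)
  qed
  have "connected_component ?U x (corner r q (g f q))" if x: "x \<in> ?U" for x
  proof -
    obtain D where D: "D \<in> \<C> W q" "x \<in> cell q D" using x by (auto simp: chain_complex_def)
    obtain s where s: "s \<in> picks q D" using picks_nonempty[OF D(1)] by blast
    have sv: "s \<in> vpicks \<beta> W q" by (rule picks_vpicks[OF D(1) s])
    have c0: "connected_component ?U x (corner r q s)" by (rule cell[OF D corner_in_chain_cell[OF s]])
    have g0: "g s 0 = s"
      by (rule extensionalityI[of _ "{..<q}"]) (use s in \<open>auto simp: g_def picks_iff\<close>)
    have "connected_component ?U x (corner r q (g s j))" if "j \<le> q" for j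
      using that
    proof (induction j)
      case 0
      then show ?case using c0 g0 by simp
    next
      case (Suc j)
      then show ?case using step[OF sv, of j] connected_component_trans by fastforce
    qed
    from this[of q] have "connected_component ?U x (corner r q (g s q))" by simp
    moreover have "g s q = g f q" by (auto simp: g_def fun_eq_iff)
    ultimately show ?thesis by simp
  qed
  then show ?thesis
    unfolding connected_iff_connected_component
    by (meson connected_component_sym connected_component_trans)
qed

lemma labeled_by_chain_complex: "labeled_by (\<K> W q) (plabel q ` vpicks \<beta> W q)"
proof -
  have verts: "(\<Union>F\<in>cells (\<K> W q). verts F) = corner r q ` vpicks \<beta> W q"
    unfolding Union_picks[symmetric] chain_complex_def using verts_chain_cell by (simp add: image_UN)
  have "inj_on (corner_label r \<beta> q) (corner r q ` vpicks \<beta> W q)"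
    using corner_label_corner plabel_inj by (force simp: inj_on_def)
  moreover have "corner_label r \<beta> q ` corner r q ` vpicks \<beta> W q = plabel q ` vpicks \<beta> W q"
    using corner_label_corner by (simp add: image_image)
  ultimately show ?thesis
    unfolding labeled_by_def verts by (simp add: chain_complex_def bij_betw_def)
qed

end

section \<open>Acyclicity in a fixed multidegree\<close>

text \<open>Here \<open>\<phi>\<close> is a chain with coefficients, and the value is the
  coefficient of \<open>E\<close> in its boundary, collected from the sets with one more pair. Sets
  need not be row chains, so that the square vanishes by sign algebra alone;
  \<open>chain_boundary\<close> is the version of the cell complex.\<close>

definition boundary ::
  "('v::finite \<Rightarrow> nat) \<Rightarrow> nat \<Rightarrow> ((nat \<times> 'v) set \<Rightarrow> 'k::comm_ring_1) \<Rightarrow> (nat \<times> 'v) set \<Rightarrow> 'k" where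
  "boundary r q \<phi> E =
     (\<Sum>d\<in>{..<q} \<times> UNIV - E. of_int (chain_sign r (insert d E) d) * \<phi> (insert d E))"

definition chain_boundary ::
  "('v::finite \<Rightarrow> nat) \<Rightarrow> ('v \<Rightarrow> nat) \<Rightarrow> nat \<Rightarrow> ((nat \<times> 'v) set \<Rightarrow> 'k::comm_ring_1) \<Rightarrow> (nat \<times> 'v) set \<Rightarrow> 'k" where
  "chain_boundary r \<beta> q \<phi> E = (if E \<in> row_chains \<beta> UNIV q then boundary r q \<phi> E else 0)"

lemma boundary_eqI:
  assumes "\<And>d. d \<in> {..<q} \<times> UNIV - E \<Longrightarrow> \<phi> (insert d E) = \<psi> (insert d E)"
  shows "boundary r q \<phi> E = boundary r q \<psi> E"
  unfolding boundary_def using assms by (intro sum.cong) auto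

lemma boundary_nonzeroE:
  assumes "boundary r q \<phi> E \<noteq> 0"
  obtains d where "d \<in> {..<q} \<times> UNIV" "d \<notin> E" "\<phi> (insert d E) \<noteq> 0"
proof -
  have "\<not> (\<forall>d\<in>{..<q} \<times> UNIV - E. \<phi> (insert d E) = 0)"
  proof
    assume "\<forall>d\<in>{..<q} \<times> UNIV - E. \<phi> (insert d E) = 0"
    then have "boundary r q \<phi> E = 0" unfolding boundary_def by (intro sum.neutral) auto
    then show False using assms by simp
  qed
  then show ?thesis using that by blast
qed

lemma boundary_add: "boundary r q (\<lambda>D. \<phi> D + \<psi> D) E = boundary r q \<phi> E + boundary r q \<psi> E"
  by (simp add: boundary_def algebra_simps sum.distrib)

lemma boundary_diff: "boundary r q (\<lambda>D. \<phi> D - \<psi> D) E = boundary r q \<phi> E - boundary r q \<psi> E"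
  by (simp add: boundary_def algebra_simps sum_subtractf)

lemma subchain:
  assumes "E \<in> row_chains \<beta> UNIV q" "insert d E \<in> row_chains \<beta> W q"
  shows "E \<in> row_chains \<beta> W q"
  using row_chainsD(2)[OF assms(1)] by (intro row_chains_subset[OF assms(2)]) auto

lemma chain_boundary_support:
  assumes "\<And>D. \<phi> D \<noteq> 0 \<Longrightarrow> D \<in> row_chains \<beta> W q \<and> card D = Suc c" and "chain_boundary r \<beta> q \<phi> E \<noteq> 0"
  shows "E \<in> row_chains \<beta> W q \<and> card E = c"
proof -
  have E: "E \<in> row_chains \<beta> UNIV q" "boundary r q \<phi> E \<noteq> 0"
    using assms(2) by (auto simp: chain_boundary_def split: if_splits)
  obtain d where d: "d \<notin> E" "\<phi> (insert d E) \<noteq> 0" using E(2) by (rule boundary_nonzeroE)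
  then show ?thesis using assms(1)[OF d(2)] subchain[OF E(1), of d W] finite_chain[OF E(1)] by simp
qed

text \<open>A set above a row chain has no empty row, and such a subset of a row chain is itself
  one. So if \<open>D\<close> is none, nothing above \<open>D\<close> is in the support. This
  reconciles the two boundary maps when they are iterated.\<close>

lemma boundary_off_chains:
  assumes supp: "\<And>D. \<phi> D \<noteq> 0 \<Longrightarrow> D \<in> row_chains \<beta> UNIV q" and E: "E \<in> row_chains \<beta> UNIV q" and "E \<subseteq> D"
    and "D \<notin> row_chains \<beta> UNIV q"
  shows "boundary r q \<phi> D = 0"
proof (rule ccontr)
  assume "boundary r q \<phi> D \<noteq> 0"
  then obtain d where "\<phi> (insert d D) \<noteq> 0" by (rule boundary_nonzeroE)
  then have "insert d D \<in> row_chains \<beta> UNIV q" by (rule supp)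
  then have "D \<in> row_chains \<beta> UNIV q"
  proof (rule row_chains_subset)
    show "\<exists>a. (k, a) \<in> D" if "k < q" for k using row_chainsD(2)[OF E that] \<open>E \<subseteq> D\<close> by blast
  qed auto
  then show False using assms(4) by simp
qed

lemma boundary_chain_boundary:
  assumes "\<And>D. \<phi> D \<noteq> 0 \<Longrightarrow> D \<in> row_chains \<beta> UNIV q" and "E \<in> row_chains \<beta> UNIV q"
  shows "boundary r q (chain_boundary r \<beta> q \<phi>) E = boundary r q (boundary r q \<phi>) E"
proof (rule boundary_eqI)
  fix d assume "d \<in> {..<q} \<times> UNIV - E"
  show "chain_boundary r \<beta> q \<phi> (insert d E) = boundary r q \<phi> (insert d E)"
  proof (cases "insert d E \<in> row_chains \<beta> UNIV q")
    case False
    have "boundary r q \<phi> (insert d E) = 0"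
      by (rule boundary_off_chains[OF _ assms(2) _ False]) (use assms(1) in auto)
    then show ?thesis using False by (simp add: chain_boundary_def)
  qed (simp add: chain_boundary_def)
qed

section \<open>Contraction of the chain complex row by row\<close>

context ranking
begin

abbreviation "bd \<equiv> boundary r"
abbreviation "\<B> \<equiv> chain_boundary r \<beta>"

text \<open>Adding the same two pairs in the two possible orders yields terms of opposite
  sign.\<close>

lemma boundary_boundary:
  assumes fin: "finite E"
  shows "bd q (bd q \<phi>) E = 0"
proof -
  let ?N = "{..<q} \<times> (UNIV :: 'v set) - E"
  define T where "T d e = of_int (\<sigma> (insert d E) d) *
    (of_int (\<sigma> (insert e (insert d E)) e) * \<phi> (insert e (insert d E)))" for d e
  have T: "T d e + T e d = 0" if "d \<in> ?N" "e \<in> ?N" "d \<noteq> e" for d e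
  proof -
    let ?D = "insert e (insert d E)"
    have "?D - {d} = insert e E" "?D - {e} = insert d E" "insert d (insert e E) = ?D" using that by auto
    then have *: "\<sigma> ?D d * \<sigma> (insert e E) e + \<sigma> ?D e * \<sigma> (insert d E) d = 0"
      using chain_sign_swap[of ?D d e] that fin by simp
    have "T d e + T e d = of_int (\<sigma> ?D d * \<sigma> (insert e E) e + \<sigma> ?D e * \<sigma> (insert d E) d) * \<phi> ?D"
      unfolding T_def \<open>insert d (insert e E) = ?D\<close> by (simp add: algebra_simps)
    then show ?thesis using * by simp
  qed
  have fN: "finite ?N" by simp
  have "bd q (bd q \<phi>) E = (\<Sum>d\<in>?N. \<Sum>e\<in>{..<q} \<times> UNIV - insert d E. T d e)"
    by (simp add: boundary_def T_def sum_distrib_left)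
  also have "\<dots> = (\<Sum>d\<in>?N. \<Sum>e\<in>?N. if d \<noteq> e then T d e else 0)"
    by (intro sum.cong sum.mono_neutral_cong_left) auto
  \<comment> \<open>Ordered pairs are split by \<open>before\<close> and then matched. Summing
    \<open>T d e + T e d\<close> over all pairs would only yield twice the sum, which says nothing
    in characteristic 2.\<close>
  also have "\<dots> = (\<Sum>d\<in>?N. \<Sum>e\<in>?N. (if before r d e then T d e else 0) + (if before r e d then T d e else 0))"
  proof (intro sum.cong refl)
    fix d e
    have "\<not> before r d d" by (simp add: before_def)
    then show "(if d \<noteq> e then T d e else 0) = (if before r d e then T d e else 0) + (if before r e d then T d e else 0)"
      using before_total[of d e] by (cases "d = e") auto
  qed
  also have "\<dots> = (\<Sum>d\<in>?N. \<Sum>e\<in>?N. if before r d e then T d e else 0)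
      + (\<Sum>d\<in>?N. \<Sum>e\<in>?N. if before r e d then T d e else 0)"
    by (simp add: sum.distrib)
  also have "(\<Sum>d\<in>?N. \<Sum>e\<in>?N. if before r e d then T d e else 0)
      = (\<Sum>d\<in>?N. \<Sum>e\<in>?N. if before r d e then T e d else 0)"
    by (rule sum.swap)
  also have "(\<Sum>d\<in>?N. \<Sum>e\<in>?N. if before r d e then T d e else 0) + \<dots>
      = (\<Sum>d\<in>?N. \<Sum>e\<in>?N. (if before r d e then T d e else 0) + (if before r d e then T e d else 0))"
    by (simp add: sum.distrib)
  also have "\<dots> = 0"
  proof (intro sum.neutral ballI)
    fix d e assume "d \<in> ?N" "e \<in> ?N"
    moreover have "\<not> before r d d" by (simp add: before_def)
    ultimately show "(if before r d e then T d e else 0) + (if before r d e then T e d else 0) = 0"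
      using T[of d e] by (cases "d = e") auto
  qed
  finally show ?thesis .
qed

text \<open>The lower rows contribute \<open>j\<close> earlier pairs and row \<open>j\<close> none,
  so the exponent is \<open>j + j\<close>. With the row summand in \<open>chain_sign\<close>, pivots
  thus have sign 1.\<close>

lemma chain_sign_first:
  assumes low: "\<And>k. k < j \<Longrightarrow> {v. (k, v) \<in> D} = {w k}" and row: "\<And>v. (j, v) \<in> D \<Longrightarrow> r a \<le> r v"
  shows "\<sigma> D (j, a) = 1"
proof -
  have "{e \<in> D. before r e (j, a)} = (\<lambda>k. (k, w k)) ` {..<j}"
  proof (intro set_eqI iffI)
    fix e assume e: "e \<in> {e \<in> D. before r e (j, a)}"
    obtain k v where kv: "e = (k, v)" by force
    then have "k < j" using e row[of v] by (auto simp: before_def)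
    moreover have "v \<in> {v. (k, v) \<in> D}" using e kv by simp
    ultimately show "e \<in> (\<lambda>k. (k, w k)) ` {..<j}" using low kv by auto
  next
    fix e assume "e \<in> (\<lambda>k. (k, w k)) ` {..<j}"
    then obtain k where k: "k < j" "e = (k, w k)" by auto
    then show "e \<in> {e \<in> D. before r e (j, a)}" using low[OF k(1)] by (auto simp: before_def)
  qed
  moreover have "inj_on (\<lambda>k. (k, w k)) {..<j}" by (auto simp: inj_on_def)
  ultimately show ?thesis by (simp add: chain_sign_def card_image flip: mult_2)
qed

text \<open>
  The contracting homotopy for row \<open>j\<close>: insert the first vertex \<open>a\<close> occurring in that row.
\<close>

lemma contract_row:
  fixes \<phi> :: "(nat \<times> 'v) set \<Rightarrow> 'k::comm_ring_1"
  assumes j: "j < q"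
    and supp: "\<And>D. \<phi> D \<noteq> 0 \<Longrightarrow> D \<in> \<C> W q \<and> card D = c"
    and low: "\<And>D k v. \<phi> D \<noteq> 0 \<Longrightarrow> k < j \<Longrightarrow> (k, v) \<in> D \<Longrightarrow> v = w k"
    and cycle: "\<And>E. E \<in> \<C> UNIV q \<Longrightarrow> bd q \<phi> E = 0"
  shows "\<exists>\<psi> a. (\<forall>D. \<psi> D \<noteq> 0 \<longrightarrow> D \<in> \<C> W q \<and> card D = Suc c) \<and>
    (\<forall>E\<in>\<C> UNIV q. \<phi> E - bd q \<psi> E \<noteq> 0 \<longrightarrow>
       (\<forall>k v. k < Suc j \<longrightarrow> (k, v) \<in> E \<longrightarrow> v = (w(j := a)) k))"
proof (cases "\<forall>D. \<phi> D = 0")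
  case True
  then show ?thesis by (intro exI[of _ "\<lambda>_. 0"]) (simp add: boundary_def)
next
  case False
  \<comment> \<open>The pivot \<open>a\<close> will have the least rank among all entries of row
    \<open>j\<close> in the support of \<open>\<phi>\<close>, so that one choice serves all
    chains.\<close>
  define V where "V = {v. \<exists>D. \<phi> D \<noteq> 0 \<and> (j, v) \<in> D}"
  have "V \<noteq> {}"
  proof -
    obtain D where D: "\<phi> D \<noteq> 0" using False by blast
    then obtain v where "(j, v) \<in> D" using supp[OF D] row_chainsD(2) j by metis
    then show ?thesis using D by (auto simp: V_def)
  qed
  then obtain a where a: "a \<in> V" "\<And>v. v \<in> V \<Longrightarrow> r a \<le> r v"
    using ex_has_least_nat[of "\<lambda>v. v \<in> V" _ r] by blast
  obtain D1 where D1: "\<phi> D1 \<noteq> 0" "(j, a) \<in> D1" using a(1) by (auto simp: V_def)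
  have row: "r a \<le> r v" if "\<phi> D \<noteq> 0" "(j, v) \<in> D" for D v
    using a(2) that by (auto simp: V_def)
  have lowset: "{v. (k, v) \<in> D} = {w k}" if D: "\<phi> D \<noteq> 0" and k: "k < j" for D k
  proof -
    obtain v where "(k, v) \<in> D" using supp[OF D] row_chainsD(2) k j less_trans by metis
    then show ?thesis using low[OF D k] by auto
  qed
  define \<psi> where "\<psi> D = (if (j, a) \<in> D then \<phi> (D - {(j, a)}) else 0)" for D
  have \<psi>_supp: "D \<in> \<C> W q \<and> card D = Suc c" if "\<psi> D \<noteq> 0" for D
  proof -
    define D0 where "D0 = D - {(j, a)}"
    have jD: "(j, a) \<in> D" and D0: "\<phi> D0 \<noteq> 0" using that by (auto simp: \<psi>_def D0_def split: if_splits)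
    have D: "D = insert (j, a) D0" "(j, a) \<notin> D0" using jD by (auto simp: D0_def)
    note C0 = supp[OF D0]
    note C1 = supp[OF D1(1)]
    have aW: "a \<in> W" using row_chainsD(1) C1 D1(2) by blast
    \<comment> \<open>Least rank means a block not beyond that of any entry of row \<open>j\<close>
      in the support, so the higher rows stay above \<open>a\<close>.\<close>
    have up: "\<beta> a < \<beta> v" if "j < l" "(l, v) \<in> D0" for l v
    proof -
      obtain u where u: "(j, u) \<in> D0" using row_chainsD(2) C0 j by blast
      have "\<beta> a \<le> \<beta> u" by (rule \<beta>_mono[OF row[OF D0 u]])
      also have "\<dots> < \<beta> v" using row_chainsD(3)[OF conjunct1[OF C0] u that(2)] that by simp
      finally show ?thesis .
    qed
    \<comment> \<open>The lower rows are the same single entries throughout the support, so the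
      chain \<open>D1\<close>, which contains the pivot, already shows that they lie below
      \<open>a\<close>.\<close>
    have down: "\<beta> v < \<beta> a" if "k < j" "(k, v) \<in> D0" for k v
    proof -
      have "(k, v) \<in> D1" using lowset[OF D0 that(1)] lowset[OF D1(1) that(1)] that(2) by blast
      then show ?thesis using row_chainsD(3)[OF conjunct1[OF C1] _ D1(2)] that by blast
    qed
    have "D \<in> \<C> W q"
      unfolding row_chains_def
    proof (intro CollectI conjI allI impI)
      show "D \<subseteq> {..<q} \<times> W" using row_chainsD(1)[OF conjunct1[OF C0]] j aW D by auto
      show "D `` {k} \<noteq> {}" if "k < q" for k using row_chainsD(2)[OF conjunct1[OF C0] that] D by auto
      show "\<beta> x < \<beta> y" if "(k, x) \<in> D" "(l, y) \<in> D" "k < l" for k l x y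
        using that D up[of l y] down[of k x] row_chainsD(3)[OF conjunct1[OF C0], of k x l y] by auto
    qed
    moreover have "card D = Suc c" using D C0 finite_chain[OF conjunct1[OF C0]] by simp
    ultimately show ?thesis by simp
  qed
  have "v = (w(j := a)) k"
    if E: "E \<in> \<C> UNIV q" and ne: "\<phi> E - bd q \<psi> E \<noteq> 0" and kv: "k < Suc j" "(k, v) \<in> E" for E k v
  proof -
    have sgn: "\<sigma> (insert (j, a) E) (j, a) = 1" if "\<phi> E \<noteq> 0"
      by (rule chain_sign_first[of j _ w]) (use lowset[OF that] row[OF that] in auto)
    \<comment> \<open>If the pivot were absent from \<open>E\<close>, the only coface carrying
      \<open>\<psi>\<close> would be \<open>E\<close> with the pivot added, and there
      \<open>\<psi>\<close> returns \<open>\<phi> E\<close>.\<close>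
    have jE: "(j, a) \<in> E"
    proof (rule ccontr)
      assume nj: "(j, a) \<notin> E"
      have "bd q \<psi> E = (\<Sum>d\<in>{..<q} \<times> UNIV - E. if d = (j, a) then of_int (\<sigma> (insert (j, a) E) (j, a)) * \<phi> E else 0)"
        unfolding boundary_def using nj by (intro sum.cong) (auto simp: \<psi>_def)
      also have "\<dots> = of_int (\<sigma> (insert (j, a) E) (j, a)) * \<phi> E"
        using nj j by simp
      also have "\<dots> = \<phi> E" using sgn by (cases "\<phi> E = 0") auto
      finally show False using ne by simp
    qed
    define E0 where "E0 = E - {(j, a)}"
    have EE0: "E = insert (j, a) E0" "(j, a) \<notin> E0" using jE by (auto simp: E0_def)
    have b\<psi>: "bd q \<psi> E = (\<Sum>d\<in>{..<q} \<times> UNIV - E. of_int (\<sigma> (insert d E) d) * \<phi> (insert d E0))"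
      unfolding boundary_def
    proof (intro sum.cong refl)
      fix d assume "d \<in> {..<q} \<times> UNIV - E"
      then have "insert d E - {(j, a)} = insert d E0" using jE by (auto simp: E0_def)
      then show "of_int (\<sigma> (insert d E) d) * \<psi> (insert d E) = of_int (\<sigma> (insert d E) d) * \<phi> (insert d E0)"
        using jE by (simp add: \<psi>_def)
    qed
    \<comment> \<open>With a second entry in row \<open>j\<close>, deleting the pivot leaves a row
      chain \<open>E0\<close>. In the cycle condition at \<open>E0\<close> the pivot's term is
      \<open>\<phi> E\<close>, and the other terms are the negatives of those in the boundary of
      \<open>\<psi>\<close> at \<open>E\<close>.\<close>
    have single: "u = a" if u: "(j, u) \<in> E" for u
    proof (rule ccontr)
      assume ua: "u \<noteq> a"
      have "E0 \<in> \<C> UNIV q" unfolding E0_def using chain_remove[OF E jE u] ua by simp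
      then have "0 = bd q \<phi> E0" using cycle by simp
      also have "\<dots> = of_int (\<sigma> E (j, a)) * \<phi> E
          + (\<Sum>d\<in>{..<q} \<times> UNIV - E. of_int (\<sigma> (insert d E0) d) * \<phi> (insert d E0))"
      proof -
        have "{..<q} \<times> UNIV - E0 = insert (j, a) ({..<q} \<times> UNIV - E)" using EE0 j by auto
        then show ?thesis unfolding boundary_def using jE by (simp flip: EE0(1))
      qed
      also have "of_int (\<sigma> E (j, a)) * \<phi> E = \<phi> E"
        using sgn jE by (cases "\<phi> E = 0") (auto simp: insert_absorb)
      also have "(\<Sum>d\<in>{..<q} \<times> UNIV - E. of_int (\<sigma> (insert d E0) d) * \<phi> (insert d E0)) = - bd q \<psi> E"
        unfolding b\<psi> sum_negf[symmetric]
      proof (intro sum.cong refl)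
        fix d assume d: "d \<in> {..<q} \<times> UNIV - E"
        show "of_int (\<sigma> (insert d E0) d) * \<phi> (insert d E0) = - (of_int (\<sigma> (insert d E) d) * \<phi> (insert d E0))"
        proof (cases "\<phi> (insert d E0) = 0")
          case False
          obtain k v where kv: "d = (k, v)" by force
          \<comment> \<open>A pair added below row \<open>j\<close> would give a lower row two
            entries. So \<open>d\<close> comes after the pivot, and removing the pivot reverses its
            sign.\<close>
          have "\<not> k < j"
          proof
            assume kj: "k < j"
            then obtain x where x: "(k, x) \<in> E" using row_chainsD(2)[OF E] j by (meson less_trans)
            then have "(k, x) \<in> insert d E0" using kj EE0 by auto
            then have "x = v" using low[OF False kj, of x] low[OF False kj, of v] kv by simp
            then show False using x d kv by simp
          qed
          moreover have "v \<noteq> a" if "k = j" using that d kv jE by auto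
          moreover have "r a \<le> r v" if "k = j" using row[OF False, of v] that kv by simp
          ultimately have bef: "before r (j, a) d"
            using kv r_eq_iff[of a v] by (auto simp: before_def le_less)
          have "finite (insert d E)" using finite_chain[OF E] by simp
          moreover have "insert d E - {(j, a)} = insert d E0" "(j, a) \<noteq> d" using d jE by (auto simp: E0_def)
          ultimately have "\<sigma> (insert d E) d = - \<sigma> (insert d E0) d"
            using chain_sign_remove[of "insert d E" "(j, a)" d r] bef jE by simp
          then show ?thesis by simp
        qed simp
      qed
      finally have "\<phi> E - bd q \<psi> E = 0" by simp
      then show False using ne by simp
    qed
    show ?thesis
    proof (cases "k = j")
      case True
      then show ?thesis using single kv by simp
    next
      case False
      then have kj: "k < j" using kv by simp
      have "v = w k"
      proof (cases "\<phi> E = 0")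
        case True
        then have "bd q \<psi> E \<noteq> 0" using ne by simp
        then obtain d where d: "d \<notin> E" "\<psi> (insert d E) \<noteq> 0" by (rule boundary_nonzeroE)
        then have "\<phi> (insert d E - {(j, a)}) \<noteq> 0" by (auto simp: \<psi>_def split: if_splits)
        moreover have "(k, v) \<in> insert d E - {(j, a)}" using kv kj by auto
        ultimately show ?thesis using low kj by blast
      next
        case False
        then show ?thesis using low kj kv by blast
      qed
      then show ?thesis using kj by simp
    qed
  qed
  then show ?thesis using \<psi>_supp by blast
qed

text \<open>Correction by a boundary preserves the support and the cycle condition, and the rows
  already made constant are the hypothesis for the next use of \<open>contract_row\<close>.\<close>

lemma contract_rows:
  fixes \<phi> :: "(nat \<times> 'v) set \<Rightarrow> 'k::comm_ring_1"
  assumes "j \<le> q"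
    and supp: "\<And>D. \<phi> D \<noteq> 0 \<Longrightarrow> D \<in> \<C> W q \<and> card D = c"
    and cycle: "\<And>E. E \<in> \<C> UNIV q \<Longrightarrow> bd q \<phi> E = 0"
  shows "\<exists>\<psi> w. (\<forall>D. \<psi> D \<noteq> 0 \<longrightarrow> D \<in> \<C> W q \<and> card D = Suc c) \<and>
    (\<forall>E\<in>\<C> UNIV q. \<phi> E - bd q \<psi> E \<noteq> 0 \<longrightarrow> (\<forall>k v. k < j \<longrightarrow> (k, v) \<in> E \<longrightarrow> v = w k))"
  using assms(1)
proof (induction j)
  case 0
  then show ?case by (intro exI[of _ "\<lambda>_. 0"]) simp
next
  case (Suc j)
  from Suc.IH[OF Suc_leD[OF Suc.prems]] obtain \<psi> w
    where I: "(\<forall>D. \<psi> D \<noteq> 0 \<longrightarrow> D \<in> \<C> W q \<and> card D = Suc c) \<and>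
      (\<forall>E\<in>\<C> UNIV q. \<phi> E - bd q \<psi> E \<noteq> 0 \<longrightarrow> (\<forall>k v. k < j \<longrightarrow> (k, v) \<in> E \<longrightarrow> v = w k))"
    by (elim exE)
  have \<psi>: "\<And>D. \<psi> D \<noteq> 0 \<Longrightarrow> D \<in> \<C> W q \<and> card D = Suc c"
    and w: "\<And>E k v. E \<in> \<C> UNIV q \<Longrightarrow> \<phi> E - bd q \<psi> E \<noteq> 0 \<Longrightarrow> k < j \<Longrightarrow> (k, v) \<in> E \<Longrightarrow> v = w k"
    using I by blast+
  \<comment> \<open>\<open>chain_boundary\<close> and not \<open>boundary\<close>: the corrected
    chain must again be supported on row chains, where the two agree.\<close>
  define \<phi>' where "\<phi>' D = \<phi> D - \<B> q \<psi> D" for D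
  have chainU: "D \<in> \<C> UNIV q" if "D \<in> \<C> W q" for D
    by (rule row_chains_mono[OF that]) simp
  have supp': "D \<in> \<C> W q \<and> card D = c" if "\<phi>' D \<noteq> 0" for D
  proof (cases "\<phi> D = 0")
    case True
    then show ?thesis
      using that \<psi> by (intro chain_boundary_support[of \<psi> \<beta> W q c r D]) (auto simp: \<phi>'_def)
  qed (rule supp)
  have low': "v = w k" if "\<phi>' D \<noteq> 0" "k < j" "(k, v) \<in> D" for D k v
  proof -
    have D: "D \<in> \<C> UNIV q" using supp'[OF that(1)] chainU by blast
    then have "\<phi> D - bd q \<psi> D \<noteq> 0" using that(1) by (simp add: \<phi>'_def chain_boundary_def)
    then show ?thesis using w[OF D _ that(2,3)] by blast
  qed
  have cycle': "bd q \<phi>' E = 0" if E: "E \<in> \<C> UNIV q" for E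
  proof -
    have "bd q (\<B> q \<psi>) E = 0"
      by (subst boundary_chain_boundary) (use \<psi> chainU E boundary_boundary[OF finite_chain[OF E]] in auto)
    then show ?thesis unfolding \<phi>'_def boundary_diff using cycle[OF E] by simp
  qed
  have "\<exists>\<eta> a. (\<forall>D. \<eta> D \<noteq> 0 \<longrightarrow> D \<in> \<C> W q \<and> card D = Suc c) \<and>
      (\<forall>E\<in>\<C> UNIV q. \<phi>' E - bd q \<eta> E \<noteq> 0 \<longrightarrow>
        (\<forall>k v. k < Suc j \<longrightarrow> (k, v) \<in> E \<longrightarrow> v = (w(j := a)) k))" (is "\<exists>\<eta> a. ?P \<eta> a")
    by (rule contract_row) (use Suc.prems supp' low' cycle' in simp_all)
  then obtain \<eta> a where I: "?P \<eta> a" by (elim exE)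
  have \<eta>: "\<And>D. \<eta> D \<noteq> 0 \<Longrightarrow> D \<in> \<C> W q \<and> card D = Suc c"
    and a: "\<And>E k v. E \<in> \<C> UNIV q \<Longrightarrow> \<phi>' E - bd q \<eta> E \<noteq> 0 \<Longrightarrow> k < Suc j \<Longrightarrow> (k, v) \<in> E \<Longrightarrow> v = (w(j := a)) k"
    using I by blast+
  show ?case
  proof (intro exI[of _ "\<lambda>D. \<psi> D + \<eta> D"] exI[of _ "w(j := a)"] conjI allI ballI impI)
    fix D assume "\<psi> D + \<eta> D \<noteq> 0"
    then have "\<psi> D \<noteq> 0 \<or> \<eta> D \<noteq> 0" by auto
    then show "D \<in> \<C> W q" "card D = Suc c" using \<psi> \<eta> by blast+
  next
    fix E k v assume E: "E \<in> \<C> UNIV q" and "\<phi> E - bd q (\<lambda>D. \<psi> D + \<eta> D) E \<noteq> 0"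
      and k: "k < Suc j" "(k, v) \<in> E"
    then have "\<phi>' E - bd q \<eta> E \<noteq> 0"
      by (simp add: boundary_add \<phi>'_def chain_boundary_def algebra_simps)
    then show "v = (w(j := a)) k" by (rule a[OF E _ k])
  qed
qed

text \<open>The sum over vertices and their cofaces is reordered as a sum over edges and their
  deletable pairs; the two ends of an edge cancel.\<close>

lemma sum_boundary_edges:
  fixes \<psi> :: "(nat \<times> 'v) set \<Rightarrow> 'k::comm_ring_1"
  assumes \<psi>: "\<And>D. \<psi> D \<noteq> 0 \<Longrightarrow> D \<in> \<C> W q \<and> card D = Suc q"
  shows "(\<Sum>E\<in>\<C> W q. bd q \<psi> E) = 0"
proof -
  let ?C = "\<C> W q" and ?N = "{..<q} \<times> (UNIV :: 'v set)"
  let ?T = "\<lambda>D d. of_int (\<sigma> D d) * \<psi> D"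
  have "(\<Sum>E\<in>?C. bd q \<psi> E) = (\<Sum>(E, d)\<in>(SIGMA E:?C. ?N - E). ?T (insert d E) d)"
    unfolding boundary_def by (rule sum.Sigma) auto
  also have "\<dots> = (\<Sum>(E, d)\<in>{(E, d) \<in> (SIGMA E:?C. ?N - E). insert d E \<in> ?C}. ?T (insert d E) d)"
    by (rule sum.mono_neutral_right) (use \<psi> in \<open>force+\<close>)
  also have "\<dots> = (\<Sum>(D, d)\<in>(SIGMA D:?C. {d \<in> D. D - {d} \<in> ?C}). ?T D d)"
    by (rule sum.reindex_bij_witness[of _ "\<lambda>(D, d). (D - {d}, d)" "\<lambda>(E, d). (insert d E, d)"])
      (use row_chainsD(1)[of _ \<beta> W q] in \<open>auto simp: insert_absorb\<close>)
  also have "\<dots> = (\<Sum>D\<in>?C. \<Sum>d\<in>{d \<in> D. D - {d} \<in> ?C}. ?T D d)"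
    by (rule sum.Sigma[symmetric]) (auto dest: finite_chain)
  also have "\<dots> = 0"
  proof (rule sum.neutral, rule ballI)
    fix D assume D: "D \<in> ?C"
    show "(\<Sum>d\<in>{d \<in> D. D - {d} \<in> ?C}. ?T D d) = 0"
    proof (cases "\<psi> D = 0")
      case False
      then obtain d e where de: "d \<noteq> e" "{x \<in> D. D - {x} \<in> ?C} = {d, e}"
        "\<sigma> D d + \<sigma> D e = 0"
        using edge_ends[OF D conjunct2[OF \<psi>[OF False]]] by (elim exE conjE)
      have "(\<Sum>d\<in>{d \<in> D. D - {d} \<in> ?C}. ?T D d) = of_int (\<sigma> D d + \<sigma> D e) * \<psi> D"
        unfolding de(2) using de(1) by (simp add: algebra_simps)
      then show ?thesis using de(3) by simp
    qed simp
  qed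
  finally show ?thesis .
qed

text \<open>Once all rows are contracted, the remainder is supported on the graph of
  \<open>w\<close>, a single vertex. It can be nonzero only for \<open>c = q\<close>, and there it
  is excluded by the augmentation, which vanishes on \<open>\<phi>\<close> and on
  boundaries.\<close>

lemma row_chains_exact:
  fixes \<phi> :: "(nat \<times> 'v) set \<Rightarrow> 'k::comm_ring_1"
  assumes supp: "\<And>D. \<phi> D \<noteq> 0 \<Longrightarrow> D \<in> \<C> W q \<and> card D = c"
    and cycle: "\<And>E. E \<in> \<C> UNIV q \<Longrightarrow> bd q \<phi> E = 0"
    and aug: "c = q \<Longrightarrow> (\<Sum>D\<in>\<C> W q. \<phi> D) = 0"
  shows "\<exists>\<psi>. (\<forall>D. \<psi> D \<noteq> 0 \<longrightarrow> D \<in> \<C> W q \<and> card D = Suc c) \<and> \<B> q \<psi> = \<phi>"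
proof -
  have "\<exists>\<psi> w. (\<forall>D. \<psi> D \<noteq> 0 \<longrightarrow> D \<in> \<C> W q \<and> card D = Suc c) \<and>
      (\<forall>E\<in>\<C> UNIV q. \<phi> E - bd q \<psi> E \<noteq> 0 \<longrightarrow> (\<forall>k v. k < q \<longrightarrow> (k, v) \<in> E \<longrightarrow> v = w k))"
    (is "\<exists>\<psi> w. ?P \<psi> w")
    by (rule contract_rows[OF order_refl]) (use supp cycle in blast)+
  then obtain \<psi> w where I: "?P \<psi> w" by (elim exE)
  have \<psi>: "\<And>D. \<psi> D \<noteq> 0 \<Longrightarrow> D \<in> \<C> W q \<and> card D = Suc c"
    and w: "\<And>E k v. E \<in> \<C> UNIV q \<Longrightarrow> \<phi> E - bd q \<psi> E \<noteq> 0 \<Longrightarrow> k < q \<Longrightarrow> (k, v) \<in> E \<Longrightarrow> v = w k"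
    using I by blast+
  have chainU: "D \<in> \<C> UNIV q" if "D \<in> \<C> W q" for D
    by (rule row_chains_mono[OF that]) simp
  let ?G = "(\<lambda>k. (k, w k)) ` {..<q}"
  have only: "E = ?G" if E: "E \<in> \<C> UNIV q" and ne: "\<phi> E - bd q \<psi> E \<noteq> 0" for E
  proof
    show "E \<subseteq> ?G"
    proof
      fix d assume d: "d \<in> E"
      obtain k v where kv: "d = (k, v)" by force
      have k: "k < q" using d kv row_chainsD(1)[OF E] by auto
      then show "d \<in> ?G" using w[OF E ne k, of v] d kv by simp
    qed
    show "?G \<subseteq> E"
    proof
      fix d assume "d \<in> ?G"
      then obtain k where k: "k < q" "d = (k, w k)" by auto
      obtain v where "(k, v) \<in> E" using row_chainsD(2)[OF E k(1)] by blast
      then show "d \<in> E" using w[OF E ne k(1)] k by auto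
    qed
  qed
  have "\<phi> E = bd q \<psi> E" if E: "E \<in> \<C> UNIV q" for E
  proof (rule ccontr)
    assume "\<phi> E \<noteq> bd q \<psi> E"
    then have ne: "\<phi> E - bd q \<psi> E \<noteq> 0" by simp
    have EW: "E \<in> \<C> W q \<and> card E = c"
    proof (cases "\<phi> E = 0")
      case True
      then have "\<B> q \<psi> E \<noteq> 0" using ne E by (simp add: chain_boundary_def)
      then show ?thesis by (rule chain_boundary_support[of \<psi> \<beta> W q c r E, rotated]) (rule \<psi>)
    qed (rule supp)
    have "card ?G = q" by (simp add: card_image inj_on_def)
    then have "card E = q" by (subst only[OF E ne])
    then have cq: "c = q" using EW by simp
    have "(\<Sum>D\<in>\<C> W q. \<phi> D - bd q \<psi> D) = (\<Sum>D\<in>\<C> W q. if D = E then \<phi> E - bd q \<psi> E else 0)"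
    proof (intro sum.cong refl)
      fix D assume "D \<in> \<C> W q"
      then have "D \<in> \<C> UNIV q" by (rule chainU)
      then show "\<phi> D - bd q \<psi> D = (if D = E then \<phi> E - bd q \<psi> E else 0)"
        using trans[OF only[of D] only[OF E ne, symmetric]] by (cases "D = E") auto
    qed
    also have "\<dots> = \<phi> E - bd q \<psi> E" using EW by simp
    finally have "\<phi> E - bd q \<psi> E = (\<Sum>D\<in>\<C> W q. \<phi> D) - (\<Sum>D\<in>\<C> W q. bd q \<psi> D)"
      by (simp add: sum_subtractf)
    then show False using ne aug[OF cq] sum_boundary_edges[of \<psi> W q] \<psi> cq by simp
  qed
  moreover have "\<phi> E = 0" if "E \<notin> \<C> UNIV q" for E
    using supp[of E] chainU[of E] that by blast
  ultimately have "\<B> q \<psi> E = \<phi> E" for E by (simp add: chain_boundary_def)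
  then have "\<B> q \<psi> = \<phi>" by (rule ext)
  then show ?thesis using \<psi> by (intro exI[of _ \<psi>]) simp
qed

lemma chain_boundary_chain_boundary:
  assumes "\<And>D. \<phi> D \<noteq> 0 \<Longrightarrow> D \<in> \<C> UNIV q"
  shows "\<B> q (\<B> q \<phi>) = (\<lambda>_. 0)"
proof
  fix E
  show "\<B> q (\<B> q \<phi>) E = 0"
  proof (cases "E \<in> \<C> UNIV q")
    case True
    have "bd q (\<B> q \<phi>) E = bd q (bd q \<phi>) E"
      by (rule boundary_chain_boundary) (use assms True in auto)
    then show ?thesis using boundary_boundary[OF finite_chain[OF True], of q \<phi>] by (simp add: chain_boundary_def)
  qed (simp add: chain_boundary_def)
qed

end

section \<open>The cellular resolution\<close>

lemma module_mult: "module ((*) :: 'a::comm_ring_1 \<Rightarrow> 'a \<Rightarrow> 'a)"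
  by unfold_locales (simp_all add: algebra_simps)

lemma mon_add: "mon (u + v) = mon u * mon v"
  by (simp add: mon_def mult_single)

lemma mon_zero: "mon 0 = 1"
  by (simp add: mon_def)

lemma mon_sum: "mon (sum f A) = (\<Prod>i\<in>A. mon (f i))"
  by (induction A rule: infinite_finite_induct) (simp_all add: mon_add mon_zero)

lemma keys_mon: "keys (mon u :: ('v, 'k::field) mpoly) = {u}"
  by (simp add: mon_def)

lemma poly_mapping_sum_single:
  "p = (\<Sum>l\<in>keys p. Poly_Mapping.single l (lookup p l))"
  by (rule poly_mapping_eqI) (simp add: lookup_sum lookup_single when_def in_keys_iff)

lemma lookup_times_mon:
  fixes p :: "('v, 'k::field) mpoly"
  shows "lookup (p * mon m) u = (\<Sum>l\<in>keys p. if u = l + m then lookup p l else 0)"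
proof -
  have "p * mon m = (\<Sum>l\<in>keys p. Poly_Mapping.single l (lookup p l)) * mon m"
    using poly_mapping_sum_single[of p] by simp
  also have "\<dots> = (\<Sum>l\<in>keys p. Poly_Mapping.single (l + m) (lookup p l))"
    by (simp add: sum_distrib_right mon_def mult_single)
  finally show ?thesis
    by (simp add: lookup_sum lookup_single when_def eq_commute)
qed

lemma lookup_times_mon_add:
  fixes p :: "('v, 'k::field) mpoly"
  shows "lookup (p * mon m) (u + m) = lookup p u"
  unfolding lookup_times_mon by (simp add: in_keys_iff)

lemma lookup_times_mon_zero:
  fixes p :: "('v, 'k::field) mpoly"
  assumes "\<nexists>w. u = w + m"
  shows "lookup (p * mon m) u = 0"
  unfolding lookup_times_mon using assms by (intro sum.neutral) auto

text \<open>The strand in multidegree \<open>\<alpha>\<close>: the coefficient of the monomial that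
  raises the label of \<open>D\<close> to \<open>\<alpha>\<close>. Subtraction of exponents is
  truncated, so chains whose label does not divide \<open>\<alpha>\<close> have to be excluded;
  labels being squarefree, these are the ones with a variable outside
  \<open>keys \<alpha>\<close>.\<close>

definition degree_part ::
  "('v::finite \<Rightarrow> nat) \<Rightarrow> ('v \<Rightarrow> nat) \<Rightarrow> 'v set \<Rightarrow> nat \<Rightarrow> ((real^'v) set \<Rightarrow> ('v, 'k::field) mpoly)
    \<Rightarrow> 'v monomial \<Rightarrow> (nat \<times> 'v) set \<Rightarrow> 'k" where
  "degree_part r \<beta> W q f \<alpha> D = (if D \<in> row_chains \<beta> (W \<inter> keys \<alpha>) q
     then lookup (f (chain_cell r q D)) (\<alpha> - clabel D) else 0)"

lemma clabel_insert: "finite E \<Longrightarrow> d \<notin> E \<Longrightarrow> clabel (insert d E) = var (snd d) + clabel E"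
  by (simp add: clabel_def)

lemma minus_add_monomial:
  fixes u v :: "'v monomial"
  assumes "\<And>i. lookup v i \<le> lookup u i"
  shows "u - v + v = u"
  by (rule poly_mapping_eqI) (simp add: lookup_add lookup_minus assms)

text \<open>A squarefree monomial divides \<open>\<alpha>\<close> as soon as its variables occur in
  \<open>\<alpha>\<close>. Hence a strand is a complex of the same kind on fewer variables.\<close>

lemma row_chains_keys_iff:
  assumes D: "D \<in> row_chains \<beta> (W :: 'v::finite set) q"
  shows "D \<in> row_chains \<beta> (W \<inter> keys \<alpha>) q \<longleftrightarrow> (\<exists>w. \<alpha> = w + clabel D)"
proof
  assume C: "D \<in> row_chains \<beta> (W \<inter> keys \<alpha>) q"
  have "lookup (clabel D) i \<le> lookup \<alpha> i" for i
  proof -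
    have "lookup \<alpha> i \<noteq> 0" if "i \<in> snd ` D"
      using row_chainsD(1)[OF C] that by (auto simp: in_keys_iff)
    then show ?thesis unfolding lookup_clabel[OF D] by (simp add: Suc_le_eq)
  qed
  then show "\<exists>w. \<alpha> = w + clabel D" using minus_add_monomial[of "clabel D" \<alpha>] by metis
next
  assume "\<exists>w. \<alpha> = w + clabel D"
  then obtain w where w: "\<alpha> = w + clabel D" by blast
  have "snd d \<in> W \<inter> keys \<alpha>" if d: "d \<in> D" for d
  proof -
    have "lookup (clabel D) (snd d) = 1" using d lookup_clabel[OF D] by simp
    then have "lookup \<alpha> (snd d) \<noteq> 0" using w by (simp add: lookup_add)
    then show ?thesis using d row_chainsD(1)[OF D] by (auto simp: in_keys_iff)
  qed
  then have "D \<subseteq> {..<q} \<times> (W \<inter> keys \<alpha>)" using row_chainsD(1)[OF D] by force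
  then show "D \<in> row_chains \<beta> (W \<inter> keys \<alpha>) q" using D by (simp add: row_chains_def)
qed

lemma degree_part_add:
  assumes D: "D \<in> row_chains \<beta> (W :: 'v::finite set) q"
  shows "degree_part r \<beta> W q f (w + clabel D) D = lookup (f (chain_cell r q D)) w"
  using row_chains_keys_iff[OF D, of "w + clabel D"] unfolding degree_part_def by auto

lemma degree_part_support:
  "degree_part r \<beta> W q f \<alpha> D \<noteq> 0 \<Longrightarrow> D \<in> row_chains \<beta> (W \<inter> keys \<alpha>) q"
  by (auto simp: degree_part_def split: if_splits)

lemma row_chains_Int: "D \<in> row_chains \<beta> (W \<inter> V) q \<Longrightarrow> D \<in> row_chains \<beta> W q"
  by (erule row_chains_mono) simp

lemma degree_part_cases:
  assumes D: "D \<in> row_chains \<beta> (W :: 'v::finite set) q"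
  obtains w where "\<alpha> = w + clabel D" "degree_part r \<beta> W q f \<alpha> D = lookup (f (chain_cell r q D)) w"
  | "\<nexists>w. \<alpha> = w + clabel D" "degree_part r \<beta> W q f \<alpha> D = 0"
  using degree_part_add[OF D, of r f] row_chains_keys_iff[OF D, of \<alpha>] unfolding degree_part_def by metis

lemma lookup_times_label:
  fixes f :: "(real^'v) set \<Rightarrow> ('v::finite, 'k::field) mpoly"
  assumes D: "D \<in> row_chains \<beta> W q"
  shows "lookup (f (chain_cell r q D) * mon (clabel D)) \<alpha> = degree_part r \<beta> W q f \<alpha> D"
  by (rule degree_part_cases[OF D, of \<alpha> r f]) (simp_all add: lookup_times_mon_add lookup_times_mon_zero)

lemma lookup_times_sign_mon:
  fixes p :: "('v, 'k::field) mpoly"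
  shows "lookup (p * (of_int (chain_sign r D d) * mon m)) u
     = of_int (chain_sign r D d) * lookup (p * mon m) u"
  using chain_sign_cases[of r D d] by auto

section \<open>Differential and augmentation in a fixed multidegree\<close>

context ranking
begin

abbreviation "cdiff W q \<equiv> cell_diff (\<K> W q) (\<I> q)"
abbreviation "\<F> W q i \<equiv> free_mod (cells_of_dim (\<K> W q) i)"

abbreviation "\<D> \<equiv> degree_part r \<beta>"

lemma inj_chain_cell: "inj_on (cell q) (\<C> W q)"
  using chain_cell_eq_iff by (auto simp: inj_on_def)

lemma nonempty_cells: "cells (\<K> W q) - {{}} = cell q ` \<C> W q"
  using chain_cell_nonempty by (auto simp: chain_complex_def)

lemma cells_of_dim_chain_complex:
  "cells_of_dim (\<K> W q) i = cell q ` {D \<in> \<C> W q. card D = q + i}"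
  using aff_dim_chain_cell by (force simp: cells_of_dim_def chain_complex_def)

lemma chain_cell_in_cells_of_dim_iff:
  assumes "D \<in> \<C> W q"
  shows "cell q D \<in> cells_of_dim (\<K> W q) i \<longleftrightarrow> card D = q + i"
  unfolding cells_of_dim_chain_complex using chain_cell_eq_iff[OF assms] assms by auto

lemma degree_part_card:
  assumes f: "f \<in> \<F> W q i" and ne: "\<D> W q f \<alpha> D \<noteq> 0"
  shows "D \<in> \<C> (W \<inter> keys \<alpha>) q \<and> card D = q + i"
proof -
  have D: "D \<in> \<C> (W \<inter> keys \<alpha>) q" by (rule degree_part_support[OF ne])
  have "f (cell q D) \<noteq> 0" using ne D by (auto simp: degree_part_def)
  then have "cell q D \<in> cells_of_dim (\<K> W q) i" using f by (auto simp: free_mod_def)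
  then show ?thesis using D chain_cell_in_cells_of_dim_iff[OF row_chains_Int[OF D]] by simp
qed

text \<open>Every coefficient occurs in some strand: that of \<open>w\<close> at the cell of
  \<open>D\<close> in multidegree \<open>w + clabel D\<close>.\<close>

lemma degree_part_eqI:
  assumes "\<And>F. F \<notin> cell q ` \<C> W q \<Longrightarrow> f F = 0" "\<And>F. F \<notin> cell q ` \<C> W q \<Longrightarrow> g F = 0"
    and eq: "\<And>\<alpha>. \<D> W q f \<alpha> = \<D> W q g \<alpha>"
  shows "f = g"
proof
  fix F
  show "f F = g F"
  proof (cases "F \<in> cell q ` \<C> W q")
    case True
    then obtain D where D: "D \<in> \<C> W q" "F = cell q D" by blast
    show ?thesis unfolding D(2)
    proof (rule poly_mapping_eqI)
      fix w
      show "lookup (f (cell q D)) w = lookup (g (cell q D)) w"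
        unfolding degree_part_add[OF D(1), symmetric] eq ..
    qed
  qed (simp add: assms)
qed

text \<open>Only cells with one pair more have a nonzero incidence number, and the quotient of the
  labels is the variable of that pair. Exactness, minimality and homogeneity all start from this
  form.\<close>

lemma cell_diff_chain_cell:
  fixes f :: "(real^'v) set \<Rightarrow> ('v, 'k::field) mpoly"
  assumes E: "E \<in> \<C> W q"
  shows "cdiff W q f (cell q E)
    = (\<Sum>d | d \<in> {..<q} \<times> UNIV - E \<and> insert d E \<in> \<C> W q.
        f (cell q (insert d E)) * (of_int (\<sigma> (insert d E) d) * mon (var (snd d))))"
proof -
  let ?L = "\<K> W q" and ?C = "\<C> W q" and ?\<epsilon> = "\<I> q"
  let ?N = "{d \<in> {..<q} \<times> UNIV - E. insert d E \<in> ?C}"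
  let ?t = "\<lambda>D. f (cell q D) * (of_int (?\<epsilon> (cell q D) (cell q E)) * mon (clabel D - clabel E)) :: ('v, 'k) mpoly"
  have finE: "finite E" by (rule finite_chain[OF E])
  have "cell q E \<in> cells ?L - {{}}" unfolding nonempty_cells using E by blast
  then have "cell_diff ?L ?\<epsilon> f (cell q E) = (\<Sum>F\<in>cell q ` ?C.
      f F * (of_int (?\<epsilon> F (cell q E)) * mon (face_label ?L F - face_label ?L (cell q E))))"
    by (simp add: cell_diff_def nonempty_cells)
  also have "\<dots> = (\<Sum>D\<in>?C. ?t D)"
    by (subst sum.reindex[OF inj_chain_cell]) (simp add: face_label_chain_cell[OF E] face_label_chain_cell)
  also have "\<dots> = (\<Sum>D\<in>(\<lambda>d. insert d E) ` ?N. ?t D)"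
  proof (rule sum.mono_neutral_right)
    show "\<forall>D\<in>?C - (\<lambda>d. insert d E) ` ?N. ?t D = 0"
    proof
      fix D assume D: "D \<in> ?C - (\<lambda>d. insert d E) ` ?N"
      have "\<not> codim1_face (cell q E) (cell q D)"
      proof
        assume "codim1_face (cell q E) (cell q D)"
        then obtain d where d: "d \<in> D" "E = D - {d}" using codim1_face_chain_cell[of D W q E] D E by blast
        then have "D = insert d E" "d \<in> ?N" using D row_chainsD(1)[of D \<beta> W q] by (auto simp: insert_absorb)
        then show False using D by blast
      qed
      then show "?t D = 0" by (simp add: chain_incidence_def)
    qed
  qed auto
  also have "\<dots> = (\<Sum>d\<in>?N. ?t (insert d E))"
    by (subst sum.reindex) (auto simp: inj_on_def)
  also have "\<dots> = (\<Sum>d\<in>?N. f (cell q (insert d E)) * (of_int (\<sigma> (insert d E) d) * mon (var (snd d))))"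
  proof (intro sum.cong refl)
    fix d assume d: "d \<in> ?N"
    then have "insert d E - {d} = E" by auto
    then have "?\<epsilon> (cell q (insert d E)) (cell q E) = \<sigma> (insert d E) d"
      using chain_incidence_chain_cell[of "insert d E" W q d] d E by simp
    moreover have "clabel (insert d E) - clabel E = var (snd d)"
      using clabel_insert[OF finE, of d] d by simp
    ultimately show "?t (insert d E) = f (cell q (insert d E)) * (of_int (\<sigma> (insert d E) d) * mon (var (snd d)))"
      by simp
  qed
  finally show ?thesis .
qed

text \<open>Multiplication by the variable of the added pair shifts degrees by the difference of the
  labels. Within one strand the monomials therefore disappear, and scalars with signs
  remain.\<close>

lemma degree_part_cell_diff:
  fixes f :: "(real^'v) set \<Rightarrow> ('v, 'k::field) mpoly"
  shows "\<D> W q (cdiff W q f) \<alpha>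
    = \<B> q (\<D> W q f \<alpha>)"
proof
  fix E
  let ?d = "cdiff W q f"
  show "\<D> W q ?d \<alpha> E = \<B> q (\<D> W q f \<alpha>) E"
  proof (cases "E \<in> \<C> (W \<inter> keys \<alpha>) q")
    \<comment> \<open>A coface in the strand would put \<open>E\<close>, if it is a row chain, into
      the strand as well.\<close>
    case False
    have "\<B> q (\<D> W q f \<alpha>) E = 0"
    proof (rule ccontr)
      assume ne: "\<B> q (\<D> W q f \<alpha>) E \<noteq> 0"
      then have EU: "E \<in> \<C> UNIV q" "bd q (\<D> W q f \<alpha>) E \<noteq> 0"
        by (auto simp: chain_boundary_def split: if_splits)
      obtain d where "\<D> W q f \<alpha> (insert d E) \<noteq> 0" using EU(2) by (rule boundary_nonzeroE)
      then show False using degree_part_support subchain[OF EU(1)] False by blast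
    qed
    then show ?thesis using False by (simp add: degree_part_def)
  next
    case True
    have E: "E \<in> \<C> W q" by (rule row_chains_Int[OF True])
    have EU: "E \<in> \<C> UNIV q" by (rule row_chains_mono[OF E]) simp
    have finE: "finite E" by (rule finite_chain[OF E])
    obtain w where w: "\<alpha> = w + clabel E" using row_chains_keys_iff[OF E] True by blast
    let ?N = "{d \<in> {..<q} \<times> UNIV - E. insert d E \<in> \<C> W q}"
    have "\<D> W q ?d \<alpha> E = lookup (?d (cell q E)) w"
      unfolding w by (rule degree_part_add[OF E])
    also have "\<dots> = (\<Sum>d\<in>?N. of_int (\<sigma> (insert d E) d) * lookup (f (cell q (insert d E)) * mon (var (snd d))) w)"
      unfolding cell_diff_chain_cell[OF E] lookup_sum lookup_times_sign_mon ..
    also have "\<dots> = (\<Sum>d\<in>?N. of_int (\<sigma> (insert d E) d) * \<D> W q f \<alpha> (insert d E))"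
    proof (intro sum.cong refl)
      fix d assume d: "d \<in> ?N"
      then have D: "insert d E \<in> \<C> W q" "d \<notin> E" by auto
      have lab: "clabel (insert d E) = var (snd d) + clabel E" by (rule clabel_insert[OF finE D(2)])
      have "lookup (f (cell q (insert d E)) * mon (var (snd d))) w = \<D> W q f \<alpha> (insert d E)"
      proof (rule degree_part_cases[OF D(1), of \<alpha> r f])
        fix w' assume w': "\<alpha> = w' + clabel (insert d E)"
          "\<D> W q f \<alpha> (insert d E) = lookup (f (cell q (insert d E))) w'"
        then have "w = w' + var (snd d)" using w lab by (simp add: add.assoc[symmetric])
        then show ?thesis using w'(2) by (simp add: lookup_times_mon_add)
      next
        assume no: "\<nexists>w. \<alpha> = w + clabel (insert d E)" "\<D> W q f \<alpha> (insert d E) = 0"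
        have "\<nexists>w'. w = w' + var (snd d)"
        proof
          assume "\<exists>w'. w = w' + var (snd d)"
          then obtain w' where "w = w' + var (snd d)" by blast
          then have "\<alpha> = w' + clabel (insert d E)" using w lab by (simp add: add.assoc)
          then show False using no(1) by blast
        qed
        then show ?thesis using no(2) by (simp add: lookup_times_mon_zero)
      qed
      then show "of_int (\<sigma> (insert d E) d) * lookup (f (cell q (insert d E)) * mon (var (snd d))) w
        = of_int (\<sigma> (insert d E) d) * \<D> W q f \<alpha> (insert d E)" by simp
    qed
    also have "\<dots> = bd q (\<D> W q f \<alpha>) E"
      unfolding boundary_def
    proof (rule sum.mono_neutral_left)
      show "\<forall>d\<in>{..<q} \<times> UNIV - E - ?N. of_int (\<sigma> (insert d E) d) * \<D> W q f \<alpha> (insert d E) = 0"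
      proof
        fix d assume "d \<in> {..<q} \<times> UNIV - E - ?N"
        then have "insert d E \<notin> \<C> W q" by auto
        then have "\<D> W q f \<alpha> (insert d E) = 0"
          using degree_part_support row_chains_Int by blast
        then show "of_int (\<sigma> (insert d E) d) * \<D> W q f \<alpha> (insert d E) = 0" by simp
      qed
    qed auto
    finally show ?thesis using EU by (simp add: chain_boundary_def)
  qed
qed

text \<open>The monomial of each vertex is absorbed by the degree shift, so on one strand the
  augmentation adds up scalars.\<close>

lemma lookup_cell_aug:
  fixes f :: "(real^'v) set \<Rightarrow> ('v, 'k::field) mpoly"
  assumes f: "f \<in> \<F> W q 0"
  shows "lookup (cell_aug (\<K> W q) f) \<alpha>
    = (\<Sum>D\<in>\<C> (W \<inter> keys \<alpha>) q. \<D> W q f \<alpha> D)"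
proof -
  let ?V = "{D \<in> \<C> W q. card D = q}"
  have inj: "inj_on (cell q) ?V" by (rule inj_on_subset[OF inj_chain_cell[of q W]]) auto
  have "cell_aug (\<K> W q) f = (\<Sum>D\<in>?V. f (cell q D) * mon (clabel D))"
    unfolding cell_aug_def cells_of_dim_chain_complex add_0_right
    by (subst sum.reindex[OF inj]) (auto intro!: sum.cong simp: face_label_chain_cell)
  then have "lookup (cell_aug (\<K> W q) f) \<alpha> = (\<Sum>D\<in>?V. \<D> W q f \<alpha> D)"
    unfolding lookup_sum using lookup_times_label by (auto simp: lookup_sum intro!: sum.cong)
  also have "\<dots> = (\<Sum>D\<in>\<C> W q. \<D> W q f \<alpha> D)"
    by (rule sum.mono_neutral_left) (use degree_part_card[OF f] in auto)
  also have "\<dots> = (\<Sum>D\<in>\<C> (W \<inter> keys \<alpha>) q. \<D> W q f \<alpha> D)"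
    by (rule sum.mono_neutral_right) (auto intro: row_chains_Int simp: degree_part_def)
  finally show ?thesis .
qed

text \<open>There are finitely many cells, each with a polynomial as coefficient. This finiteness is
  what allows strands to be reassembled.\<close>

lemma finite_degrees:
  fixes f :: "(real^'v) set \<Rightarrow> ('v, 'k::field) mpoly"
  shows "finite {\<alpha>. \<exists>D. \<D> W q f \<alpha> D \<noteq> 0}"
proof (rule finite_subset)
  show "{\<alpha>. \<exists>D. \<D> W q f \<alpha> D \<noteq> 0}
    \<subseteq> (\<Union>D\<in>\<C> W q. (\<lambda>u. u + clabel D) ` keys (f (cell q D)))"
  proof
    fix \<alpha> assume "\<alpha> \<in> {\<alpha>. \<exists>D. \<D> W q f \<alpha> D \<noteq> 0}"
    then obtain D where ne: "\<D> W q f \<alpha> D \<noteq> 0" by blast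
    have D: "D \<in> \<C> W q" by (rule row_chains_Int[OF degree_part_support[OF ne]])
    show "\<alpha> \<in> (\<Union>D\<in>\<C> W q. (\<lambda>u. u + clabel D) ` keys (f (cell q D)))"
    proof (rule degree_part_cases[OF D, of \<alpha> r f])
      fix w assume "\<alpha> = w + clabel D" "\<D> W q f \<alpha> D = lookup (f (cell q D)) w"
      then show ?thesis using ne D by (intro UN_I[of D] image_eqI[of _ _ w]) (simp_all add: in_keys_iff)
    qed (use ne in simp)
  qed
qed auto

text \<open>Strands can be prescribed independently, as long as only finitely many are nonzero; the
  polynomials are then put together monomial by monomial.\<close>

lemma degree_parts_realize:
  fixes \<psi> :: "'v monomial \<Rightarrow> (nat \<times> 'v) set \<Rightarrow> 'k::field"
  assumes supp: "\<And>\<alpha> D. \<psi> \<alpha> D \<noteq> 0 \<Longrightarrow> D \<in> \<C> (W \<inter> keys \<alpha>) q \<and> card D = q + i"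
    and fin: "finite {\<alpha>. \<exists>D. \<psi> \<alpha> D \<noteq> 0}"
  shows "\<exists>g\<in>\<F> W q i. \<forall>\<alpha>. \<D> W q g \<alpha> = \<psi> \<alpha>"
proof -
  let ?Z = "{\<alpha>. \<exists>D. \<psi> \<alpha> D \<noteq> 0}"
  define h where "h D = (\<Sum>\<alpha>\<in>?Z. Poly_Mapping.single (\<alpha> - clabel D) (\<psi> \<alpha> D))" for D
  define g where "g F = (if F \<in> cells_of_dim (\<K> W q) i then h (cell_chain r \<beta> q F) else 0)" for F
  have fincells: "finite (cells_of_dim (\<K> W q) i)"
    unfolding cells_of_dim_chain_complex by simp
  have sub: "{F. g F \<noteq> 0} \<subseteq> cells_of_dim (\<K> W q) i" by (auto simp: g_def)
  have gfree: "g \<in> \<F> W q i"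
    unfolding free_mod_def using sub finite_subset[OF sub fincells] by simp
  have hl: "lookup (h D) w = \<psi> (w + clabel D) D" for D w
  proof -
    have "lookup (h D) w = (\<Sum>\<alpha>\<in>?Z. if \<alpha> = w + clabel D then \<psi> \<alpha> D else 0)"
      unfolding h_def lookup_sum
    proof (intro sum.cong refl)
      fix \<alpha>
      show "lookup (Poly_Mapping.single (\<alpha> - clabel D) (\<psi> \<alpha> D)) w = (if \<alpha> = w + clabel D then \<psi> \<alpha> D else 0)"
      proof (cases "\<psi> \<alpha> D = 0")
        case False
        then have "D \<in> \<C> (W \<inter> keys \<alpha>) q" using supp by blast
        then obtain w' where "\<alpha> = w' + clabel D" using row_chains_keys_iff[OF row_chains_Int] by blast
        then show ?thesis by (auto simp: lookup_single when_def)
      next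
        case True
        then show ?thesis by (cases "\<alpha> = w + clabel D") simp_all
      qed
    qed
    then show ?thesis using fin by (auto simp: sum.delta)
  qed
  have "\<D> W q g \<alpha> D = \<psi> \<alpha> D" for \<alpha> D
  proof (cases "D \<in> \<C> W q \<and> card D = q + i")
    case True
    then have D: "D \<in> \<C> W q" by simp
    have gD: "g (cell q D) = h D"
      unfolding g_def using chain_cell_in_cells_of_dim_iff[OF D] True cell_chain_chain_cell[OF D] by simp
    show ?thesis
    proof (rule degree_part_cases[OF D, of \<alpha> r g])
      fix w assume "\<alpha> = w + clabel D" "\<D> W q g \<alpha> D = lookup (g (cell q D)) w"
      then show ?thesis using gD hl by simp
    next
      assume no: "\<nexists>w. \<alpha> = w + clabel D" "\<D> W q g \<alpha> D = 0"
      then have "D \<notin> \<C> (W \<inter> keys \<alpha>) q" using row_chains_keys_iff[OF D] by blast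
      then have "\<psi> \<alpha> D = 0" using supp by blast
      then show ?thesis using no(2) by simp
    qed
  next
    case False
    then have "\<psi> \<alpha> D = 0" using supp[of \<alpha> D] row_chains_Int[of D \<beta> W "keys \<alpha>" q] by blast
    moreover have "\<D> W q g \<alpha> D = 0"
      using degree_part_card[OF gfree, of \<alpha> D] False row_chains_Int[of D \<beta> W "keys \<alpha>" q] by blast
    ultimately show ?thesis by simp
  qed
  then show ?thesis using gfree by blast
qed

lemma cell_diff_off:
  assumes "F \<notin> cell q ` \<C> W q"
  shows "cell_diff (\<K> W q) \<epsilon> f F = 0"
  using assms unfolding cell_diff_def nonempty_cells by simp

lemma free_mod_off:
  assumes "f \<in> \<F> W q i" "F \<notin> cell q ` \<C> W q"
  shows "f F = 0"
  using assms unfolding free_mod_def cells_of_dim_chain_complex by blast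

lemma cell_diff_free_mod:
  fixes f :: "(real^'v) set \<Rightarrow> ('v, 'k::field) mpoly"
  assumes f: "f \<in> \<F> W q ((Suc i))"
  shows "cdiff W q f \<in> \<F> W q i"
proof -
  let ?d = "cdiff W q f"
  have sub: "{F. ?d F \<noteq> 0} \<subseteq> cells_of_dim (\<K> W q) i"
  proof
    fix F assume F: "F \<in> {F. ?d F \<noteq> 0}"
    then obtain E where E: "E \<in> \<C> W q" "F = cell q E" using cell_diff_off by blast
    have "\<not> (\<forall>d\<in>{d \<in> {..<q} \<times> UNIV - E. insert d E \<in> \<C> W q}.
        f (cell q (insert d E)) * (of_int (\<sigma> (insert d E) d) * mon (var (snd d))) = 0)"
    proof
      assume "\<forall>d\<in>{d \<in> {..<q} \<times> UNIV - E. insert d E \<in> \<C> W q}.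
        f (cell q (insert d E)) * (of_int (\<sigma> (insert d E) d) * mon (var (snd d))) = 0"
      then have "?d F = 0" unfolding E(2) cell_diff_chain_cell[OF E(1)] by (rule sum.neutral)
      then show False using F by simp
    qed
    then obtain d where "d \<in> {d \<in> {..<q} \<times> UNIV - E. insert d E \<in> \<C> W q}"
      and ne: "f (cell q (insert d E)) * (of_int (\<sigma> (insert d E) d) * mon (var (snd d))) \<noteq> 0"
      by blast
    then have d: "d \<notin> E" "insert d E \<in> \<C> W q" by auto
    have "f (cell q (insert d E)) \<noteq> 0" using ne by auto
    then have "cell q (insert d E) \<in> cells_of_dim (\<K> W q) (Suc i)"
      using f by (auto simp: free_mod_def)
    then have "card (insert d E) = q + Suc i" using chain_cell_in_cells_of_dim_iff[OF d(2)] by simp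
    then have "card E = q + i" using d(1) finite_chain[OF E(1)] by simp
    then show "F \<in> cells_of_dim (\<K> W q) i" using chain_cell_in_cells_of_dim_iff[OF E(1)] E(2) by simp
  qed
  have "finite (cells_of_dim (\<K> W q) i)" unfolding cells_of_dim_chain_complex by simp
  then show ?thesis unfolding free_mod_def using sub finite_subset[OF sub] by simp
qed

text \<open>Preimages are found in each strand over the field and reassembled to
  polynomials.\<close>

lemma cell_complex_exact:
  fixes f :: "(real^'v) set \<Rightarrow> ('v, 'k::field) mpoly"
  assumes f: "f \<in> \<F> W q i"
    and cycle: "0 < i \<Longrightarrow> cdiff W q f = (\<lambda>_. 0)"
    and aug: "i = 0 \<Longrightarrow> cell_aug (\<K> W q) f = 0"
  shows "\<exists>g\<in>\<F> W q ((Suc i)).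
    cdiff W q g = f"
proof -
  let ?\<phi> = "\<D> W q f"
  \<comment> \<open>For \<open>i = 0\<close> the cycle condition is automatic: a nonzero term would
    require a row chain with fewer than \<open>q\<close> pairs.\<close>
  have bd: "bd q (?\<phi> \<alpha>) E = 0" if E: "E \<in> \<C> UNIV q" for \<alpha> E
  proof (cases "i = 0")
    case False
    then have "\<B> q (?\<phi> \<alpha>) = \<D> W q (\<lambda>_. 0) \<alpha>"
      unfolding degree_part_cell_diff[symmetric] using cycle by simp
    then have "\<B> q (?\<phi> \<alpha>) E = 0" by (simp add: degree_part_def)
    then show ?thesis using E by (simp add: chain_boundary_def)
  next
    case True
    show ?thesis
    proof (rule ccontr)
      assume "bd q (?\<phi> \<alpha>) E \<noteq> 0"
      then obtain d where d: "d \<notin> E" "?\<phi> \<alpha> (insert d E) \<noteq> 0" by (rule boundary_nonzeroE)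
      then have "card (insert d E) = q" using degree_part_card[OF f] True by simp
      then show False using d(1) finite_chain[OF E] chain_card_ge[OF E] by simp
    qed
  qed
  have ex: "\<exists>\<psi>. (\<forall>D. \<psi> D \<noteq> 0 \<longrightarrow> D \<in> \<C> (W \<inter> keys \<alpha>) q \<and> card D = Suc (q + i)) \<and>
      \<B> q \<psi> = ?\<phi> \<alpha>" for \<alpha>
  proof (rule row_chains_exact)
    show "?\<phi> \<alpha> D \<noteq> 0 \<Longrightarrow> D \<in> \<C> (W \<inter> keys \<alpha>) q \<and> card D = q + i" for D
      by (rule degree_part_card[OF f])
    show "E \<in> \<C> UNIV q \<Longrightarrow> bd q (?\<phi> \<alpha>) E = 0" for E by (rule bd)
    assume "q + i = q"
    then have "i = 0" by simp
    then show "(\<Sum>D\<in>\<C> (W \<inter> keys \<alpha>) q. ?\<phi> \<alpha> D) = 0"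
      using lookup_cell_aug[of f W q \<alpha>] f aug by simp
  qed
  define Q where "Q \<alpha> \<psi> \<longleftrightarrow> (\<forall>D. \<psi> D \<noteq> 0 \<longrightarrow> D \<in> \<C> (W \<inter> keys \<alpha>) q \<and> card D = Suc (q + i)) \<and>
      \<B> q \<psi> = ?\<phi> \<alpha>" for \<alpha> \<psi>
  have "\<forall>\<alpha>. \<exists>\<psi>. Q \<alpha> \<psi>" unfolding Q_def by (rule allI, rule ex)
  then obtain \<Psi> where \<Psi>: "\<forall>\<alpha>. Q \<alpha> (\<Psi> \<alpha>)" by (rule choice[THEN exE])
  \<comment> \<open>The choice is reset to 0 where the strand of \<open>f\<close> vanishes;
    otherwise infinitely many multidegrees might be nonzero, and no polynomial would have these
    strands.\<close>
  define \<psi> where "\<psi> \<alpha> = (if ?\<phi> \<alpha> = (\<lambda>_. 0) then (\<lambda>_. 0) else \<Psi> \<alpha>)" for \<alpha>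
  have "Q \<alpha> (\<psi> \<alpha>)" for \<alpha>
  proof (cases "?\<phi> \<alpha> = (\<lambda>_. 0)")
    case True
    then show ?thesis by (simp add: \<psi>_def Q_def chain_boundary_def boundary_def fun_eq_iff)
  next
    case False
    show ?thesis unfolding \<psi>_def if_not_P[OF False] by (rule \<Psi>[rule_format])
  qed
  then have \<psi>: "\<psi> \<alpha> D \<noteq> 0 \<Longrightarrow> D \<in> \<C> (W \<inter> keys \<alpha>) q \<and> card D = q + Suc i"
    and \<psi>d: "\<B> q (\<psi> \<alpha>) = ?\<phi> \<alpha>" for \<alpha> D
    unfolding Q_def by simp_all
  have "{\<alpha>. \<exists>D. \<psi> \<alpha> D \<noteq> 0} \<subseteq> {\<alpha>. \<exists>D. ?\<phi> \<alpha> D \<noteq> 0}" by (auto simp: \<psi>_def)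
  then have fin: "finite {\<alpha>. \<exists>D. \<psi> \<alpha> D \<noteq> 0}" by (rule finite_subset[OF _ finite_degrees])
  have "\<exists>g\<in>\<F> W q ((Suc i)). \<forall>\<alpha>. \<D> W q g \<alpha> = \<psi> \<alpha>"
    by (rule degree_parts_realize[OF \<psi> fin])
  then obtain g where g: "g \<in> \<F> W q ((Suc i))"
    "\<And>\<alpha>. \<D> W q g \<alpha> = \<psi> \<alpha>" by blast
  have "cdiff W q g = f"
    by (rule degree_part_eqI[of q W]) (simp_all add: cell_diff_off free_mod_off[OF f] degree_part_cell_diff g(2) \<psi>d)
  then show ?thesis using g(1) by blast
qed

lemma cell_diff_cell_diff:
  fixes f :: "(real^'v) set \<Rightarrow> ('v, 'k::field) mpoly"
  shows "cdiff W q
    (cdiff W q f) = (\<lambda>_. 0)"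
proof (rule degree_part_eqI[where W = W and q = q])
  fix \<alpha> :: "'v monomial"
  have "D \<in> \<C> UNIV q" if "\<D> W q f \<alpha> D \<noteq> 0" for D
    by (rule row_chains_mono[OF degree_part_support[OF that]]) simp
  then have "\<B> q (\<B> q (\<D> W q f \<alpha>)) = (\<lambda>_. 0)"
    by (rule chain_boundary_chain_boundary)
  moreover have "\<D> W q (\<lambda>_. 0 :: ('v, 'k) mpoly) \<alpha> = (\<lambda>_. 0)"
    by (simp add: degree_part_def fun_eq_iff)
  ultimately show "\<D> W q (cdiff W q
    (cdiff W q f)) \<alpha> = \<D> W q (\<lambda>_. 0) \<alpha>"
    unfolding degree_part_cell_diff by simp
qed (simp_all add: cell_diff_off)

lemma cell_aug_cell_diff:
  fixes f :: "(real^'v) set \<Rightarrow> ('v, 'k::field) mpoly"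
  assumes f: "f \<in> \<F> W q 1"
  shows "cell_aug (\<K> W q) (cdiff W q f) = 0"
proof (rule poly_mapping_eqI)
  fix \<alpha> :: "'v monomial"
  let ?C = "\<C> (W \<inter> keys \<alpha>) q"
  have d: "cdiff W q f \<in> \<F> W q 0"
    by (rule cell_diff_free_mod) (use f in simp)
  have "(\<Sum>D\<in>?C. \<B> q (\<D> W q f \<alpha>) D) = (\<Sum>D\<in>?C. bd q (\<D> W q f \<alpha>) D)"
  proof (intro sum.cong refl)
    fix D assume "D \<in> ?C"
    then have "D \<in> \<C> UNIV q" by (rule row_chains_mono) simp
    then show "\<B> q (\<D> W q f \<alpha>) D = bd q (\<D> W q f \<alpha>) D"
      by (simp add: chain_boundary_def)
  qed
  also have "\<dots> = 0"
    by (rule sum_boundary_edges) (use degree_part_card[OF f] in auto)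
  finally show "lookup (cell_aug (\<K> W q) (cdiff W q f)) \<alpha> = lookup 0 \<alpha>"
    unfolding lookup_cell_aug[OF d] degree_part_cell_diff by simp
qed

end

section \<open>Linearity, the image of the augmentation, and the resolution\<close>

lemma cell_diff_add: "cell_diff L \<epsilon> (\<lambda>b. f b + g b) = (\<lambda>c. cell_diff L \<epsilon> f c + cell_diff L \<epsilon> g c)"
  by (auto simp: cell_diff_def fun_eq_iff distrib_right sum.distrib)

lemma cell_diff_scale: "cell_diff L \<epsilon> (\<lambda>b. c * f b) = (\<lambda>G. c * cell_diff L \<epsilon> f G)"
  by (auto simp: cell_diff_def fun_eq_iff sum_distrib_left mult.assoc)

lemma cell_aug_add: "cell_aug L (\<lambda>b. f b + g b) = cell_aug L f + cell_aug L g"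
  by (simp add: cell_aug_def distrib_right sum.distrib)

lemma cell_aug_scale: "cell_aug L (\<lambda>b. c * f b) = c * cell_aug L f"
  by (simp add: cell_aug_def sum_distrib_left mult.assoc)

lemma free_mod_add: "f \<in> free_mod B \<Longrightarrow> g \<in> free_mod B \<Longrightarrow> (\<lambda>b. f b + g b) \<in> free_mod B"
proof -
  assume f: "f \<in> free_mod B" and g: "g \<in> free_mod B"
  have sub: "{b. f b + g b \<noteq> 0} \<subseteq> {b. f b \<noteq> 0} \<union> {b. g b \<noteq> 0}" by auto
  then have "finite {b. f b + g b \<noteq> 0}" by (rule finite_subset) (use f g in \<open>auto simp: free_mod_def\<close>)
  then show ?thesis using f g sub by (auto simp: free_mod_def)
qed

lemma free_mod_scale: "f \<in> free_mod B \<Longrightarrow> (\<lambda>b. c * f b) \<in> free_mod B"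
proof -
  assume f: "f \<in> free_mod B"
  have sub: "{b. c * f b \<noteq> 0} \<subseteq> {b. f b \<noteq> 0}" by auto
  then have "finite {b. c * f b \<noteq> 0}" by (rule finite_subset) (use f in \<open>auto simp: free_mod_def\<close>)
  then show ?thesis using f sub by (auto simp: free_mod_def)
qed

context ranking
begin

text \<open>The vertices are the picks and their labels the generators, so each generator is the
  image of a basis element, and the image is an ideal by linearity.\<close>

lemma image_cell_aug:
  "cell_aug (\<K> W q) ` \<F> W q 0
    = (ideal_gen (mon ` plabel q ` vpicks \<beta> W q) :: ('v, 'k::field) mpoly set)"
proof -
  let ?L = "\<K> W q" and ?M = "mon ` plabel q ` vpicks \<beta> W q :: ('v, 'k) mpoly set"
  have vertex: "\<exists>s\<in>vpicks \<beta> W q. F = {corner r q s} \<and> face_label ?L F = plabel q s" if F: "F \<in> cells_of_dim ?L 0" for F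
  proof -
    obtain D where D: "D \<in> \<C> W q" "card D = q" "F = cell q D"
      using F unfolding cells_of_dim_chain_complex by auto
    obtain s where s: "s \<in> picks q D" using picks_nonempty[OF D(1)] by blast
    have sv: "s \<in> vpicks \<beta> W q" by (rule picks_vpicks[OF D(1) s])
    note G = chain_card_eq[OF D(1,2) s]
    have "F = {corner r q s}" unfolding D(3) by (subst G, rule chain_cell_graph) (use s in \<open>simp add: picks_iff\<close>)
    moreover have "face_label ?L F = plabel q s"
    proof -
      have "clabel D = (\<Sum>d\<in>(\<lambda>k. (k, s k)) ` {..<q}. var (snd d))" unfolding clabel_def by (subst G) simp
      also have "\<dots> = plabel q s" by (subst sum.reindex) (auto simp: inj_on_def plabel_def)
      finally show ?thesis unfolding D(3) face_label_chain_cell[OF D(1)] .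
    qed
    ultimately show ?thesis using sv by blast
  qed
  have vertex': "{corner r q s} \<in> cells_of_dim ?L 0 \<and> face_label ?L {corner r q s} = plabel q s" if s: "s \<in> vpicks \<beta> W q" for s
  proof -
    note G = vpicks_graph[OF s]
    have ext: "s \<in> extensional {..<q}" using s by (simp add: vpicks_def)
    have "card ((\<lambda>k. (k, s k)) ` {..<q}) = q" by (simp add: card_image inj_on_def)
    then have c: "{corner r q s} \<in> cells_of_dim ?L 0"
      using chain_cell_in_cells_of_dim_iff[OF G(1), of 0] chain_cell_graph[OF ext] by simp
    obtain s' where s': "s' \<in> vpicks \<beta> W q" "{corner r q s} = {corner r q s'}" "face_label ?L {corner r q s} = plabel q s'"
      using vertex[OF c] by blast
    have "s = s'"
      using corner_inj[OF G(1) vpicks_graph(1)[OF s'(1)] G(2) vpicks_graph(2)[OF s'(1)]] s'(2) by simp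
    then show ?thesis using c s'(3) by simp
  qed
  show ?thesis
  proof
    show "cell_aug ?L ` free_mod (cells_of_dim ?L 0) \<subseteq> ideal_gen ?M"
    proof
      fix p assume "p \<in> cell_aug ?L ` (free_mod (cells_of_dim ?L 0) :: ((real^'v) set \<Rightarrow> ('v, 'k) mpoly) set)"
      then obtain f :: "(real^'v) set \<Rightarrow> ('v, 'k) mpoly" where p: "p = cell_aug ?L f" by blast
      show "p \<in> ideal_gen ?M"
        unfolding p cell_aug_def ideal_gen_def
      proof (rule module.span_sum[OF module_mult], rule module.span_scale[OF module_mult], rule module.span_base[OF module_mult])
        fix F assume "F \<in> cells_of_dim ?L 0"
        then obtain s where "s \<in> vpicks \<beta> W q" "face_label ?L F = plabel q s" using vertex by blast
        then show "mon (face_label ?L F) \<in> ?M" by simp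
      qed
    qed
    show "ideal_gen ?M \<subseteq> cell_aug ?L ` free_mod (cells_of_dim ?L 0)"
      unfolding ideal_gen_def
    proof (rule module.span_minimal[OF module_mult])
      show "?M \<subseteq> cell_aug ?L ` free_mod (cells_of_dim ?L 0)"
      proof
        fix p assume "p \<in> ?M"
        then obtain s where s: "s \<in> vpicks \<beta> W q" "p = mon (plabel q s)" by blast
        note v = vertex'[OF s(1)]
        define f where "f F = (if F = {corner r q s} then 1 else (0 :: ('v, 'k) mpoly))" for F
        have "f \<in> free_mod (cells_of_dim ?L 0)" using v by (auto simp: free_mod_def f_def)
        moreover have "cell_aug ?L f = p"
        proof -
          have fin: "finite (cells_of_dim ?L 0)" unfolding cells_of_dim_chain_complex by simp
          have "cell_aug ?L f = (\<Sum>F\<in>cells_of_dim ?L 0. if F = {corner r q s} then mon (plabel q s) else 0)"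
            unfolding cell_aug_def f_def using v by (intro sum.cong) auto
          then show ?thesis using v s(2) fin by simp
        qed
        ultimately show "p \<in> cell_aug ?L ` free_mod (cells_of_dim ?L 0)" by blast
      qed
      show "module.subspace (*) (cell_aug ?L ` (free_mod (cells_of_dim ?L 0) :: ((real^'v) set \<Rightarrow> ('v, 'k) mpoly) set))"
        unfolding module.subspace_def[OF module_mult]
      proof (intro conjI ballI allI)
        have "(\<lambda>_. 0) \<in> (free_mod (cells_of_dim ?L 0) :: ((real^'v) set \<Rightarrow> ('v, 'k) mpoly) set)"
          by (simp add: free_mod_def)
        moreover have "cell_aug ?L (\<lambda>_. 0) = (0 :: ('v, 'k) mpoly)" by (simp add: cell_aug_def)
        ultimately show "(0 :: ('v, 'k) mpoly) \<in> cell_aug ?L ` free_mod (cells_of_dim ?L 0)"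
          by (intro image_eqI[of _ _ "\<lambda>_. 0"]) simp_all
      next
        fix x y :: "('v, 'k) mpoly"
        assume "x \<in> cell_aug ?L ` free_mod (cells_of_dim ?L 0)" "y \<in> cell_aug ?L ` free_mod (cells_of_dim ?L 0)"
        then obtain f g where fg: "f \<in> free_mod (cells_of_dim ?L 0)" "g \<in> free_mod (cells_of_dim ?L 0)"
          "x = cell_aug ?L f" "y = cell_aug ?L g" by (elim imageE)
        show "x + y \<in> cell_aug ?L ` free_mod (cells_of_dim ?L 0)"
          by (rule image_eqI[OF _ free_mod_add[OF fg(1,2)]]) (simp only: cell_aug_add fg)
      next
        fix c x :: "('v, 'k) mpoly"
        assume "x \<in> cell_aug ?L ` free_mod (cells_of_dim ?L 0)"
        then obtain f where f: "f \<in> free_mod (cells_of_dim ?L 0)" "x = cell_aug ?L f" by (elim imageE)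
        show "c * x \<in> cell_aug ?L ` free_mod (cells_of_dim ?L 0)"
          by (rule image_eqI[OF _ free_mod_scale[OF f(1)]]) (simp only: cell_aug_scale f(2))
      qed
    qed
  qed
qed

theorem chain_complex_supports_resolution:
  "supports_minimal_free_resolution (\<K> W q) (\<I> q)
    (ideal_gen (mon ` plabel q ` vpicks \<beta> W q) :: ('v, 'k::field) mpoly set)"
proof -
  let ?L = "\<K> W q" and ?\<epsilon> = "\<I> q"
  let ?d = "cell_diff ?L ?\<epsilon> :: ((real^'v) set \<Rightarrow> ('v, 'k) mpoly) \<Rightarrow> _"
  let ?F = "\<lambda>i. free_mod (cells_of_dim ?L i) :: ((real^'v) set \<Rightarrow> ('v, 'k) mpoly) set"
  have "free_resolution (cells_of_dim ?L) (\<lambda>_. ?d) (cell_aug ?L) (ideal_gen (mon ` plabel q ` vpicks \<beta> W q))"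
    unfolding free_resolution_def
  proof (intro conjI allI)
    show "hom_free (cells_of_dim ?L (Suc i)) (cells_of_dim ?L i) ?d" for i
      unfolding hom_free_def by (simp add: cell_diff_free_mod cell_diff_add cell_diff_scale)
    show "hom_ring (cells_of_dim ?L 0) (cell_aug ?L :: ((real^'v) set \<Rightarrow> ('v, 'k) mpoly) \<Rightarrow> _)"
      unfolding hom_ring_def by (simp add: cell_aug_add cell_aug_scale)
    show "cell_aug ?L ` ?F 0 = ideal_gen (mon ` plabel q ` vpicks \<beta> W q)" by (rule image_cell_aug)
    show "{f \<in> ?F 0. cell_aug ?L f = 0} = ?d ` ?F 1"
    proof
      show "{f \<in> ?F 0. cell_aug ?L f = 0} \<subseteq> ?d ` ?F 1"
      proof
        fix f assume "f \<in> {f \<in> ?F 0. cell_aug ?L f = 0}"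
        then have "\<exists>g\<in>?F (Suc 0). ?d g = f" by (intro cell_complex_exact) auto
        then show "f \<in> ?d ` ?F 1" by auto
      qed
      show "?d ` ?F 1 \<subseteq> {f \<in> ?F 0. cell_aug ?L f = 0}"
        using cell_aug_cell_diff cell_diff_free_mod[of _ W q 0] by auto
    qed
    show "{f \<in> ?F (Suc i). ?d f = (\<lambda>_. 0)} = ?d ` ?F (Suc (Suc i))" for i
    proof
      show "{f \<in> ?F (Suc i). ?d f = (\<lambda>_. 0)} \<subseteq> ?d ` ?F (Suc (Suc i))"
      proof
        fix f assume "f \<in> {f \<in> ?F (Suc i). ?d f = (\<lambda>_. 0)}"
        then have "\<exists>g\<in>?F (Suc (Suc i)). ?d g = f" by (intro cell_complex_exact) auto
        then show "f \<in> ?d ` ?F (Suc (Suc i))" by auto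
      qed
      show "?d ` ?F (Suc (Suc i)) \<subseteq> {f \<in> ?F (Suc i). ?d f = (\<lambda>_. 0)}"
        using cell_diff_cell_diff cell_diff_free_mod by auto
    qed
  qed
  moreover have "minimal_differentials (cells_of_dim ?L) (\<lambda>_. ?d)"
    unfolding minimal_differentials_def
  proof (intro allI ballI)
    fix i f F
    show "?d f F \<in> var_ideal UNIV"
    proof (cases "F \<in> cell q ` \<C> W q")
      case True
      then obtain E where E: "E \<in> \<C> W q" "F = cell q E" by blast
      \<comment> \<open>Minimality: the added pair contributes its variable as a factor of every
        term.\<close>
      have "f (cell q (insert d E)) * (of_int (\<sigma> (insert d E) d) * mon (var (snd d)))
          \<in> module.span (*) ((\<lambda>v. mon (var v) :: ('v, 'k) mpoly) ` UNIV)" for d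
        by (intro module.span_scale[OF module_mult] module.span_base[OF module_mult]) auto
      then show ?thesis
        unfolding E(2) cell_diff_chain_cell[OF E(1)] var_ideal_def ideal_gen_def by (intro module.span_sum[OF module_mult]) auto
    next
      case False
      show ?thesis
        unfolding cell_diff_off[OF False] var_ideal_def ideal_gen_def by (rule module.span_zero[OF module_mult])
    qed
  qed
  ultimately show ?thesis unfolding supports_minimal_free_resolution_def by blast
qed

end

section \<open>Homogeneity for arbitrary weights of the variables\<close>

lemma mon_degree_add: "mon_degree w (u + v) j = mon_degree w u j + mon_degree w v j"
  by (simp add: mon_degree_def lookup_add distrib_right sum.distrib)

lemma homogeneous_zero: "homogeneous J w a 0"
  by (simp add: homogeneous_def)

lemma homogeneous_add: "homogeneous J w a p \<Longrightarrow> homogeneous J w a p' \<Longrightarrow> homogeneous J w a (p + p')"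
  using Poly_Mapping.keys_add[of p p'] by (auto simp: homogeneous_def)

lemma homogeneous_sum: "(\<And>i. i \<in> A \<Longrightarrow> homogeneous J w a (f i)) \<Longrightarrow> homogeneous J w a (sum f A)"
  by (induction A rule: infinite_finite_induct) (simp_all add: homogeneous_zero homogeneous_add)

lemma homogeneous_times_mon:
  assumes "homogeneous J w a p" and "\<And>j. j \<in> J \<Longrightarrow> a j + mon_degree w m j = a' j"
  shows "homogeneous J w a' (p * mon m)"
  unfolding homogeneous_def
proof (intro ballI)
  fix u j assume u: "u \<in> keys (p * mon m)" and j: "j \<in> J"
  obtain l where "l \<in> keys p" "u = l + m"
    using u keys_mult[of p "mon m"] by (auto simp: keys_mon)
  then show "mon_degree w u j = a' j"
    using assms j by (simp add: mon_degree_add homogeneous_def)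
qed

lemma homogeneous_uminus: "homogeneous J w a p \<Longrightarrow> homogeneous J w a (- p)"
  by (simp add: homogeneous_def)

context ranking
begin

text \<open>Weights are additive on monomials, and each coefficient of the differential is a signed
  quotient of labels. The exponent grading and all gradings by integer vectors are instances of
  \<open>J\<close> and \<open>w\<close>.\<close>

theorem chain_complex_graded:
  "cellular_graded TYPE('k::field) J w (\<K> W q) (\<I> q)"
  unfolding cellular_graded_def graded_maps_def
proof (intro conjI allI ballI subsetI)
  let ?L = "\<K> W q" and ?\<epsilon> = "\<I> q"
  let ?P = "\<lambda>i a. graded_piece J w (face_label ?L) (cells_of_dim ?L i) a :: ((real^'v) set \<Rightarrow> ('v, 'k) mpoly) set"
  have hom: "homogeneous J w (\<lambda>j. a j - mon_degree w (clabel D) j) (f (cell q D))"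
    if f: "f \<in> ?P i a" and D: "D \<in> \<C> W q" for i a f D
  proof (cases "cell q D \<in> cells_of_dim ?L i")
    case True
    then show ?thesis using f face_label_chain_cell[OF D, of W] by (auto simp: graded_piece_def)
  next
    case False
    then have "f (cell q D) = 0" using f by (auto simp: graded_piece_def free_mod_def)
    then show ?thesis by (simp add: homogeneous_zero)
  qed
  {
    fix i a h assume "h \<in> cell_diff ?L ?\<epsilon> ` ?P (Suc i) a"
    then obtain f where f: "f \<in> ?P (Suc i) a" "h = cell_diff ?L ?\<epsilon> f" by blast
    have "h \<in> free_mod (cells_of_dim ?L i)"
      unfolding f(2) by (rule cell_diff_free_mod) (use f(1) in \<open>simp add: graded_piece_def\<close>)
    moreover have "homogeneous J w (\<lambda>j. a j - mon_degree w (face_label ?L F) j) (h F)"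
      if F: "F \<in> cells_of_dim ?L i" for F
    proof -
      obtain E where E: "E \<in> \<C> W q" "F = cell q E"
        using F unfolding cells_of_dim_chain_complex by blast
      show ?thesis
        unfolding f(2) E(2) cell_diff_chain_cell[OF E(1)] face_label_chain_cell[OF E(1)]
      proof (rule homogeneous_sum)
        fix d assume "d \<in> {d \<in> {..<q} \<times> UNIV - E. insert d E \<in> \<C> W q}"
        then have D: "insert d E \<in> \<C> W q" "d \<notin> E" by auto
        have "homogeneous J w (\<lambda>j. a j - mon_degree w (clabel E) j) (f (cell q (insert d E)) * mon (var (snd d)))"
          by (rule homogeneous_times_mon[OF hom[OF f(1) D(1)]])
            (simp add: clabel_insert[OF finite_chain[OF E(1)] D(2)] mon_degree_add)
        then show "homogeneous J w (\<lambda>j. a j - mon_degree w (clabel E) j)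
            (f (cell q (insert d E)) * (of_int (\<sigma> (insert d E) d) * mon (var (snd d))))"
          using chain_sign_cases[of r "insert d E" d] homogeneous_uminus by auto
      qed
    qed
    ultimately show "h \<in> ?P i a" by (simp add: graded_piece_def)
  }
  fix a f assume f: "f \<in> ?P 0 a"
  show "homogeneous J w a (cell_aug ?L f)"
    unfolding cell_aug_def
  proof (rule homogeneous_sum)
    fix F assume F: "F \<in> cells_of_dim ?L 0"
    then obtain D where D: "D \<in> \<C> W q" "F = cell q D"
      unfolding cells_of_dim_chain_complex by blast
    show "homogeneous J w a (f F * mon (face_label ?L F))"
      unfolding D(2) face_label_chain_cell[OF D(1)] by (rule homogeneous_times_mon[OF hom[OF f D(1)]]) simp
  qed
qed

end

section \<open>The ideals and the recursive description\<close>

text \<open>One factor is fixed at a time: the elements whose product with a fixed \<open>y\<close>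
  lies in a given ideal form an ideal.\<close>

lemma ideal_gen_mult:
  assumes a: "a \<in> ideal_gen A" and b: "b \<in> ideal_gen B"
  shows "a * b \<in> ideal_gen {x * y | x y. x \<in> A \<and> y \<in> B}"
proof -
  let ?T = "module.span (*) {x * y | x y. x \<in> A \<and> y \<in> B}"
  have colon: "module.subspace (*) {a. a * y \<in> ?T}" for y
    unfolding module.subspace_def[OF module_mult]
    using module.span_zero[OF module_mult] module.span_add[OF module_mult]
      module.span_scale[OF module_mult]
    by (auto simp: distrib_right mult.assoc)
  have *: "a * y \<in> ?T" if y: "y \<in> B" for y
  proof -
    have "module.span (*) A \<subseteq> {a. a * y \<in> ?T}"
    proof (rule module.span_minimal[OF module_mult _ colon])
      have "a * y \<in> ?T" if "a \<in> A" for a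
        by (rule module.span_base[OF module_mult]) (use that y in blast)
      then show "A \<subseteq> {a. a * y \<in> ?T}" by blast
    qed
    then show ?thesis using a by (auto simp: ideal_gen_def)
  qed
  have "module.span (*) B \<subseteq> {b. b * a \<in> ?T}"
    by (rule module.span_minimal[OF module_mult _ colon]) (use * in \<open>auto simp: mult.commute\<close>)
  then show ?thesis using b by (auto simp: ideal_gen_def mult.commute)
qed

lemma ideal_gen_mono: "A \<subseteq> B \<Longrightarrow> ideal_gen A \<subseteq> ideal_gen B"
  unfolding ideal_gen_def by (rule module.span_mono[OF module_mult])

lemma ideal_gen_base: "a \<in> A \<Longrightarrow> a \<in> ideal_gen A"
  unfolding ideal_gen_def by (rule module.span_base[OF module_mult])

lemma ideal_gen_minimal: "A \<subseteq> ideal_gen B \<Longrightarrow> ideal_gen A \<subseteq> ideal_gen B"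
  unfolding ideal_gen_def
  by (rule module.span_minimal[OF module_mult _ module.subspace_span[OF module_mult]])

lemma ideal_gen_prod:
  assumes "finite J" "\<And>j. j \<in> J \<Longrightarrow> f j \<in> ideal_gen (A j)"
  shows "(\<Prod>j\<in>J. f j) \<in> ideal_gen {(\<Prod>j\<in>J. g j) | g. \<forall>j\<in>J. g j \<in> A j}"
  using assms
proof (induction J rule: finite_induct)
  case empty
  then show ?case by (intro ideal_gen_base) simp
next
  case (insert i J)
  let ?X = "{x * y | x y. x \<in> A i \<and> y \<in> {(\<Prod>j\<in>J. g j) | g. \<forall>j\<in>J. g j \<in> A j}}"
  let ?Y = "{(\<Prod>j\<in>insert i J. g j) | g. \<forall>j\<in>insert i J. g j \<in> A j}"
  have "f i * prod f J \<in> ideal_gen ?X"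
    using insert by (intro ideal_gen_mult) auto
  moreover have "?X \<subseteq> ?Y"
  proof
    fix z assume "z \<in> ?X"
    then obtain x g where xg: "z = x * (\<Prod>j\<in>J. g j)" "x \<in> A i" "\<forall>j\<in>J. g j \<in> A j" by blast
    have "(\<Prod>j\<in>J. (g(i := x)) j) = (\<Prod>j\<in>J. g j)"
      using insert.hyps by (intro prod.cong) auto
    then have "z = (\<Prod>j\<in>insert i J. (g(i := x)) j)"
      using insert.hyps xg(1) by simp
    moreover have "\<forall>j\<in>insert i J. (g(i := x)) j \<in> A j" using xg by auto
    ultimately show "z \<in> ?Y" by blast
  qed
  ultimately show ?case using insert.hyps ideal_gen_mono by (metis (no_types, lifting) prod.insert subsetD)
qed

text \<open>An increasing enumeration of \<open>J\<close> turns a choice of one variable from each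
  block of \<open>J\<close> into a pick; conversely, the blocks met by a pick form an index
  set.\<close>

lemma I_ideal_eq:
  fixes \<beta> :: "'v \<Rightarrow> nat"
  assumes B: "\<And>j. 1 \<le> j \<Longrightarrow> j \<le> p \<Longrightarrow> B j = {v. \<beta> v = j}" and \<beta>1: "\<And>v. 1 \<le> \<beta> v"
  shows "I_ideal B p q = (ideal_gen (mon ` plabel q ` vpicks \<beta> {v. \<beta> v \<le> p} q) :: ('v, 'k::field) mpoly set)"
    (is "_ = ideal_gen ?M")
proof
  have "ideal_prod J (\<lambda>j. var_ideal (B j)) \<subseteq> ideal_gen ?M" if J: "J \<subseteq> {1..p}" "card J = q" for J
    unfolding ideal_prod_def
  proof (rule ideal_gen_minimal, rule subsetI)
    have finJ: "finite J" using J(1) finite_subset by blast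
    fix z :: "('v, 'k) mpoly" assume "z \<in> {(\<Prod>j\<in>J. f j) | f. \<forall>j\<in>J. f j \<in> var_ideal (B j)}"
    then obtain f :: "nat \<Rightarrow> ('v, 'k) mpoly"
      where f: "z = (\<Prod>j\<in>J. f j)" "\<forall>j\<in>J. f j \<in> ideal_gen ((\<lambda>v. mon (var v)) ` B j)"
      by (auto simp: var_ideal_def)
    let ?Z = "{(\<Prod>j\<in>J. g j) | g. \<forall>j\<in>J. g j \<in> (\<lambda>v. mon (var v) :: ('v, 'k) mpoly) ` B j}"
    have "z \<in> ideal_gen ?Z"
      unfolding f(1) using f(2) by (intro ideal_gen_prod[OF finJ]) auto
    moreover have "?Z \<subseteq> ?M"
    proof
      fix y :: "('v, 'k) mpoly"
      assume "y \<in> ?Z"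
      then obtain g where y: "y = (\<Prod>j\<in>J. g j)" and g: "\<forall>j\<in>J. g j \<in> (\<lambda>v. mon (var v)) ` B j" by blast
      have "\<forall>j\<in>J. \<exists>v. v \<in> B j \<and> g j = mon (var v)" using g by blast
      then obtain h where h: "\<forall>j\<in>J. h j \<in> B j \<and> g j = mon (var (h j))" by (rule bchoice[THEN exE])
      have \<beta>h: "\<beta> (h j) = j" if "j \<in> J" for j
      proof -
        have "1 \<le> j" "j \<le> p" using that J(1) by auto
        then show ?thesis using bspec[OF h that] B[of j] by simp
      qed
      define e where "e = Infinite_Set.enumerate J"
      have e_in: "e k \<in> J" if "k < q" for k using that J(2) finJ finite_enumerate_in_set[of J k] by (simp add: e_def)
      have e_mono: "e k < e l" if "k < l" "l < q" for k l
        using that J(2) finJ finite_enumerate_mono[of k l J] by (simp add: e_def)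
      have "inj_on e {..<q}"
        by (rule linorder_inj_onI) (use e_mono in force)+
      moreover have "e ` {..<q} = J"
        using finite_enumerate_Ex[OF finJ] e_in J(2) by (force simp: e_def)
      ultimately have bij: "bij_betw e {..<q} J" by (simp add: bij_betw_def)
      define s where "s = restrict (\<lambda>k. h (e k)) {..<q}"
      have "s \<in> vpicks \<beta> {v. \<beta> v \<le> p} q"
        using e_in e_mono \<beta>h J(1) by (auto simp: vpicks_def s_def subset_iff)
      moreover have "plabel q s = (\<Sum>k<q. var (h (e k)))" by (simp add: plabel_def s_def)
      then have "plabel q s = (\<Sum>j\<in>J. var (h j))" using sum.reindex_bij_betw[OF bij, of "\<lambda>j. var (h j)"] by simp
      then have "mon (plabel q s) = y" using h by (simp add: mon_sum y)
      ultimately show "y \<in> ?M" by blast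
    qed
    ultimately show "z \<in> ideal_gen ?M" using ideal_gen_mono by blast
  qed
  then show "I_ideal B p q \<subseteq> ideal_gen ?M"
    unfolding I_ideal_def ideal_sum_def by (intro ideal_gen_minimal) blast
  have "?M \<subseteq> I_ideal B p q"
  proof
    fix y :: "('v, 'k) mpoly" assume "y \<in> ?M"
    then obtain s where s: "s \<in> vpicks \<beta> {v. \<beta> v \<le> p} q" "y = mon (plabel q s)" by blast
    define J where "J = (\<lambda>k. \<beta> (s k)) ` {..<q}"
    have inj: "inj_on (\<lambda>k. \<beta> (s k)) {..<q}"
      by (rule linorder_inj_onI) (use s(1) in \<open>force simp: vpicks_def\<close>)+
    have J: "J \<subseteq> {1..p}" "card J = q"
      using s(1) \<beta>1 inj by (auto simp: J_def vpicks_def card_image)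
    \<comment> \<open>The entries of \<open>s\<close> lie in different blocks, so each index in
      \<open>J\<close> determines the entry whose variable is the factor there.\<close>
    define f where "f j = (mon (var (s (inv_into {..<q} (\<lambda>k. \<beta> (s k)) j))) :: ('v, 'k) mpoly)" for j
    have f: "f (\<beta> (s k)) = mon (var (s k))" if "k < q" for k
      using inv_into_f_f[OF inj, of k] that by (simp add: f_def)
    have "(\<Prod>j\<in>J. f j) = (\<Prod>k<q. f (\<beta> (s k)))" unfolding J_def by (simp add: prod.reindex[OF inj])
    also have "\<dots> = y" using f by (simp add: s(2) plabel_def mon_sum)
    finally have y: "y = (\<Prod>j\<in>J. f j)" ..
    have "f j \<in> var_ideal (B j)" if "j \<in> J" for j
    proof -
      obtain k where k: "k < q" "j = \<beta> (s k)" using \<open>j \<in> J\<close> by (auto simp: J_def)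
      have "s k \<in> B j" using B[of j] J(1) that k by auto
      then show ?thesis unfolding k(2) f[OF k(1)] var_ideal_def by (intro ideal_gen_base) (simp add: k(2))
    qed
    then have "y \<in> ideal_prod J (\<lambda>j. var_ideal (B j))"
      unfolding ideal_prod_def y by (intro ideal_gen_base) blast
    then show "y \<in> I_ideal B p q"
      unfolding I_ideal_def ideal_sum_def using J by (intro ideal_gen_base) blast
  qed
  then show "ideal_gen ?M \<subseteq> I_ideal B p q"
    unfolding I_ideal_def ideal_sum_def by (rule ideal_gen_minimal)
qed

text \<open>The polynomials all of whose monomials are divisible by some generator form an ideal
  that contains the generators.\<close>

lemma mon_in_monomial_ideal_iff:
  "(mon u :: ('v, 'k::field) mpoly) \<in> ideal_gen (mon ` G) \<longleftrightarrow> (\<exists>g\<in>G. monomial_dvd g u)"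
proof
  let ?P = "{p :: ('v, 'k) mpoly. \<forall>u\<in>keys p. \<exists>g\<in>G. monomial_dvd g u}"
  assume "(mon u :: ('v, 'k) mpoly) \<in> ideal_gen (mon ` G)"
  moreover have "ideal_gen (mon ` G) \<subseteq> ?P"
    unfolding ideal_gen_def
  proof (rule module.span_minimal[OF module_mult])
    have "monomial_dvd g g" for g :: "'v monomial" unfolding monomial_dvd_def by (rule exI[of _ 0]) simp
    then show "mon ` G \<subseteq> ?P" by (simp add: keys_mon image_subset_iff) blast
    show "module.subspace (*) ?P"
      unfolding module.subspace_def[OF module_mult]
    proof (intro conjI ballI allI)
      show "0 \<in> ?P" by simp
    next
      fix p p' assume "p \<in> ?P" "p' \<in> ?P"
      then show "p + p' \<in> ?P" using Poly_Mapping.keys_add[of p p'] by blast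
    next
      fix c p assume p: "p \<in> ?P"
      show "c * p \<in> ?P"
      proof (intro CollectI ballI)
        fix u assume "u \<in> keys (c * p)"
        then obtain a l where u: "u = a + l" "l \<in> keys p" using keys_mult[of c p] by blast
        then obtain g w where "g \<in> G" "l = g + w" using p by (auto simp: monomial_dvd_def)
        then have "u = g + (a + w)" using u by (simp add: algebra_simps)
        then show "\<exists>g\<in>G. monomial_dvd g u" using \<open>g \<in> G\<close> by (auto simp: monomial_dvd_def)
      qed
    qed
  qed
  ultimately show "\<exists>g\<in>G. monomial_dvd g u" by (auto simp: keys_mon)
next
  assume "\<exists>g\<in>G. monomial_dvd g u"
  then obtain g w where g: "g \<in> G" "u = g + w" by (auto simp: monomial_dvd_def)
  then have "(mon u :: ('v, 'k) mpoly) = mon w * mon g" by (simp add: mon_add mult.commute)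
  moreover have "mon w * mon g \<in> module.span (*) (mon ` G :: ('v, 'k) mpoly set)"
    by (intro module.span_scale[OF module_mult] module.span_base[OF module_mult] imageI g(1))
  ultimately show "(mon u :: ('v, 'k) mpoly) \<in> ideal_gen (mon ` G)"
    by (simp add: ideal_gen_def)
qed

text \<open>All labels have total degree \<open>q\<close>, so a monomial of the ideal that divides a
  label has degree \<open>q\<close> as well and equals it.\<close>

lemma min_gens_chain_ideal:
  fixes \<beta> :: "'v::finite \<Rightarrow> nat"
  shows "min_gens (ideal_gen (mon ` plabel q ` vpicks \<beta> W q) :: ('v, 'k::field) mpoly set) = plabel q ` vpicks \<beta> W q"
proof -
  let ?G = "plabel q ` vpicks \<beta> W q"
  define deg where "deg u = (\<Sum>v\<in>UNIV. lookup u v)" for u :: "'v monomial"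
  have deg_add: "deg (u + v) = deg u + deg v" for u v by (simp add: deg_def lookup_add sum.distrib)
  have deg_plabel: "deg (plabel q s) = q" for s
    unfolding deg_def plabel_def lookup_sum lookup_var by (subst sum.swap) simp
  have deg0: "w = 0" if "deg w = 0" for w
    by (rule poly_mapping_eqI) (use that in \<open>simp add: deg_def\<close>)
  let ?U = "{u. (\<exists>g\<in>?G. monomial_dvd g u) \<and> (\<forall>u'. (\<exists>g\<in>?G. monomial_dvd g u') \<and> monomial_dvd u' u \<longrightarrow> u' = u)}"
  have dvd_eq: "u = g" if "g \<in> ?G" "deg u \<le> q" "monomial_dvd g u" for u g
  proof -
    obtain w where w: "u = g + w" using \<open>monomial_dvd g u\<close> unfolding monomial_dvd_def by blast
    have "deg w = 0" using that(1,2) w deg_plabel by (auto simp: deg_add)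
    then show ?thesis using w deg0 by simp
  qed
  have deg_le: "deg u' \<le> deg u" if "monomial_dvd u' u" for u u' using that by (auto simp: monomial_dvd_def deg_add)
  have trans: "monomial_dvd u u''" if "monomial_dvd u u'" "monomial_dvd u' u''" for u u' u'' :: "'v monomial"
    using that by (auto simp: monomial_dvd_def add.assoc)
  show ?thesis
    unfolding min_gens_def mon_in_monomial_ideal_iff
  proof (intro set_eqI iffI)
    fix u assume "u \<in> ?U"
    then obtain g where g: "g \<in> ?G" "monomial_dvd g u"
      and min: "\<And>u'. \<exists>g\<in>?G. monomial_dvd g u' \<Longrightarrow> monomial_dvd u' u \<Longrightarrow> u' = u" by blast
    have "monomial_dvd g g" unfolding monomial_dvd_def by (rule exI[of _ 0]) simp
    then have "g = u" using min g by blast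
    then show "u \<in> ?G" using g by simp
  next
    fix u assume u: "u \<in> ?G"
    have "monomial_dvd u u" unfolding monomial_dvd_def by (rule exI[of _ 0]) simp
    moreover have "u' = u" if "g \<in> ?G" "monomial_dvd g u'" "monomial_dvd u' u" for u' g
    proof -
      have "deg u = q" using u deg_plabel by auto
      then have "deg u' \<le> q" using deg_le[OF that(3)] by simp
      then have "u' = g" using dvd_eq that by blast
      moreover have "u = g" using dvd_eq[OF that(1)] trans[OF that(2,3)] \<open>deg u = q\<close> by simp
      ultimately show ?thesis by simp
    qed
    ultimately show "u \<in> ?U"
      using u by blast
  qed
qed

section \<open>Vertex label sets of simplices and products\<close>

text \<open>Unit vectors are affinely independent, so the faces of the simplex are the hulls of the
  subsets of its vertices.\<close>

lemma label_cells_Delta: "label_cells (Delta Q) = (\<lambda>A. var ` A) ` Pow Q"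
proof -
  let ?E = "\<lambda>v :: 'a. axis v 1 :: real^'a"
  have "?E ` A \<subseteq> Basis" for A by (auto simp: Basis_vec_def)
  then have indep: "\<not> affine_dependent (?E ` A)" for A
    using affine_dependent_imp_dependent independent_mono[OF independent_Basis] by blast
  have "cells (Delta Q) = (\<lambda>A. convex hull (?E ` A)) ` Pow Q"
    unfolding Delta_def fst_conv face_of_convex_hull_affine_independent[OF indep]
    by (auto simp: subset_image_iff)
  moreover have "vlabel (Delta Q) ` verts (convex hull (?E ` A)) = var ` A" for A
  proof -
    have "verts (convex hull (?E ` A)) = ?E ` A"
      unfolding verts_def extreme_point_of_convex_hull_affine_independent[OF indep] by simp
    moreover have "vlabel (Delta Q) (?E v) = var v" for v
      by (simp add: Delta_def axis_eq_axis)
    ultimately show ?thesis by (simp add: image_image)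
  qed
  ultimately show ?thesis unfolding label_cells_def by (simp add: image_image)
qed

definition label_product :: "'v monomial set \<Rightarrow> 'v monomial set \<Rightarrow> 'v monomial set" where
  "label_product A B = (\<lambda>(a, b). a + b) ` (A \<times> B)"

lemma verts_Times: "verts (F \<times> G) = verts F \<times> verts (G :: 'b::euclidean_space set)"
  for F :: "'a::euclidean_space set"
proof -
  have "(a, b) \<in> verts (F \<times> G) \<longleftrightarrow> a \<in> verts F \<and> b \<in> verts G" for a b
    unfolding verts_def mem_Collect_eq face_of_singleton[symmetric]
    using face_of_Times_eq[of "{a}" "{b}" F G] by simp
  then show ?thesis by auto
qed

lemma image_Times_image: "(\<lambda>(a, b). h a b) ` (f ` A \<times> g ` B) = (\<lambda>(x, y). h (f x) (g y)) ` (A \<times> B)"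
proof -
  have "f ` A \<times> g ` B = (\<lambda>(x, y). (f x, g y)) ` (A \<times> B)" by auto
  then show ?thesis by (simp only: image_image) (simp add: case_prod_beta)
qed

lemma label_cells_lprod:
  "label_cells (lprod K L) = (\<lambda>(A, B). label_product A B) ` (label_cells K \<times> label_cells L)"
proof -
  have prod: "vlabel (lprod K L) ` verts (F \<times> G) = label_product (vlabel K ` verts F) (vlabel L ` verts G)" for F G
    unfolding verts_Times label_product_def image_Times_image by (simp add: lprod_def)
  have cells: "cells (lprod K L) = (\<lambda>(F, G). F \<times> G) ` (cells K \<times> cells L)"
    by (auto simp: lprod_def)
  show ?thesis
    unfolding label_cells_def image_Times_image cells image_image
    by (simp add: case_prod_beta prod)
qed

lemma plabel_picks_one:
  assumes D: "D \<in> row_chains \<beta> W 1"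
  shows "plabel 1 ` picks 1 D = var ` (D `` {0})"
proof
  show "plabel 1 ` picks 1 D \<subseteq> var ` (D `` {0})"
    by (auto simp: plabel_def picks_iff)
  show "var ` (D `` {0}) \<subseteq> plabel 1 ` picks 1 D"
  proof
    fix y assume "y \<in> var ` (D `` {0})"
    then obtain a where a: "(0, a) \<in> D" "y = var a" by blast
    obtain s where s: "s \<in> picks 1 D" "s 0 = a" using picks_through[OF D a(1)] by blast
    have "plabel 1 s = y" using s a by (simp add: plabel_def)
    then show "y \<in> plabel 1 ` picks 1 D" using s by blast
  qed
qed

text \<open>Splitting off the last row is the product with a simplex in the recursion.\<close>

lemma plabel_picks_Suc:
  "plabel (Suc m) ` picks (Suc m) D = label_product (plabel m ` picks m D) (var ` (D `` {m}))"
proof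
  show "plabel (Suc m) ` picks (Suc m) D \<subseteq> label_product (plabel m ` picks m D) (var ` (D `` {m}))"
  proof
    fix y assume "y \<in> plabel (Suc m) ` picks (Suc m) D"
    then obtain s where s: "s \<in> picks (Suc m) D" "y = plabel (Suc m) s" by blast
    have r: "restrict s {..<m} \<in> picks m D" using s(1) by (auto simp: picks_iff)
    have "y = plabel m (restrict s {..<m}) + var (s m)" by (simp add: s(2) plabel_def)
    moreover have "s m \<in> D `` {m}" using s(1) by (auto simp: picks_iff)
    ultimately show "y \<in> label_product (plabel m ` picks m D) (var ` (D `` {m}))"
      unfolding label_product_def using r by blast
  qed
  show "label_product (plabel m ` picks m D) (var ` (D `` {m})) \<subseteq> plabel (Suc m) ` picks (Suc m) D"
  proof
    fix y assume "y \<in> label_product (plabel m ` picks m D) (var ` (D `` {m}))"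
    then obtain s a where sa: "s \<in> picks m D" "(m, a) \<in> D" "y = plabel m s + var a"
      by (auto simp: label_product_def)
    have "s(m := a) \<in> picks (Suc m) D"
      using sa(1,2) by (auto simp: picks_iff less_Suc_eq extensional_def)
    moreover have "plabel (Suc m) (s(m := a)) = y" by (simp add: sa(3) plabel_def)
    ultimately show "y \<in> plabel (Suc m) ` picks (Suc m) D" by blast
  qed
qed

text \<open>Blocks start at 1 and increase strictly from row to row; this gives the lower end of the
  range of the union.\<close>

lemma chain_row_bound:
  assumes D: "D \<in> row_chains \<beta> W q" and \<beta>1: "\<And>v. 1 \<le> \<beta> v" and "(k, a) \<in> D"
  shows "Suc k \<le> \<beta> a"
  using assms(3)
proof (induction k arbitrary: a)
  case 0
  then show ?case using \<beta>1[of a] by simp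
next
  case (Suc k)
  then have "k < q" using row_chainsD(1)[OF D] by auto
  then obtain c where c: "(k, c) \<in> D" using row_chainsD(2)[OF D] by blast
  then have "\<beta> c < \<beta> a" using row_chainsD(3)[OF D c Suc.prems] by simp
  then show ?case using Suc.IH[OF c] by simp
qed

text \<open>The index \<open>i\<close> of the union is a cut between the blocks of the last two
  rows. It need not be unique, which is why the pieces of the union overlap.\<close>

lemma row_chains_Suc_iff:
  assumes \<beta>1: "\<And>v. 1 \<le> \<beta> v" and m: "1 \<le> m"
  shows "D \<in> row_chains \<beta> {v. \<beta> v \<le> p} (Suc m) \<longleftrightarrow>
    (\<exists>i E A. m \<le> i \<and> i < p \<and> E \<in> row_chains \<beta> {v. \<beta> v \<le> i} m \<and> A \<noteq> {} \<and>
       A \<subseteq> {v. i < \<beta> v \<and> \<beta> v \<le> p} \<and> D = E \<union> {m} \<times> A)"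
proof
  assume D: "D \<in> row_chains \<beta> {v. \<beta> v \<le> p} (Suc m)"
  define R where "R = D `` {m - 1}"
  \<comment> \<open>The least possible cut: the highest block met in row \<open>m - 1\<close>, the
    last one before row \<open>m\<close>.\<close>
  define i where "i = Max (\<beta> ` R)"
  obtain c0 where "(m - 1, c0) \<in> D" using row_chainsD(2)[OF D, of "m - 1"] by fastforce
  then have "R \<noteq> {}" unfolding R_def by blast
  have bound: "\<beta> a \<le> p" if "(k, a) \<in> D" for k a using row_chainsD(1)[OF D] that by auto
  have "finite (\<beta> ` R)" by (rule finite_subset[of _ "{..p}"]) (auto simp: R_def bound)
  then have i_in: "i \<in> \<beta> ` R" and i_max: "\<And>a. a \<in> R \<Longrightarrow> \<beta> a \<le> i"
    using \<open>R \<noteq> {}\<close> by (auto simp: i_def)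
  then obtain c where c: "(m - 1, c) \<in> D" "\<beta> c = i" by (auto simp: R_def)
  define E where "E = D \<inter> {..<m} \<times> UNIV"
  define A where "A = D `` {m}"
  have DEA: "D = E \<union> {m} \<times> A"
    using row_chainsD(1)[OF D] by (auto simp: E_def A_def less_Suc_eq)
  have "m \<le> i" using chain_row_bound[OF D \<beta>1 c(1)] c(2) m by simp
  obtain a where a: "(m, a) \<in> D" using row_chainsD(2)[OF D, of m] by blast
  then have "A \<noteq> {}" by (auto simp: A_def)
  have up: "i < \<beta> a" if "(m, a) \<in> D" for a
    using row_chainsD(3)[OF D c(1) that] c(2) m by simp
  then have "A \<subseteq> {v. i < \<beta> v \<and> \<beta> v \<le> p}" using bound by (auto simp: A_def)
  moreover have "i < p" using up[OF a] bound[OF a] by simp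
  moreover have "E \<in> row_chains \<beta> {v. \<beta> v \<le> i} m"
    unfolding row_chains_def
  proof (intro CollectI conjI allI impI)
    show "E \<subseteq> {..<m} \<times> {v. \<beta> v \<le> i}"
    proof
      fix d assume d: "d \<in> E"
      obtain k v where kv: "d = (k, v)" by force
      have "\<beta> v \<le> i"
      proof (cases "k = m - 1")
        case True
        then show ?thesis using d kv i_max by (auto simp: E_def R_def)
      next
        case False
        then have "k < m - 1" "(k, v) \<in> D" using d kv by (auto simp: E_def)
        then show ?thesis using row_chainsD(3)[OF D _ c(1)] c(2) by fastforce
      qed
      then show "d \<in> {..<m} \<times> {v. \<beta> v \<le> i}" using d kv by (auto simp: E_def)
    qed
    show "E `` {k} \<noteq> {}" if "k < m" for k
      using row_chainsD(2)[OF D, of k] that by (auto simp: E_def)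
    show "\<beta> x < \<beta> y" if "(k, x) \<in> E" "(l, y) \<in> E" "k < l" for k l x y
      using row_chainsD(3)[OF D, of k x l y] that by (auto simp: E_def)
  qed
  ultimately show "\<exists>i E A. m \<le> i \<and> i < p \<and> E \<in> row_chains \<beta> {v. \<beta> v \<le> i} m \<and> A \<noteq> {} \<and>
       A \<subseteq> {v. i < \<beta> v \<and> \<beta> v \<le> p} \<and> D = E \<union> {m} \<times> A"
    using \<open>m \<le> i\<close> \<open>A \<noteq> {}\<close> DEA by blast
next
  assume "\<exists>i E A. m \<le> i \<and> i < p \<and> E \<in> row_chains \<beta> {v. \<beta> v \<le> i} m \<and> A \<noteq> {} \<and>
       A \<subseteq> {v. i < \<beta> v \<and> \<beta> v \<le> p} \<and> D = E \<union> {m} \<times> A"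
  then obtain i E A where i: "i < p" and E: "E \<in> row_chains \<beta> {v. \<beta> v \<le> i} m" and A: "A \<noteq> {}"
    "A \<subseteq> {v. i < \<beta> v \<and> \<beta> v \<le> p}" and D: "D = E \<union> {m} \<times> A" by blast
  have Eb: "k < m \<and> \<beta> v \<le> i" if "(k, v) \<in> E" for k v using row_chainsD(1)[OF E] that by auto
  show "D \<in> row_chains \<beta> {v. \<beta> v \<le> p} (Suc m)"
    unfolding row_chains_def
  proof (intro CollectI conjI allI impI)
    show "D \<subseteq> {..<Suc m} \<times> {v. \<beta> v \<le> p}" using Eb A i by (fastforce simp: D)
    show "D `` {k} \<noteq> {}" if "k < Suc m" for k
    proof (cases "k = m")
      case True
      then show ?thesis using A by (auto simp: D)
    next
      case False
      then obtain a where "(k, a) \<in> E" using row_chainsD(2)[OF E, of k] \<open>k < Suc m\<close> by auto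
      then show ?thesis by (auto simp: D)
    qed
    fix k l a c assume ka: "(k, a) \<in> D" and lc: "(l, c) \<in> D" and kl: "k < l"
    have l: "l \<le> m" using lc Eb by (auto simp: D dest: less_imp_le)
    then have a: "(k, a) \<in> E" using ka kl by (auto simp: D)
    show "\<beta> a < \<beta> c"
    proof (cases "l = m")
      case True
      then have "c \<in> A" using lc Eb by (auto simp: D)
      then show ?thesis using A Eb[OF a] by auto
    next
      case False
      then show ?thesis using lc row_chainsD(3)[OF E a _ kl] by (auto simp: D)
    qed
  qed
qed

section \<open>The recursion in terms of label sets, and initial segments of ranks\<close>

context ranking
begin

lemma label_cells_one: "label_cells (\<K> W 1) = label_cells (Delta W)"
  unfolding label_cells_chain_complex label_cells_Delta
proof
  show "insert {} ((\<lambda>D. plabel 1 ` picks 1 D) ` \<C> W 1) \<subseteq> (\<lambda>A. var ` A) ` Pow W"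
  proof
    fix Y assume "Y \<in> insert {} ((\<lambda>D. plabel 1 ` picks 1 D) ` \<C> W 1)"
    then consider "Y = {}" | D where "D \<in> \<C> W 1" "Y = plabel 1 ` picks 1 D" by blast
    then show "Y \<in> (\<lambda>A. var ` A) ` Pow W"
    proof cases
      case (2 D)
      then show ?thesis using plabel_picks_one[OF 2(1)] row_chainsD(1)[OF 2(1)] by auto
    qed auto
  qed
  show "(\<lambda>A. var ` A) ` Pow W \<subseteq> insert {} ((\<lambda>D. plabel 1 ` picks 1 D) ` \<C> W 1)"
  proof
    fix Y :: "'v monomial set" assume "Y \<in> (\<lambda>A. var ` A) ` Pow W"
    then obtain A where A: "A \<subseteq> W" "Y = var ` A" by blast
    show "Y \<in> insert {} ((\<lambda>D. plabel 1 ` picks 1 D) ` \<C> W 1)"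
    proof (cases "A = {}")
      case False
      then have D: "{0} \<times> A \<in> \<C> W 1" using A(1) by (auto simp: row_chains_def)
      have "({0::nat} \<times> A) `` {0} = A" by auto
      then have "plabel 1 ` picks 1 ({0} \<times> A) = Y" using plabel_picks_one[OF D] A(2) by simp
      then show ?thesis using D by blast
    qed (use A in simp)
  qed
qed

lemma label_cells_Suc:
  assumes \<beta>1: "\<And>v. 1 \<le> \<beta> v" and m: "1 \<le> m" "m < p"
  shows "label_cells (\<K> {v. \<beta> v \<le> p} (Suc m)) =
    (\<Union>i\<in>{m..p - 1}. label_cells (lprod (\<K> {v. \<beta> v \<le> i} m) (Delta {v. i < \<beta> v \<and> \<beta> v \<le> p})))"
  (is "?L = ?R")
proof -
  have prod_eq: "plabel (Suc m) ` picks (Suc m) (E \<union> {m} \<times> A) = label_product (plabel m ` picks m E) (var ` A)"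
    if E: "E \<in> \<C> W m" for E A W
  proof -
    have "picks m (E \<union> {m} \<times> A) = picks m E" by (auto simp: picks_iff)
    moreover have "(E \<union> {m} \<times> A) `` {m} = A" using row_chainsD(1)[OF E] by auto
    ultimately show ?thesis unfolding plabel_picks_Suc by simp
  qed
  show ?thesis
  proof
    show "?L \<subseteq> ?R"
    proof
      fix Y assume "Y \<in> ?L"
      then consider "Y = {}" | D where "D \<in> \<C> {v. \<beta> v \<le> p} (Suc m)" "Y = plabel (Suc m) ` picks (Suc m) D"
        unfolding label_cells_chain_complex by blast
      then show "Y \<in> ?R"
      proof cases
        case 1
        \<comment> \<open>The empty face must occur in some piece; \<open>m < p\<close> guarantees
          that there is one, with \<open>i = m\<close>.\<close>
        have "Y = label_product {} {}" using 1 by (simp add: label_product_def)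
        moreover have "{} \<in> label_cells (Delta {v. m < \<beta> v \<and> \<beta> v \<le> p})" by (auto simp: label_cells_Delta)
        moreover have "{} \<in> label_cells (\<K> {v. \<beta> v \<le> m} m)" by (simp add: label_cells_chain_complex)
        ultimately have "Y \<in> label_cells (lprod (\<K> {v. \<beta> v \<le> m} m) (Delta {v. m < \<beta> v \<and> \<beta> v \<le> p}))"
          unfolding label_cells_lprod by blast
        moreover have "m \<in> {m..p - 1}" using m by auto
        ultimately show ?thesis by blast
      next
        case (2 D)
        obtain i E A where i: "m \<le> i" "i < p" and E: "E \<in> \<C> {v. \<beta> v \<le> i} m"
          and A: "A \<subseteq> {v. i < \<beta> v \<and> \<beta> v \<le> p}" and D: "D = E \<union> {m} \<times> A"
          using row_chains_Suc_iff[of \<beta> m, OF \<beta>1 m(1)] 2(1) by auto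
        have "Y = label_product (plabel m ` picks m E) (var ` A)" using 2(2) prod_eq[OF E] D by simp
        moreover have "var ` A \<in> label_cells (Delta {v. i < \<beta> v \<and> \<beta> v \<le> p})" using A by (auto simp: label_cells_Delta)
        moreover have "plabel m ` picks m E \<in> label_cells (\<K> {v. \<beta> v \<le> i} m)"
          using E by (simp add: label_cells_chain_complex)
        ultimately have "Y \<in> label_cells (lprod (\<K> {v. \<beta> v \<le> i} m) (Delta {v. i < \<beta> v \<and> \<beta> v \<le> p}))"
          unfolding label_cells_lprod by blast
        moreover have "i \<in> {m..p - 1}" using i by auto
        ultimately show ?thesis by blast
      qed
    qed
    show "?R \<subseteq> ?L"
    proof
      fix Y assume "Y \<in> ?R"
      then obtain i X Z where i: "i \<in> {m..p - 1}" and Y: "Y = label_product X Z"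
        and X: "X \<in> label_cells (\<K> {v. \<beta> v \<le> i} m)"
        and Z: "Z \<in> label_cells (Delta {v. i < \<beta> v \<and> \<beta> v \<le> p})"
        unfolding label_cells_lprod by (elim UN_E imageE) auto
      obtain A where A: "A \<subseteq> {v. i < \<beta> v \<and> \<beta> v \<le> p}" "Z = var ` A"
        using Z by (auto simp: label_cells_Delta)
      show "Y \<in> ?L"
      proof (cases "X = {} \<or> A = {}")
        case True
        then have "Y = {}" using Y A by (auto simp: label_product_def)
        then show ?thesis by (simp add: label_cells_chain_complex)
      next
        case False
        then obtain E where E: "E \<in> \<C> {v. \<beta> v \<le> i} m" "X = plabel m ` picks m E"
          using X by (auto simp: label_cells_chain_complex)
        have ip: "m \<le> i" "i < p" using i m by auto
        have "E \<union> {m} \<times> A \<in> \<C> {v. \<beta> v \<le> p} (Suc m)"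
          unfolding row_chains_Suc_iff[of \<beta> m, OF \<beta>1 m(1)] using ip E(1) A(1) False by blast
        then have "plabel (Suc m) ` picks (Suc m) (E \<union> {m} \<times> A) \<in> ?L"
          unfolding label_cells_chain_complex by blast
        then show ?thesis using prod_eq[OF E(1)] Y A(2) E(2) by simp
      qed
    qed
  qed
qed

lemma label_cells_mono:
  "W \<subseteq> W' \<Longrightarrow> label_cells (\<K> W q) \<subseteq> label_cells (\<K> W' q)"
  unfolding label_cells_chain_complex using row_chains_mono[of _ \<beta> W q W'] by blast

text \<open>The ranking respects blocks, so any rank below that of a variable of the first
  \<open>p\<close> blocks belongs to such a variable. This yields the embedding dimension for every
  \<open>p\<close>.\<close>

lemma rank_image_initial: "r ` {v. \<beta> v \<le> p} = {..<card {v. \<beta> v \<le> p}}"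
proof -
  let ?W = "{v. \<beta> v \<le> p}"
  have down: "n \<in> r ` ?W" if "n < r v" "v \<in> ?W" for n v
  proof -
    have "r v < CARD('v)" using r_bij by (auto simp: bij_betw_def)
    then have "n \<in> r ` UNIV" using r_bij that(1) by (simp add: bij_betw_def)
    then obtain u where u: "r u = n" by blast
    then have "\<beta> u \<le> \<beta> v" using \<beta>_mono that(1) by simp
    then show ?thesis using that(2) u by auto
  qed
  have "\<exists>k. r ` ?W = {..<k}"
  proof (cases "?W = {}")
    case False
    let ?M = "Max (r ` ?W)"
    have "?M \<in> r ` ?W" using False by (intro Max_in) auto
    then obtain w where w: "w \<in> ?W" "r w = ?M" by auto
    have "r ` ?W = {..<Suc ?M}"
    proof
      show "r ` ?W \<subseteq> {..<Suc ?M}" by (auto simp: less_Suc_eq_le intro!: Max_ge)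
      show "{..<Suc ?M} \<subseteq> r ` ?W"
      proof
        fix n assume "n \<in> {..<Suc ?M}"
        then have "n < r w \<or> n = r w" using w(2) by auto
        then show "n \<in> r ` ?W" using down[OF _ w(1)] w(1) by blast
      qed
    qed
    then show ?thesis by blast
  qed auto
  then obtain k where k: "r ` ?W = {..<k}" by blast
  have "card (r ` ?W) = card ?W" by (rule card_image) (simp add: inj_on_def)
  then show ?thesis using k by simp
qed

end

section \<open>Numbering of the variables\<close>

text \<open>The rank is the number of variables with smaller key. It is injective with values below
  the number of variables, hence bijective.\<close>

lemma ex_ranking:
  fixes key :: "'v::finite \<Rightarrow> nat"
  assumes "inj key"
  shows "\<exists>r. bij_betw r UNIV {..<CARD('v)} \<and> (\<forall>u v. key u < key v \<longrightarrow> r u < r v)"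
proof (intro exI conjI allI impI)
  let ?r = "\<lambda>v. card {u. key u < key v}"
  show mono: "?r u < ?r v" if "key u < key v" for u v
    using that by (intro psubset_card_mono) auto
  have "inj ?r"
  proof (rule injI)
    fix u v assume "?r u = ?r v"
    then have "\<not> key u < key v" "\<not> key v < key u" using mono[of u v] mono[of v u] by auto
    then show "u = v" using injD[OF assms] by simp
  qed
  moreover have "range ?r \<subseteq> {..<CARD('v)}"
    by (auto intro!: psubset_card_mono)
  ultimately show "bij_betw ?r UNIV {..<CARD('v)}"
    unfolding bij_betw_def by (metis card_image card_lessThan card_subset_eq finite_lessThan)
qed

theorem theorem3p3:
  fixes n t :: nat and b :: "nat \<Rightarrow> nat" and x :: "nat \<Rightarrow> nat \<Rightarrow> 'v::finite"
  assumes t: "1 \<le> t" "t \<le> n"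
    and b: "1 \<le> b 1" "\<And>i j. 1 \<le> i \<Longrightarrow> i \<le> j \<Longrightarrow> j \<le> n \<Longrightarrow> b i \<le> b j"
    and x: "bij_betw (\<lambda>(j, l). x j l) (SIGMA j:{1..n}. {1..b j}) UNIV"
  shows "\<exists>\<Gamma> :: nat \<Rightarrow> nat \<Rightarrow> (real^'v, 'v) labeled_complex.
     (\<forall>p q. 1 \<le> q \<and> q \<le> p \<and> p \<le> n \<longrightarrow>
        polytopal_complex (cells (\<Gamma> p q)) \<and>
        labeled_by (\<Gamma> p q) (min_gens (I_ideal (block x b) p q :: ('v, 'k::field) mpoly set)) \<and>
        lies_in_Rd ((\<Sum>j=1..p. b j) - q) (\<Gamma> p q)) \<and>
     (\<exists>\<epsilon>. incidence_function (cells (\<Gamma> n t)) \<epsilon> \<and>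
        supports_minimal_free_resolution (\<Gamma> n t) \<epsilon>
          (I_ideal (block x b) n t :: ('v, 'k) mpoly set) \<and>
        fine_graded TYPE('k) (\<Gamma> n t) \<epsilon> \<and>
        Zt_graded TYPE('k) t (\<Gamma> n t) \<epsilon>) \<and>
     (\<forall>p. 1 \<le> p \<and> p \<le> n \<longrightarrow>
        label_cells (\<Gamma> p 1) = label_cells (Delta (\<Union>j\<in>{1..p}. block x b j))) \<and>
     (\<forall>p q. 2 \<le> q \<and> q \<le> p \<and> p \<le> n \<longrightarrow>
        label_cells (\<Gamma> p q) =
          (\<Union>i\<in>{q-1..p-1}.
             label_cells (lprod (\<Gamma> i (q-1)) (Delta (\<Union>j\<in>{i+1..p}. block x b j))))) \<and>
     (\<forall>s. t \<le> s \<and> s \<le> n \<longrightarrow> connected (\<Union>(cells (\<Gamma> s t)))) \<and>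
     (\<forall>s. t \<le> s \<and> s \<le> n - 1 \<longrightarrow> label_cells (\<Gamma> s t) \<subseteq> label_cells (\<Gamma> (s+1) t))"
proof -
  let ?S = "SIGMA j:{1..n}. {1..b j}"
  define idx where "idx = inv_into ?S (\<lambda>(j, l). x j l)"
  define \<beta> where "\<beta> v = fst (idx v)" for v
  have idx_in: "idx v \<in> ?S" for v
    unfolding idx_def by (rule inv_into_into) (use x in \<open>auto simp: bij_betw_def\<close>)
  have x_idx: "x (\<beta> v) (snd (idx v)) = v" for v
    using f_inv_into_f[of v "\<lambda>(j, l). x j l" ?S] x by (auto simp: bij_betw_def \<beta>_def idx_def case_prod_beta)
  have idx_x: "idx (x j l) = (j, l)" if "1 \<le> j" "j \<le> n" "1 \<le> l" "l \<le> b j" for j l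
    using inv_into_f_f[of "\<lambda>(j, l). x j l" ?S "(j, l)"] x that by (auto simp: bij_betw_def idx_def)
  have \<beta>1: "1 \<le> \<beta> v" "\<beta> v \<le> n" "1 \<le> snd (idx v)" "snd (idx v) \<le> b (\<beta> v)" for v
    using idx_in[of v] by (auto simp: \<beta>_def mem_Sigma_iff split_beta)
  have \<beta>x: "\<beta> (x j l) = j" if "1 \<le> j" "j \<le> n" "1 \<le> l" "l \<le> b j" for j l
    using idx_x[OF that] by (simp add: \<beta>_def)
  have block: "block x b j = {v. \<beta> v = j}" if "1 \<le> j" "j \<le> n" for j
  proof
    show "block x b j \<subseteq> {v. \<beta> v = j}" using \<beta>x that by (auto simp: block_def)
    show "{v. \<beta> v = j} \<subseteq> block x b j"
    proof
      fix v assume "v \<in> {v. \<beta> v = j}"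
      then have "v = x j (snd (idx v))" "snd (idx v) \<in> {1..b j}" using x_idx[of v] \<beta>1[of v] by auto
      then show "v \<in> block x b j" unfolding block_def by blast
    qed
  qed
  have blocks: "(\<Union>j\<in>{i+1..p}. block x b j) = {v. i < \<beta> v \<and> \<beta> v \<le> p}" if "p \<le> n" for i p
    using block that by auto
  have blocks1: "(\<Union>j\<in>{1..p}. block x b j) = {v. \<beta> v \<le> p}" if "p \<le> n" for p
    using block that \<beta>1 by auto
  have card_blocks: "card {v. \<beta> v \<le> p} = (\<Sum>j=1..p. b j)" if p: "p \<le> n" for p
  proof -
    have "card (\<Union>j\<in>{1..p}. block x b j) = (\<Sum>j\<in>{1..p}. card (block x b j))"
      by (rule card_UN_disjoint) (use block p in auto)
    also have "\<dots> = (\<Sum>j=1..p. b j)"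
    proof (intro sum.cong refl)
      fix j assume j: "j \<in> {1..p}"
      have "inj_on (x j) {1..b j}"
      proof (rule inj_onI)
        fix l l' assume l: "l \<in> {1..b j}" "l' \<in> {1..b j}" "x j l = x j l'"
        have j': "1 \<le> j" "j \<le> n" and l': "1 \<le> l" "l \<le> b j" "1 \<le> l'" "l' \<le> b j"
          using j l(1,2) p by auto
        have "(j, l) = (j, l')"
          unfolding idx_x[OF j' l'(1,2), symmetric] idx_x[OF j' l'(3,4), symmetric] l(3) ..
        then show "l = l'" by simp
      qed
      then show "card (block x b j) = b j" by (simp add: block_def card_image)
    qed
    finally show ?thesis using blocks1[OF p] by simp
  qed
  \<comment> \<open>\<open>K\<close> exceeds all positions within blocks, so \<open>key\<close>
    orders the variables by block and then by position.\<close>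
  define K where "K = Suc (Max (range (\<lambda>v. snd (idx v))))"
  have K: "snd (idx v) < K" for v by (simp add: K_def less_Suc_eq_le)
  define key where "key v = \<beta> v * K + snd (idx v)" for v
  have key_mono: "key u < key v" if "\<beta> u < \<beta> v" for u v
  proof -
    have "key u < (Suc (\<beta> u)) * K" using K[of u] by (simp add: key_def)
    also have "\<dots> \<le> \<beta> v * K" using that by (intro mult_right_mono) auto
    finally show ?thesis by (simp add: key_def)
  qed
  have "inj key"
  proof (rule injI)
    fix u v assume eq: "key u = key v"
    then have "\<beta> u = \<beta> v" using key_mono[of u v] key_mono[of v u] by (metis less_irrefl linorder_neqE_nat)
    moreover from this have "snd (idx u) = snd (idx v)" using eq by (simp add: key_def)
    ultimately show "u = v" using x_idx by metis
  qed
  then obtain r where r: "bij_betw r UNIV {..<CARD('v)}" "\<And>u v. key u < key v \<Longrightarrow> r u < r v"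
    using ex_ranking by blast
  interpret ranking r \<beta>
    by unfold_locales (use r key_mono in auto)
  \<comment> \<open>One numbering serves all \<open>p\<close> and \<open>q\<close>, so the complexes
    for growing \<open>p\<close> are nested.\<close>
  define \<Gamma> where "\<Gamma> p q = chain_complex r \<beta> {v. \<beta> v \<le> p} q" for p q
  have ideal: "I_ideal (block x b) p q = (ideal_gen (mon ` plabel q ` vpicks \<beta> {v. \<beta> v \<le> p} q) :: ('v, 'k) mpoly set)"
    if "p \<le> n" for p q
    by (rule I_ideal_eq) (use block that \<beta>1 in auto)
  show ?thesis
  proof (rule exI[of _ \<Gamma>], intro conjI allI impI)
    fix p q assume pq: "1 \<le> q \<and> q \<le> p \<and> p \<le> n"
    show "polytopal_complex (cells (\<Gamma> p q))"
      unfolding \<Gamma>_def by (rule polytopal_chain_complex)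
    show "labeled_by (\<Gamma> p q) (min_gens (I_ideal (block x b) p q :: ('v, 'k) mpoly set))"
      unfolding ideal[OF conjunct2[OF conjunct2[OF pq]]] min_gens_chain_ideal \<Gamma>_def
      by (rule labeled_by_chain_complex)
    show "lies_in_Rd ((\<Sum>j=1..p. b j) - q) (\<Gamma> p q)"
      unfolding \<Gamma>_def using lies_in_Rd_chain_complex[OF _ rank_image_initial, of q p] pq card_blocks[of p] by simp
  next
    show "\<exists>\<epsilon>. incidence_function (cells (\<Gamma> n t)) \<epsilon> \<and>
        supports_minimal_free_resolution (\<Gamma> n t) \<epsilon> (I_ideal (block x b) n t :: ('v, 'k) mpoly set) \<and>
        fine_graded TYPE('k) (\<Gamma> n t) \<epsilon> \<and> Zt_graded TYPE('k) t (\<Gamma> n t) \<epsilon>"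
      unfolding \<Gamma>_def ideal[OF order_refl] fine_graded_def Zt_graded_def
      by (intro exI[of _ "chain_incidence r \<beta> t"] conjI allI incidence_function_chain_complex
          chain_complex_supports_resolution chain_complex_graded)
  next
    fix p assume "1 \<le> p \<and> p \<le> n"
    then show "label_cells (\<Gamma> p 1) = label_cells (Delta (\<Union>j\<in>{1..p}. block x b j))"
      unfolding \<Gamma>_def using blocks1[of p] label_cells_one by simp
  next
    fix p q assume pq: "2 \<le> q \<and> q \<le> p \<and> p \<le> n"
    have "(\<Union>j\<in>{i+1..p}. block x b j) = {v. i < \<beta> v \<and> \<beta> v \<le> p}" for i
      using blocks pq by simp
    moreover have "1 \<le> q - 1" "q - 1 < p" "Suc (q - 1) = q" using pq by auto
    ultimately show "label_cells (\<Gamma> p q) = (\<Union>i\<in>{q-1..p-1}.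
        label_cells (lprod (\<Gamma> i (q-1)) (Delta (\<Union>j\<in>{i+1..p}. block x b j))))"
      unfolding \<Gamma>_def using label_cells_Suc[of "q - 1" p] \<beta>1(1) by simp
  next
    fix s assume s: "t \<le> s \<and> s \<le> n"
    \<comment> \<open>The first block is nonempty and block sizes do not decrease, so every block
      has a first variable. The first variables of the blocks 1 to \<open>t\<close> form the vertex
      to which all others are joined.\<close>
    have b1: "1 \<le> b j" if "1 \<le> j" "j \<le> n" for j using b(1) b(2)[of 1 j] that by simp
    show "connected (\<Union>(cells (\<Gamma> s t)))"
      unfolding \<Gamma>_def
    proof (rule connected_chain_complex)
      show "1 \<le> \<beta> v" for v by (rule \<beta>1)
      fix k assume "k < t"
      then have "\<beta> (x (Suc k) 1) = Suc k" "Suc k \<le> s" using s b1[of "Suc k"] by (auto intro!: \<beta>x)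
      then show "x (Suc k) 1 \<in> {v. \<beta> v \<le> s} \<and> \<beta> (x (Suc k) 1) = Suc k" by simp
    qed
  next
    fix s assume "t \<le> s \<and> s \<le> n - 1"
    show "label_cells (\<Gamma> s t) \<subseteq> label_cells (\<Gamma> (s + 1) t)"
      unfolding \<Gamma>_def by (rule label_cells_mono) auto
  qed
qed

end
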